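(* Let $(\mathcal N,P,h)$ be a 2-dimensional almost paracomplex Riemannian manifold with associated metric $\widetilde h(x',y')=h(x',Py')$, and let $(\mathcal S(\mathcal N),\phi,\xi,\eta,g)$ be the 3-dimensional apapR manifold with $\mathcal S(\mathcal N)=\mathbb R^+\times\mathcal N$, $\phi(x',a\tfrac{d}{dt})=(Px',0)$, $\xi=\tfrac{d}{dt}$, $\eta=dt$ and $g=dt^2+\cosh 2t\,h+\sinh 2t\,\widetilde h$. Then $(\mathcal S(\mathcal N),\phi,\xi,\eta,g)$ has the following properties: (1) it has constant negative $\xi$-sectional curvatures, i.e. there is a constant $c<0$ such that every 2-plane containing $\xi$, at every point, has sectional curvature $c$; (2) it is $*$-scalar flat, i.e. $\tau^*=0$.
   Context: An almost paracomplex Riemannian manifold $(\mathcal N,P,h)$ of dimension $2n$ is a differentiable manifold with an endomorphism $P$ of $T\mathcal N$ satisfying $P^2=I$, $P\neq I$, $\operatorname{tr}P=0$ and a Riemannian metric $h$ with $h(Px',Py')=h(x',y')$. An almost paracontact almost paracomplex Riemannian manifold (apapR manifold) $(\mathcal M,\phi,\xi,\eta,g)$ is a $(2n+1)$-dimensional differentiable manifold with an endomorphism $\phi$ of $T\mathcal M$, a vector field $\xi$, a 1-form $\eta$ and a Riemannian metric $g$ such that $\phi^2=\mathcal I-\eta\otimes\xi$, $\eta(\xi)=1$, $\eta\circ\phi=0$, $\phi\xi=0$, $\operatorname{tr}\phi=0$, $g(\phi x,\phi y)=g(x,y)-\eta(x)\eta(y)$. Curvature conventions for $g$ with Levi-Civita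 connection $\nabla$: $R(x,y)=[\nabla_x,\nabla_y]-\nabla_{[x,y]}$, $R(x,y,z,w)=g(R(x,y)z,w)$; $\rho^*(y,z)=g^{ij}R(e_i,y,z,\phi e_j)$, $\tau^*=g^{ij}\rho^*(e_i,e_j)$ for any basis $\{e_i\}$ of the tangent space. The sectional curvature of a 2-plane with basis $\{x,y\}$ is $R(x,y,y,x)/\big(g(x,x)g(y,y)-g(x,y)^2\big)$. $\mathbb R^+$ is the set of positive reals, $t$ is its coordinate; tangent vectors of $\mathbb R^+\times\mathcal N$ are written $(x',a\tfrac{d}{dt})$ with $x'$ tangent to $\mathcal N$; $h$ and $\widetilde h$ are pulled back to the product. *)

theory Defs
  imports "HOL-Analysis.Analysis"
begin

section \<open>Smooth maps between Euclidean spaces\<close>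

primrec Ck_on :: "nat \<Rightarrow> 'a::euclidean_space set \<Rightarrow> ('a \<Rightarrow> 'b::real_normed_vector) \<Rightarrow> bool" where
  "Ck_on 0 S f \<longleftrightarrow> continuous_on S f"
| "Ck_on (Suc k) S f \<longleftrightarrow>
     (\<forall>x\<in>S. f differentiable at x) \<and>
     (\<forall>v. Ck_on k S (\<lambda>x. frechet_derivative f (at x) v))"

text \<open>Only used for open \<open>S\<close>.\<close>
definition smooth_on :: "'a::euclidean_space set \<Rightarrow> ('a \<Rightarrow> 'b::real_normed_vector) \<Rightarrow> bool" where
  "smooth_on S f \<longleftrightarrow> (\<forall>k. Ck_on k S f)"


section \<open>Smooth manifolds\<close>

text \<open>
  A chart is a pair \<open>(U, \<psi>)\<close> of a domain and a coordinate map; the values of \<open>\<psi>\<close> outside \<open>U\<close>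
  are irrelevant.  A manifold modelled on the Euclidean space \<open>'e\<close> is a topology \<open>T\<close> together
  with a smooth atlas \<open>A\<close>, which is not required to be maximal.
\<close>
type_synonym ('m, 'e) chart = "'m set \<times> ('m \<Rightarrow> 'e)"

definition chart_inv :: "('m, 'e) chart \<Rightarrow> 'e \<Rightarrow> 'm" where
  "chart_inv c = inv_into (fst c) (snd c)"

definition transition :: "('m, 'e) chart \<Rightarrow> ('m, 'e) chart \<Rightarrow> 'e \<Rightarrow> 'e" where
  "transition c d = snd d \<circ> chart_inv c"

definition charts_at :: "('m, 'e) chart set \<Rightarrow> 'm \<Rightarrow> ('m, 'e) chart set" where
  "charts_at A p = {c \<in> A. p \<in> fst c}"

definition smooth_manifold :: "'m topology \<Rightarrow> ('m, 'e::euclidean_space) chart set \<Rightarrow> bool" where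
  "smooth_manifold T A \<longleftrightarrow>
     Hausdorff_space T \<and> second_countable T \<and>
     (\<Union>c\<in>A. fst c) = topspace T \<and>
     (\<forall>c\<in>A. openin T (fst c) \<and> open (snd c ` fst c) \<and>
        homeomorphic_map (subtopology T (fst c)) (top_of_set (snd c ` fst c)) (snd c)) \<and>
     (\<forall>c\<in>A. \<forall>d\<in>A. smooth_on (snd c ` (fst c \<inter> fst d)) (transition c d))"


section \<open>Tangent vectors, functions and vector fields\<close>

text \<open>
  A tangent vector at \<open>p\<close> is the family of its components in the charts around \<open>p\<close>, subject to the
  contravariant transformation law; the entries at all other charts are \<open>0\<close>.
\<close>
type_synonym ('m, 'e) tvec = "('m, 'e) chart \<Rightarrow> 'e"

type_synonym ('m, 'e) vfield = "'m \<Rightarrow> ('m, 'e) tvec"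

definition tangent_space ::
  "('m, 'e::euclidean_space) chart set \<Rightarrow> 'm \<Rightarrow> ('m, 'e) tvec set" where
  "tangent_space A p = {v.
     (\<forall>c. c \<notin> charts_at A p \<longrightarrow> v c = 0) \<and>
     (\<forall>c\<in>charts_at A p. \<forall>d\<in>charts_at A p.
        v d = frechet_derivative (transition c d) (at (snd c p)) (v c))}"

definition tzero :: "('m, 'e::euclidean_space) tvec" where
  "tzero = (\<lambda>c. 0)"

definition tadd :: "('m, 'e::euclidean_space) tvec \<Rightarrow> ('m, 'e) tvec \<Rightarrow> ('m, 'e) tvec"
  (infixl \<open>+\<^sub>T\<close> 65) where
  "v +\<^sub>T w = (\<lambda>c. v c + w c)"

definition tscale :: "real \<Rightarrow> ('m, 'e::euclidean_space) tvec \<Rightarrow> ('m, 'e) tvec"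
  (infixr \<open>*\<^sub>T\<close> 75) where
  "a *\<^sub>T v = (\<lambda>c. a *\<^sub>R v c)"

abbreviation tminus :: "('m, 'e::euclidean_space) tvec \<Rightarrow> ('m, 'e) tvec \<Rightarrow> ('m, 'e) tvec"
  (infixl \<open>-\<^sub>T\<close> 65) where
  "v -\<^sub>T w \<equiv> v +\<^sub>T (-1) *\<^sub>T w"

text \<open>The vector at \<open>p\<close> whose components in the chart \<open>c\<close> are \<open>u\<close>.\<close>
definition chart_vec ::
  "('m, 'e::euclidean_space) chart set \<Rightarrow> ('m, 'e) chart \<Rightarrow> 'm \<Rightarrow> 'e \<Rightarrow> ('m, 'e) tvec" where
  "chart_vec A c p u = (\<lambda>d. if d \<in> charts_at A p
     then frechet_derivative (transition c d) (at (snd c p)) u else 0)"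

definition smooth_fun_on ::
  "('m, 'e::euclidean_space) chart set \<Rightarrow> 'm set \<Rightarrow> ('m \<Rightarrow> real) \<Rightarrow> bool" where
  "smooth_fun_on A U f \<longleftrightarrow> (\<forall>c\<in>A. smooth_on (snd c ` (fst c \<inter> U)) (\<lambda>x. f (chart_inv c x)))"

text \<open>
  Vector fields are total functions; the predicate concerns their restriction to the open set \<open>U\<close>,
  so it describes the smooth local sections over \<open>U\<close>.
\<close>
definition smooth_vfield_on ::
  "('m, 'e::euclidean_space) chart set \<Rightarrow> 'm set \<Rightarrow> ('m, 'e) vfield \<Rightarrow> bool" where
  "smooth_vfield_on A U X \<longleftrightarrow>
     (\<forall>p\<in>U. X p \<in> tangent_space A p) \<and>
     (\<forall>c\<in>A. smooth_on (snd c ` (fst c \<inter> U)) (\<lambda>x. X (chart_inv c x) c))"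

text \<open>The derivative of \<open>f\<close> at \<open>p\<close> along \<open>v\<close>; by the chain rule any chart around \<open>p\<close> will do.\<close>
definition dir_deriv ::
  "('m, 'e::euclidean_space) chart set \<Rightarrow> 'm \<Rightarrow> ('m, 'e) tvec \<Rightarrow> ('m \<Rightarrow> real) \<Rightarrow> real" where
  "dir_deriv A p v f = (let c = (SOME c. c \<in> charts_at A p) in
     frechet_derivative (\<lambda>x. f (chart_inv c x)) (at (snd c p)) (v c))"

definition lie_bracket ::
  "('m, 'e::euclidean_space) chart set \<Rightarrow> ('m, 'e) vfield \<Rightarrow> ('m, 'e) vfield \<Rightarrow> ('m, 'e) vfield" where
  "lie_bracket A X Y = (\<lambda>p c. if c \<in> charts_at A p
     then frechet_derivative (\<lambda>x. Y (chart_inv c x) c) (at (snd c p)) (X p c)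
        - frechet_derivative (\<lambda>x. X (chart_inv c x) c) (at (snd c p)) (Y p c)
     else 0)"


section \<open>Tensor fields\<close>

definition one_form ::
  "'m topology \<Rightarrow> ('m, 'e::euclidean_space) chart set \<Rightarrow> ('m \<Rightarrow> ('m, 'e) tvec \<Rightarrow> real) \<Rightarrow> bool" where
  "one_form T A \<omega> \<longleftrightarrow>
     (\<forall>p\<in>topspace T. \<forall>x\<in>tangent_space A p. \<forall>y\<in>tangent_space A p. \<forall>a b.
        \<omega> p (a *\<^sub>T x +\<^sub>T b *\<^sub>T y) = a * \<omega> p x + b * \<omega> p y) \<and>
     (\<forall>U X. openin T U \<and> smooth_vfield_on A U X \<longrightarrow> smooth_fun_on A U (\<lambda>p. \<omega> p (X p)))"

definition endomorphism_field ::
  "'m topology \<Rightarrow> ('m, 'e::euclidean_space) chart set \<Rightarrow>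
   ('m \<Rightarrow> ('m, 'e) tvec \<Rightarrow> ('m, 'e) tvec) \<Rightarrow> bool" where
  "endomorphism_field T A F \<longleftrightarrow>
     (\<forall>p\<in>topspace T. \<forall>x\<in>tangent_space A p. F p x \<in> tangent_space A p) \<and>
     (\<forall>p\<in>topspace T. \<forall>x\<in>tangent_space A p. \<forall>y\<in>tangent_space A p. \<forall>a b.
        F p (a *\<^sub>T x +\<^sub>T b *\<^sub>T y) = a *\<^sub>T F p x +\<^sub>T b *\<^sub>T F p y) \<and>
     (\<forall>U X. openin T U \<and> smooth_vfield_on A U X \<longrightarrow> smooth_vfield_on A U (\<lambda>p. F p (X p)))"

text \<open>The trace at \<open>p\<close>, computed in the coordinate basis of the chart \<open>c\<close>.\<close>
definition trace_in_chart ::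
  "('m, 'e::euclidean_space) chart set \<Rightarrow> ('m, 'e) chart \<Rightarrow> 'm \<Rightarrow>
   (('m, 'e) tvec \<Rightarrow> ('m, 'e) tvec) \<Rightarrow> real" where
  "trace_in_chart A c p F = (\<Sum>b\<in>Basis. F (chart_vec A c p b) c \<bullet> b)"

definition traceless ::
  "('m, 'e::euclidean_space) chart set \<Rightarrow> ('m \<Rightarrow> ('m, 'e) tvec \<Rightarrow> ('m, 'e) tvec) \<Rightarrow> bool" where
  "traceless A F \<longleftrightarrow> (\<forall>p. \<forall>c\<in>charts_at A p. trace_in_chart A c p (F p) = 0)"

type_synonym ('m, 'e) form2 = "'m \<Rightarrow> ('m, 'e) tvec \<Rightarrow> ('m, 'e) tvec \<Rightarrow> real"

definition riemannian_metric ::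
  "'m topology \<Rightarrow> ('m, 'e::euclidean_space) chart set \<Rightarrow> ('m, 'e) form2 \<Rightarrow> bool" where
  "riemannian_metric T A g \<longleftrightarrow>
     (\<forall>p\<in>topspace T. \<forall>x\<in>tangent_space A p. \<forall>y\<in>tangent_space A p. \<forall>z\<in>tangent_space A p. \<forall>a b.
        g p (a *\<^sub>T x +\<^sub>T b *\<^sub>T y) z = a * g p x z + b * g p y z) \<and>
     (\<forall>p\<in>topspace T. \<forall>x\<in>tangent_space A p. \<forall>y\<in>tangent_space A p. g p x y = g p y x) \<and>
     (\<forall>p\<in>topspace T. \<forall>x\<in>tangent_space A p. x \<noteq> tzero \<longrightarrow> g p x x > 0) \<and>
     (\<forall>U X Y. openin T U \<and> smooth_vfield_on A U X \<and> smooth_vfield_on A U Y \<longrightarrow>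
        smooth_fun_on A U (\<lambda>p. g p (X p) (Y p)))"


section \<open>Levi-Civita connection and curvature\<close>

text \<open>
  A connection acts on smooth local sections over arbitrary open sets \<open>U\<close>; its value on
  fields that are not smooth near the point in question is unconstrained.
\<close>
definition affine_connection ::
  "'m topology \<Rightarrow> ('m, 'e::euclidean_space) chart set \<Rightarrow>
   (('m, 'e) vfield \<Rightarrow> ('m, 'e) vfield \<Rightarrow> ('m, 'e) vfield) \<Rightarrow> bool" where
  "affine_connection T A nabla \<longleftrightarrow> (\<forall>U. openin T U \<longrightarrow>
     (\<forall>X Y. smooth_vfield_on A U X \<and> smooth_vfield_on A U Y \<longrightarrow>
        smooth_vfield_on A U (nabla X Y)) \<and>
     (\<forall>X X' Y. smooth_vfield_on A U X \<and> smooth_vfield_on A U X' \<and> smooth_vfield_on A U Y \<longrightarrow>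
        (\<forall>p\<in>U. nabla (\<lambda>q. X q +\<^sub>T X' q) Y p = nabla X Y p +\<^sub>T nabla X' Y p)) \<and>
     (\<forall>f X Y. smooth_fun_on A U f \<and> smooth_vfield_on A U X \<and> smooth_vfield_on A U Y \<longrightarrow>
        (\<forall>p\<in>U. nabla (\<lambda>q. f q *\<^sub>T X q) Y p = f p *\<^sub>T nabla X Y p)) \<and>
     (\<forall>X Y Y'. smooth_vfield_on A U X \<and> smooth_vfield_on A U Y \<and> smooth_vfield_on A U Y' \<longrightarrow>
        (\<forall>p\<in>U. nabla X (\<lambda>q. Y q +\<^sub>T Y' q) p = nabla X Y p +\<^sub>T nabla X Y' p)) \<and>
     (\<forall>f X Y. smooth_fun_on A U f \<and> smooth_vfield_on A U X \<and> smooth_vfield_on A U Y \<longrightarrow>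
        (\<forall>p\<in>U. nabla X (\<lambda>q. f q *\<^sub>T Y q) p =
           dir_deriv A p (X p) f *\<^sub>T Y p +\<^sub>T f p *\<^sub>T nabla X Y p)))"

definition levi_civita ::
  "'m topology \<Rightarrow> ('m, 'e::euclidean_space) chart set \<Rightarrow> ('m, 'e) form2 \<Rightarrow>
   (('m, 'e) vfield \<Rightarrow> ('m, 'e) vfield \<Rightarrow> ('m, 'e) vfield) \<Rightarrow> bool" where
  "levi_civita T A g nabla \<longleftrightarrow>
     affine_connection T A nabla \<and>
     (\<forall>U X Y. openin T U \<and> smooth_vfield_on A U X \<and> smooth_vfield_on A U Y \<longrightarrow>
        (\<forall>p\<in>U. nabla X Y p -\<^sub>T nabla Y X p = lie_bracket A X Y p)) \<and>
     (\<forall>U X Y Z. openin T U \<and> smooth_vfield_on A U X \<and> smooth_vfield_on A U Y \<and>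
        smooth_vfield_on A U Z \<longrightarrow>
        (\<forall>p\<in>U. dir_deriv A p (X p) (\<lambda>q. g q (Y q) (Z q)) =
           g p (nabla X Y p) (Z p) + g p (Y p) (nabla X Z p)))"

definition curvature_fields ::
  "('m, 'e::euclidean_space) chart set \<Rightarrow>
   (('m, 'e) vfield \<Rightarrow> ('m, 'e) vfield \<Rightarrow> ('m, 'e) vfield) \<Rightarrow>
   ('m, 'e) vfield \<Rightarrow> ('m, 'e) vfield \<Rightarrow> ('m, 'e) vfield \<Rightarrow> ('m, 'e) vfield" where
  "curvature_fields A nabla X Y Z = (\<lambda>p.
     nabla X (nabla Y Z) p -\<^sub>T nabla Y (nabla X Z) p -\<^sub>T nabla (lie_bracket A X Y) Z p)"

definition local_extension ::
  "'m topology \<Rightarrow> ('m, 'e::euclidean_space) chart set \<Rightarrow> 'm \<Rightarrow> ('m, 'e) tvec \<Rightarrow> ('m, 'e) vfield" where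
  "local_extension T A p x =
     (SOME X. (\<exists>U. openin T U \<and> p \<in> U \<and> smooth_vfield_on A U X) \<and> X p = x)"

text \<open>
  \<open>R(x,y)z\<close> for tangent vectors at \<open>p\<close>: since the curvature is tensorial, it may be evaluated on
  any smooth local extensions.
\<close>
definition curvature_op ::
  "'m topology \<Rightarrow> ('m, 'e::euclidean_space) chart set \<Rightarrow>
   (('m, 'e) vfield \<Rightarrow> ('m, 'e) vfield \<Rightarrow> ('m, 'e) vfield) \<Rightarrow>
   'm \<Rightarrow> ('m, 'e) tvec \<Rightarrow> ('m, 'e) tvec \<Rightarrow> ('m, 'e) tvec \<Rightarrow> ('m, 'e) tvec" where
  "curvature_op T A nabla p x y z =
     curvature_fields A nabla
       (local_extension T A p x) (local_extension T A p y) (local_extension T A p z) p"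

definition curvature ::
  "'m topology \<Rightarrow> ('m, 'e::euclidean_space) chart set \<Rightarrow> ('m, 'e) form2 \<Rightarrow>
   (('m, 'e) vfield \<Rightarrow> ('m, 'e) vfield \<Rightarrow> ('m, 'e) vfield) \<Rightarrow>
   'm \<Rightarrow> ('m, 'e) tvec \<Rightarrow> ('m, 'e) tvec \<Rightarrow> ('m, 'e) tvec \<Rightarrow> ('m, 'e) tvec \<Rightarrow> real" where
  "curvature T A g nabla p x y z w = g p (curvature_op T A nabla p x y z) w"

definition plane_basis ::
  "('m, 'e::euclidean_space) chart set \<Rightarrow> 'm \<Rightarrow> ('m, 'e) tvec \<Rightarrow> ('m, 'e) tvec \<Rightarrow> bool" where
  "plane_basis A p x y \<longleftrightarrow> x \<in> tangent_space A p \<and> y \<in> tangent_space A p \<and>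
     (\<forall>a b. a *\<^sub>T x +\<^sub>T b *\<^sub>T y = tzero \<longrightarrow> a = 0 \<and> b = 0)"

definition tspan2 :: "('m, 'e::euclidean_space) tvec \<Rightarrow> ('m, 'e) tvec \<Rightarrow> ('m, 'e) tvec set" where
  "tspan2 x y = {a *\<^sub>T x +\<^sub>T b *\<^sub>T y | a b. True}"

definition sectional_curvature ::
  "'m topology \<Rightarrow> ('m, 'e::euclidean_space) chart set \<Rightarrow> ('m, 'e) form2 \<Rightarrow>
   (('m, 'e) vfield \<Rightarrow> ('m, 'e) vfield \<Rightarrow> ('m, 'e) vfield) \<Rightarrow>
   'm \<Rightarrow> ('m, 'e) tvec \<Rightarrow> ('m, 'e) tvec \<Rightarrow> real" where
  "sectional_curvature T A g nabla p x y =
     curvature T A g nabla p x y y x / (g p x x * g p y y - (g p x y)\<^sup>2)"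

definition tangent_basis ::
  "('m, 'e::euclidean_space) chart set \<Rightarrow> 'm \<Rightarrow> ('i::finite \<Rightarrow> ('m, 'e) tvec) \<Rightarrow> bool" where
  "tangent_basis A p e \<longleftrightarrow> (\<forall>i. e i \<in> tangent_space A p) \<and>
     (\<forall>v\<in>tangent_space A p. \<exists>!a :: 'i \<Rightarrow> real. v = (\<lambda>c. \<Sum>i\<in>UNIV. a i *\<^sub>R e i c))"

definition inverse_metric ::
  "('m, 'e::euclidean_space) form2 \<Rightarrow> 'm \<Rightarrow> ('i::finite \<Rightarrow> ('m, 'e) tvec) \<Rightarrow> real ^ 'i ^ 'i" where
  "inverse_metric g p e = matrix_inv (\<chi> i j. g p (e i) (e j))"

definition star_ricci ::
  "'m topology \<Rightarrow> ('m, 'e::euclidean_space) chart set \<Rightarrow>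
   ('m \<Rightarrow> ('m, 'e) tvec \<Rightarrow> ('m, 'e) tvec) \<Rightarrow> ('m, 'e) form2 \<Rightarrow>
   (('m, 'e) vfield \<Rightarrow> ('m, 'e) vfield \<Rightarrow> ('m, 'e) vfield) \<Rightarrow>
   'm \<Rightarrow> ('i::finite \<Rightarrow> ('m, 'e) tvec) \<Rightarrow> ('m, 'e) tvec \<Rightarrow> ('m, 'e) tvec \<Rightarrow> real" where
  "star_ricci T A \<phi> g nabla p e y z =
     (\<Sum>i\<in>UNIV. \<Sum>j\<in>UNIV. inverse_metric g p e $ i $ j *
        curvature T A g nabla p (e i) y z (\<phi> p (e j)))"

definition star_scalar ::
  "'m topology \<Rightarrow> ('m, 'e::euclidean_space) chart set \<Rightarrow>
   ('m \<Rightarrow> ('m, 'e) tvec \<Rightarrow> ('m, 'e) tvec) \<Rightarrow> ('m, 'e) form2 \<Rightarrow>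
   (('m, 'e) vfield \<Rightarrow> ('m, 'e) vfield \<Rightarrow> ('m, 'e) vfield) \<Rightarrow>
   'm \<Rightarrow> ('i::finite \<Rightarrow> ('m, 'e) tvec) \<Rightarrow> real" where
  "star_scalar T A \<phi> g nabla p e =
     (\<Sum>i\<in>UNIV. \<Sum>j\<in>UNIV. inverse_metric g p e $ i $ j *
        star_ricci T A \<phi> g nabla p e (e i) (e j))"


section \<open>Almost paracomplex and almost paracontact almost paracomplex structures\<close>

definition almost_paracomplex_riemannian ::
  "'m topology \<Rightarrow> ('m, 'e::euclidean_space) chart set \<Rightarrow>
   ('m \<Rightarrow> ('m, 'e) tvec \<Rightarrow> ('m, 'e) tvec) \<Rightarrow> ('m, 'e) form2 \<Rightarrow> bool" where
  "almost_paracomplex_riemannian T A P h \<longleftrightarrow>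
     even DIM('e) \<and> smooth_manifold T A \<and> endomorphism_field T A P \<and> riemannian_metric T A h \<and>
     (\<forall>p\<in>topspace T. \<forall>x\<in>tangent_space A p. P p (P p x) = x) \<and>
     (\<exists>p\<in>topspace T. \<exists>x\<in>tangent_space A p. P p x \<noteq> x) \<and>
     traceless A P \<and>
     (\<forall>p\<in>topspace T. \<forall>x\<in>tangent_space A p. \<forall>y\<in>tangent_space A p. h p (P p x) (P p y) = h p x y)"

definition apapR_manifold ::
  "'m topology \<Rightarrow> ('m, 'e::euclidean_space) chart set \<Rightarrow>
   ('m \<Rightarrow> ('m, 'e) tvec \<Rightarrow> ('m, 'e) tvec) \<Rightarrow> ('m, 'e) vfield \<Rightarrow>
   ('m \<Rightarrow> ('m, 'e) tvec \<Rightarrow> real) \<Rightarrow> ('m, 'e) form2 \<Rightarrow> bool" where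
  "apapR_manifold T A \<phi> \<xi> \<eta> g \<longleftrightarrow>
     odd DIM('e) \<and> smooth_manifold T A \<and> endomorphism_field T A \<phi> \<and>
     smooth_vfield_on A (topspace T) \<xi> \<and> one_form T A \<eta> \<and> riemannian_metric T A g \<and>
     (\<forall>p\<in>topspace T. \<forall>x\<in>tangent_space A p. \<phi> p (\<phi> p x) = x -\<^sub>T \<eta> p x *\<^sub>T \<xi> p) \<and>
     (\<forall>p\<in>topspace T. \<eta> p (\<xi> p) = 1) \<and>
     (\<forall>p\<in>topspace T. \<forall>x\<in>tangent_space A p. \<eta> p (\<phi> p x) = 0) \<and>
     (\<forall>p\<in>topspace T. \<phi> p (\<xi> p) = tzero) \<and>
     traceless A \<phi> \<and>
     (\<forall>p\<in>topspace T. \<forall>x\<in>tangent_space A p. \<forall>y\<in>tangent_space A p.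
        g p (\<phi> p x) (\<phi> p y) = g p x y - \<eta> p x * \<eta> p y)"

definition constant_negative_xi_sectional ::
  "'m topology \<Rightarrow> ('m, 'e::euclidean_space) chart set \<Rightarrow> ('m, 'e) vfield \<Rightarrow> ('m, 'e) form2 \<Rightarrow>
   (('m, 'e) vfield \<Rightarrow> ('m, 'e) vfield \<Rightarrow> ('m, 'e) vfield) \<Rightarrow> bool" where
  "constant_negative_xi_sectional T A \<xi> g nabla \<longleftrightarrow>
     (\<exists>c<0. \<forall>p\<in>topspace T. \<forall>x y. plane_basis A p x y \<and> \<xi> p \<in> tspan2 x y \<longrightarrow>
        sectional_curvature T A g nabla p x y = c)"


section \<open>The manifold \<open>\<real>\<^sup>+ \<times> N\<close>\<close>

definition associated_metric ::
  "('m \<Rightarrow> ('m, 'e::euclidean_space) tvec \<Rightarrow> ('m, 'e) tvec) \<Rightarrow> ('m, 'e) form2 \<Rightarrow> ('m, 'e) form2" where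
  "associated_metric P h p x y = h p x (P p y)"

definition S_top :: "'m topology \<Rightarrow> (real \<times> 'm) topology" where
  "S_top T = prod_topology (top_of_set {0<..}) T"

definition S_chart :: "('m, 'e) chart \<Rightarrow> (real \<times> 'm, real \<times> 'e) chart" where
  "S_chart c = ({0<..} \<times> fst c, \<lambda>(t, p). (t, snd c p))"

definition S_atlas :: "('m, 'e) chart set \<Rightarrow> (real \<times> 'm, real \<times> 'e) chart set" where
  "S_atlas A = S_chart ` A"

text \<open>The differential of the projection to \<open>N\<close>; components in \<open>c\<close> are read off from \<open>S_chart c\<close>.\<close>
definition N_part ::
  "(real \<times> 'm, real \<times> 'e::euclidean_space) tvec \<Rightarrow> ('m, 'e) tvec" where
  "N_part w = (\<lambda>c. snd (w (S_chart c)))"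

text \<open>
  The tangent vector \<open>(x', a d/dt)\<close> at \<open>z\<close>; \<open>S_chart\<close> is injective, so every chart of \<open>S_atlas A\<close>
  determines its factor.
\<close>
definition S_vec ::
  "('m, 'e::euclidean_space) chart set \<Rightarrow> real \<times> 'm \<Rightarrow> ('m, 'e) tvec \<Rightarrow> real \<Rightarrow>
   (real \<times> 'm, real \<times> 'e) tvec" where
  "S_vec A z x a = (\<lambda>d. if d \<in> charts_at (S_atlas A) z
     then (a, x (inv_into A S_chart d)) else 0)"

definition S_phi ::
  "('m, 'e::euclidean_space) chart set \<Rightarrow> ('m \<Rightarrow> ('m, 'e) tvec \<Rightarrow> ('m, 'e) tvec) \<Rightarrow>
   real \<times> 'm \<Rightarrow> (real \<times> 'm, real \<times> 'e) tvec \<Rightarrow> (real \<times> 'm, real \<times> 'e) tvec" where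
  "S_phi A P z w = S_vec A z (P (snd z) (N_part w)) 0"

definition S_xi ::
  "('m, 'e::euclidean_space) chart set \<Rightarrow> (real \<times> 'm, real \<times> 'e) vfield" where
  "S_xi A z = S_vec A z tzero 1"

text \<open>\<open>\<eta> = dt\<close>, the differential of the coordinate function \<open>t = fst\<close>.\<close>
definition S_eta ::
  "('m, 'e::euclidean_space) chart set \<Rightarrow> real \<times> 'm \<Rightarrow> (real \<times> 'm, real \<times> 'e) tvec \<Rightarrow> real" where
  "S_eta A z w = dir_deriv (S_atlas A) z w fst"

definition S_metric ::
  "('m, 'e::euclidean_space) chart set \<Rightarrow> ('m \<Rightarrow> ('m, 'e) tvec \<Rightarrow> ('m, 'e) tvec) \<Rightarrow>
   ('m, 'e) form2 \<Rightarrow> (real \<times> 'm, real \<times> 'e) form2" where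
  "S_metric A P h z x y =
     S_eta A z x * S_eta A z y
     + cosh (2 * fst z) * h (snd z) (N_part x) (N_part y)
     + sinh (2 * fst z) * associated_metric P h (snd z) (N_part x) (N_part y)"

end

theory Submission
  imports Defs
begin

text \<open>
  The slices \<open>{t} \<times> N\<close> carry the metrics \<open>cosh 2t h + sinh 2t h~\<close>, which scale the
  eigendistributions of \<open>P\<close> by the factors \<open>exp (2t)\<close> and \<open>exp (- 2t)\<close>.  Since \<open>P\<close> interchanges \<open>h\<close> and
  \<open>h~\<close>, the \<open>t\<close>-derivative of this family is \<open>2 g (\<phi> \<cdot>, \<cdot>)\<close>.  Half of that derivative is the
  second fundamental form of the slices, so \<open>\<nabla>\<^sub>x \<xi> = \<phi> x\<close> (\<open>dir_deriv_xi_metric\<close>, \<open>nabla_xi\<close>).  As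
  \<open>\<phi>\<close> does not depend on \<open>t\<close>, its Lie derivative along \<open>\<xi>\<close> vanishes, and therefore

    \<open>R (x, \<xi>) \<xi> = - \<nabla>\<^sub>\<xi> (\<phi> x) = - \<phi>\<^sup>2 x = - (x - \<eta> (x) \<xi>)\<close>

  for a field \<open>x\<close> that commutes with \<open>\<xi>\<close> (\<open>curvature_fields_xi\<close>).  Every plane through \<open>\<xi>\<close> thus has
  curvature \<open>-1\<close>.  Let \<open>u, v, \<xi>\<close> be an orthonormal frame with \<open>\<phi> u = u\<close> and \<open>\<phi> v = - v\<close>.  The
  eigenvalues \<open>1, -1, 0\<close> of \<open>\<phi>\<close> turn \<open>\<tau>\<^sup>*\<close> into the difference of the Ricci curvatures of \<open>u\<close> and
  \<open>v\<close>; the plane of \<open>u\<close> and \<open>v\<close> contributes equally to both, and so do the planes through \<open>\<xi>\<close>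
  (\<open>star_scalar_flat_S\<close>).

  The values \<open>R (x, y) z\<close> at a point are computed on unspecified extensions of the three vectors.
  To evaluate them on coordinate fields, which commute, one needs that the curvature is tensorial
  (\<open>curvature_fields_pointwise\<close>).  This, like the skew-symmetry of \<open>R (x, y)\<close>
  (\<open>curvature_fields_skew\<close>), rests on the identity \<open>X (Y f) - Y (X f) = [X, Y] f\<close> and hence on the
  symmetry of second derivatives (\<open>second_derivative_symmetric\<close>).
\<close>

section \<open>Calculus of smooth maps between Euclidean spaces\<close>

lemma Ck_on_cong:
  assumes "open S" "\<And>x. x \<in> S \<Longrightarrow> f x = g x" "Ck_on k S f"
  shows "Ck_on k S g"
  using assms(2,3)
proof (induction k arbitrary: f g)
  case 0
  then show ?case by (auto cong: continuous_on_cong)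
next
  case (Suc k)
  have d: "g differentiable at x \<and> frechet_derivative f (at x) = frechet_derivative g (at x)"
    if x: "x \<in> S" for x
  proof -
    have "f differentiable at x" using Suc.prems(2) x by simp
    then show ?thesis
      using frechet_derivative_transform_within_open[OF _ assms(1) x, of f g]
        differentiable_transform_within[of f x UNIV] Suc.prems(1)
      by (metis assms(1) differentiable_def frechet_derivative_works
          has_derivative_transform_within_open x)
  qed
  show ?case
    unfolding Ck_on.simps
  proof (intro conjI ballI allI)
    fix v
    show "Ck_on k S (\<lambda>x. frechet_derivative g (at x) v)"
      by (rule Suc.IH[of "\<lambda>x. frechet_derivative f (at x) v"]) (use d Suc.prems in auto)
  qed (use d in auto)
qed

lemma Ck_on_subset: "Ck_on k S f \<Longrightarrow> S' \<subseteq> S \<Longrightarrow> Ck_on k S' f"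
  by (induction k arbitrary: f) (auto intro: continuous_on_subset)

lemma Ck_on_SucD: "Ck_on (Suc k) S f \<Longrightarrow> Ck_on k S f"
proof (induction k arbitrary: f)
  case 0
  then show ?case
    unfolding Ck_on.simps
    by (intro continuous_at_imp_continuous_on ballI differentiable_imp_continuous_within) simp
next
  case (Suc k)
  then show ?case by auto
qed

lemma Ck_on_const: "Ck_on k S (\<lambda>x. c)"
  by (induction k arbitrary: c) auto

lemma Ck_on_bounded_linear:
  assumes "bounded_linear L" shows "Ck_on k S L"
proof (cases k)
  case 0
  then show ?thesis using assms linear_continuous_on by auto
next
  case (Suc j)
  have "(L has_derivative L) (at x)" for x
    using assms by (rule bounded_linear_imp_has_derivative)
  then have "L differentiable at x" "frechet_derivative L (at x) = L" for x
    by (auto simp: differentiable_def frechet_derivative_at[symmetric])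
  then show ?thesis using Suc Ck_on_const by auto
qed

lemma Ck_on_add:
  assumes "open S" "Ck_on k S f" "Ck_on k S g"
  shows "Ck_on k S (\<lambda>x. f x + g x)"
  using assms(2,3)
proof (induction k arbitrary: f g)
  case 0
  then show ?case by (auto intro: continuous_on_add)
next
  case (Suc k)
  have d: "frechet_derivative (\<lambda>x. f x + g x) (at x) v
      = frechet_derivative f (at x) v + frechet_derivative g (at x) v" if "x \<in> S" for x v
  proof -
    have "((\<lambda>x. f x + g x) has_derivative
        (\<lambda>v. frechet_derivative f (at x) v + frechet_derivative g (at x) v)) (at x)"
      using Suc.prems that
      by (intro has_derivative_add) (auto simp: frechet_derivative_works[symmetric])
    from frechet_derivative_at[OF this, symmetric] show ?thesis by simp
  qed
  show ?case unfolding Ck_on.simps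
  proof (intro conjI ballI allI)
    fix v
    have "Ck_on k S (\<lambda>x. frechet_derivative f (at x) v + frechet_derivative g (at x) v)"
      using Suc by auto
    then show "Ck_on k S (\<lambda>x. frechet_derivative (\<lambda>x. f x + g x) (at x) v)"
      by (rule Ck_on_cong[OF assms(1), rotated]) (simp add: d)
  qed (use Suc.prems in \<open>auto intro: differentiable_add\<close>)
qed

lemma Ck_on_bounded_linear_comp:
  assumes "open S" "bounded_linear L" "Ck_on k S f"
  shows "Ck_on k S (\<lambda>x. L (f x))"
  using assms(3)
proof (induction k arbitrary: f)
  case 0
  then show ?case
    using bounded_linear.continuous_on[OF assms(2)] by simp
next
  case (Suc k)
  have h: "((\<lambda>x. L (f x)) has_derivative (\<lambda>v. L (frechet_derivative f (at x) v))) (at x)"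
    if "x \<in> S" for x
    using Suc.prems that
    by (intro bounded_linear.has_derivative[OF assms(2)])
      (auto simp: frechet_derivative_works[symmetric])
  have d: "frechet_derivative (\<lambda>x. L (f x)) (at x) = (\<lambda>v. L (frechet_derivative f (at x) v))"
    if "x \<in> S" for x by (rule frechet_derivative_at[OF h[OF that], symmetric])
  show ?case unfolding Ck_on.simps
  proof (intro conjI ballI allI)
    fix v
    have "Ck_on k S (\<lambda>x. L (frechet_derivative f (at x) v))"
      using Suc by auto
    then show "Ck_on k S (\<lambda>x. frechet_derivative (\<lambda>x. L (f x)) (at x) v)"
      by (rule Ck_on_cong[OF assms(1), rotated]) (simp add: d)
  qed (rule differentiableI[OF h])
qed

lemma Ck_on_scaleR:
  fixes f :: "'a::euclidean_space \<Rightarrow> real"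
  assumes "open S" "Ck_on k S f" "Ck_on k S g"
  shows "Ck_on k S (\<lambda>x. f x *\<^sub>R g x)"
  using assms(2,3)
proof (induction k arbitrary: f g)
  case 0
  then show ?case using continuous_on_scaleR[of S f g] by simp
next
  case (Suc k)
  have D: "(f has_derivative frechet_derivative f (at x)) (at x)"
    "(g has_derivative frechet_derivative g (at x)) (at x)" if "x \<in> S" for x
    using Suc.prems that by (simp_all flip: frechet_derivative_works)
  have h: "((\<lambda>x. f x *\<^sub>R g x) has_derivative
        (\<lambda>v. f x *\<^sub>R frechet_derivative g (at x) v + frechet_derivative f (at x) v *\<^sub>R g x)) (at x)"
    if "x \<in> S" for x
    by (rule has_derivative_scaleR[OF D[OF that]])
  have d: "frechet_derivative (\<lambda>x. f x *\<^sub>R g x) (at x) =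
      (\<lambda>v. f x *\<^sub>R frechet_derivative g (at x) v + frechet_derivative f (at x) v *\<^sub>R g x)"
    if "x \<in> S" for x by (rule frechet_derivative_at[OF h[OF that], symmetric])
  show ?case unfolding Ck_on.simps(2)
  proof (intro conjI ballI allI)
    fix v
    have "Ck_on k S (\<lambda>x. f x *\<^sub>R frechet_derivative g (at x) v + frechet_derivative f (at x) v *\<^sub>R g x)"
    proof (intro Ck_on_add[OF assms(1)] Suc.IH)
      show "Ck_on k S f" "Ck_on k S g" by (rule Ck_on_SucD, rule Suc.prems)+
      show "Ck_on k S (\<lambda>x. frechet_derivative g (at x) v)"
        "Ck_on k S (\<lambda>x. frechet_derivative f (at x) v)" using Suc.prems by auto
    qed
    then show "Ck_on k S (\<lambda>x. frechet_derivative (\<lambda>x. f x *\<^sub>R g x) (at x) v)"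
      by (rule Ck_on_cong[OF assms(1), rotated]) (simp add: d)
  qed (rule differentiableI[OF h])
qed

lemma Ck_on_sum:
  assumes "open S" "\<And>i. i \<in> I \<Longrightarrow> Ck_on k S (f i)"
  shows "Ck_on k S (\<lambda>x. \<Sum>i\<in>I. f i x)"
proof (cases "finite I")
  case True
  then show ?thesis using assms(2)
  proof (induction I rule: finite_induct)
    case (insert i I)
    have "Ck_on k S (\<lambda>x. f i x + (\<Sum>i\<in>I. f i x))"
      by (rule Ck_on_add[OF assms(1) insert.prems insert.IH]) (use insert.prems in simp_all)
    then show ?case using insert.hyps by simp
  qed (simp add: Ck_on_const)
qed (simp add: Ck_on_const)

lemma linear_Basis_expansion:
  fixes L :: "'a::euclidean_space \<Rightarrow> 'b::real_vector"
  assumes "linear L" shows "L v = (\<Sum>b\<in>Basis. (v \<bullet> b) *\<^sub>R L b)"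
proof -
  have "L v = L (\<Sum>b\<in>Basis. (v \<bullet> b) *\<^sub>R b)" by (simp add: euclidean_representation)
  also have "\<dots> = (\<Sum>b\<in>Basis. (v \<bullet> b) *\<^sub>R L b)"
    by (simp add: linear_sum[OF assms] linear_cmul[OF assms])
  finally show ?thesis .
qed

text \<open>
  The derivative \<open>D f (g x) (D g (x) v)\<close> is a sum of products of components of \<open>D g\<close> with partial
  derivatives of \<open>f\<close> composed with \<open>g\<close>.  The latter are of the same form with one derivative less, so
  the induction runs over all \<open>f\<close> with \<open>g\<close> fixed.
\<close>
lemma Ck_on_compose:
  fixes g :: "'a::euclidean_space \<Rightarrow> 'b::euclidean_space"
  assumes "open S" "open S'" "g ` S \<subseteq> S'" "Ck_on k S' f" "Ck_on k S g"
  shows "Ck_on k S (\<lambda>x. f (g x))"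
  using assms(4,5)
proof (induction k arbitrary: f)
  case 0
  then show ?case using assms(3) by (auto intro: continuous_on_compose2)
next
  case (Suc k)
  have h: "((\<lambda>x. f (g x)) has_derivative
        (\<lambda>v. frechet_derivative f (at (g x)) (frechet_derivative g (at x) v))) (at x)"
    if "x \<in> S" for x
  proof (rule has_derivative_compose[of g _ x UNIV f])
    show "(g has_derivative frechet_derivative g (at x)) (at x)"
      using Suc.prems(2) that by (simp flip: frechet_derivative_works)
    have "g x \<in> S'" using assms(3) that by auto
    then show "(f has_derivative frechet_derivative f (at (g x))) (at (g x))"
      using Suc.prems(1) by (simp flip: frechet_derivative_works)
  qed
  have d: "frechet_derivative (\<lambda>x. f (g x)) (at x) v =
      (\<Sum>b\<in>Basis. (frechet_derivative g (at x) v \<bullet> b) *\<^sub>R frechet_derivative f (at (g x)) b)"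
    if "x \<in> S" for x v
  proof -
    have "frechet_derivative (\<lambda>x. f (g x)) (at x) v
        = frechet_derivative f (at (g x)) (frechet_derivative g (at x) v)"
      by (simp flip: frechet_derivative_at[OF h[OF that]])
    also have "linear (frechet_derivative f (at (g x)))"
      using Suc.prems that assms(3) by (intro linear_frechet_derivative) (auto simp: image_subset_iff)
    note linear_Basis_expansion[OF this, of "frechet_derivative g (at x) v"]
    finally show ?thesis .
  qed
  show ?case unfolding Ck_on.simps(2)
  proof (intro conjI ballI allI)
    fix v
    have "Ck_on k S (\<lambda>x. \<Sum>b\<in>Basis. (frechet_derivative g (at x) v \<bullet> b) *\<^sub>R
        frechet_derivative f (at (g x)) b)"
    proof (rule Ck_on_sum[OF assms(1)], rule Ck_on_scaleR[OF assms(1)])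
      fix b :: 'b
      show "Ck_on k S (\<lambda>x. frechet_derivative g (at x) v \<bullet> b)"
        by (rule Ck_on_bounded_linear_comp[OF assms(1) bounded_linear_inner_left])
          (use Suc.prems in auto)
      show "Ck_on k S (\<lambda>x. frechet_derivative f (at (g x)) b)"
        by (rule Suc.IH[of "\<lambda>y. frechet_derivative f (at y) b"])
          (use Suc.prems Ck_on_SucD[OF Suc.prems(2)] in auto)
    qed
    then show "Ck_on k S (\<lambda>x. frechet_derivative (\<lambda>x. f (g x)) (at x) v)"
      by (rule Ck_on_cong[OF assms(1), rotated]) (simp add: d)
  qed (rule differentiableI[OF h])
qed

lemma smooth_on_cong:
  "open S \<Longrightarrow> (\<And>x. x \<in> S \<Longrightarrow> f x = g x) \<Longrightarrow> smooth_on S f \<Longrightarrow> smooth_on S g"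
  unfolding smooth_on_def using Ck_on_cong by blast

lemma smooth_on_subset: "smooth_on S f \<Longrightarrow> S' \<subseteq> S \<Longrightarrow> smooth_on S' f"
  unfolding smooth_on_def using Ck_on_subset by blast

lemma smooth_on_const: "smooth_on S (\<lambda>x. c)"
  unfolding smooth_on_def using Ck_on_const by blast

lemma smooth_on_bounded_linear: "bounded_linear L \<Longrightarrow> smooth_on S L"
  unfolding smooth_on_def using Ck_on_bounded_linear by blast

lemma smooth_on_add:
  "open S \<Longrightarrow> smooth_on S f \<Longrightarrow> smooth_on S g \<Longrightarrow> smooth_on S (\<lambda>x. f x + g x)"
  by (simp add: smooth_on_def Ck_on_add)

lemma smooth_on_sum:
  "open S \<Longrightarrow> (\<And>i. i \<in> I \<Longrightarrow> smooth_on S (f i)) \<Longrightarrow> smooth_on S (\<lambda>x. \<Sum>i\<in>I. f i x)"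
  by (simp add: smooth_on_def Ck_on_sum)

lemma smooth_on_scaleR:
  fixes f :: "'a::euclidean_space \<Rightarrow> real"
  shows "open S \<Longrightarrow> smooth_on S f \<Longrightarrow> smooth_on S g \<Longrightarrow> smooth_on S (\<lambda>x. f x *\<^sub>R g x)"
  by (simp add: smooth_on_def Ck_on_scaleR)

lemma smooth_on_mult:
  fixes f g :: "'a::euclidean_space \<Rightarrow> real"
  shows "open S \<Longrightarrow> smooth_on S f \<Longrightarrow> smooth_on S g \<Longrightarrow> smooth_on S (\<lambda>x. f x * g x)"
  using smooth_on_scaleR[of S f g] by simp

lemma smooth_on_bounded_linear_comp:
  "open S \<Longrightarrow> bounded_linear L \<Longrightarrow> smooth_on S f \<Longrightarrow> smooth_on S (\<lambda>x. L (f x))"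
  by (simp add: smooth_on_def Ck_on_bounded_linear_comp)

lemma smooth_on_inner_right:
  "open S \<Longrightarrow> smooth_on S f \<Longrightarrow> smooth_on S (\<lambda>x. f x \<bullet> b)"
  by (rule smooth_on_bounded_linear_comp[OF _ bounded_linear_inner_left])

lemma smooth_on_compose:
  fixes g :: "'a::euclidean_space \<Rightarrow> 'b::euclidean_space"
  shows "open S \<Longrightarrow> open S' \<Longrightarrow> g ` S \<subseteq> S' \<Longrightarrow> smooth_on S' f \<Longrightarrow> smooth_on S g
    \<Longrightarrow> smooth_on S (\<lambda>x. f (g x))"
  unfolding smooth_on_def using Ck_on_compose[of S S' g _ f] by simp

lemma smooth_on_differentiable: "smooth_on S f \<Longrightarrow> x \<in> S \<Longrightarrow> f differentiable at x"
  unfolding smooth_on_def by (metis Ck_on.simps(2))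

lemma smooth_on_has_derivative:
  "smooth_on S f \<Longrightarrow> x \<in> S \<Longrightarrow> (f has_derivative frechet_derivative f (at x)) (at x)"
  using smooth_on_differentiable frechet_derivative_works by blast

lemma smooth_on_linear_derivative: "smooth_on S f \<Longrightarrow> x \<in> S \<Longrightarrow> linear (frechet_derivative f (at x))"
  using smooth_on_differentiable linear_frechet_derivative by blast

lemma smooth_on_continuous_on: "smooth_on S f \<Longrightarrow> continuous_on S f"
  unfolding smooth_on_def by (metis Ck_on.simps(1))

lemma smooth_on_derivative: "smooth_on S f \<Longrightarrow> smooth_on S (\<lambda>x. frechet_derivative f (at x) v)"
  unfolding smooth_on_def by (metis Ck_on.simps(2))

lemma derivative_along_field_expansion:
  assumes "smooth_on S f" "x \<in> S"
  shows "frechet_derivative f (at x) v = (\<Sum>b\<in>Basis. (v \<bullet> b) *\<^sub>R frechet_derivative f (at x) b)"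
  using linear_Basis_expansion[OF smooth_on_linear_derivative[OF assms]] .

lemma smooth_on_derivative_along_field:
  assumes "open S" "smooth_on S f" "smooth_on S X"
  shows "smooth_on S (\<lambda>x. frechet_derivative f (at x) (X x))"
proof -
  have "smooth_on S (\<lambda>x. \<Sum>b\<in>Basis. (X x \<bullet> b) *\<^sub>R frechet_derivative f (at x) b)"
    by (rule smooth_on_sum[OF assms(1) smooth_on_scaleR[OF assms(1)
            smooth_on_inner_right[OF assms(1,3)] smooth_on_derivative[OF assms(2)]]])
  then show ?thesis
    by (rule smooth_on_cong[OF assms(1), rotated])
      (rule derivative_along_field_expansion[OF assms(2), symmetric])
qed

lemma Ck_on_exp_linear:
  fixes L :: "'a::euclidean_space \<Rightarrow> real"
  assumes "open S" "bounded_linear L"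
  shows "Ck_on k S (\<lambda>x. exp (L x))"
proof (induction k)
  case 0
  then show ?case using continuous_on_exp[OF linear_continuous_on[OF assms(2)]] by simp
next
  case (Suc k)
  have h: "((\<lambda>x. exp (L x)) has_derivative (\<lambda>v. L v * exp (L x))) (at x)" for x
    by (rule has_derivative_exp[OF bounded_linear_imp_has_derivative[OF assms(2)]])
  have d: "frechet_derivative (\<lambda>x. exp (L x)) (at x) = (\<lambda>v. L v * exp (L x))" for x
    by (rule frechet_derivative_at[OF h, symmetric])
  have "Ck_on k S (\<lambda>x. L v *\<^sub>R exp (L x))" for v
    by (rule Ck_on_scaleR[OF assms(1) Ck_on_const Suc])
  then show ?case using differentiableI[OF h] by (simp add: d)
qed

lemma smooth_on_cosh_sinh_linear:
  fixes L :: "'a::euclidean_space \<Rightarrow> real"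
  assumes "open S" "bounded_linear L"
  shows "smooth_on S (\<lambda>x. cosh (L x))" "smooth_on S (\<lambda>x. sinh (L x))"
proof -
  have 1: "smooth_on S (\<lambda>x. exp (L x))"
    using Ck_on_exp_linear[OF assms] by (auto simp: smooth_on_def)
  have 2: "smooth_on S (\<lambda>x. exp (- L x))"
    using Ck_on_exp_linear[OF assms(1) bounded_linear_minus[OF assms(2)]] by (auto simp: smooth_on_def)
  show "smooth_on S (\<lambda>x. cosh (L x))"
    unfolding cosh_def
    by (rule smooth_on_scaleR[OF assms(1) smooth_on_const smooth_on_add[OF assms(1) 1 2]])
  have "smooth_on S (\<lambda>x. (1/2) *\<^sub>R (exp (L x) + (-1) *\<^sub>R exp (- L x)))"
    by (rule smooth_on_scaleR[OF assms(1) smooth_on_const smooth_on_add[OF assms(1) 1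
            smooth_on_scaleR[OF assms(1) smooth_on_const 2]]])
  then show "smooth_on S (\<lambda>x. sinh (L x))"
    by (simp add: sinh_def)
qed

text \<open>
  The second difference \<open>f (x + h u + h v) - f (x + h u) - f (x + h v) + f x\<close> equals, by two
  applications of the mean value theorem, \<open>h\<^sup>2\<close> times an iterated derivative near \<open>x\<close>.  Its symmetry
  in \<open>u\<close> and \<open>v\<close> is the source of the symmetry of second derivatives.
\<close>
lemma second_difference_mean_value:
  fixes f :: "'a::euclidean_space \<Rightarrow> real"
  assumes "smooth_on S f" "0 < h"
    and "\<And>s t. 0 \<le> s \<Longrightarrow> s \<le> h \<Longrightarrow> 0 \<le> t \<Longrightarrow> t \<le> h \<Longrightarrow> x + s *\<^sub>R u + t *\<^sub>R v \<in> S"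
  shows "\<exists>s t. 0 \<le> s \<and> s \<le> h \<and> 0 \<le> t \<and> t \<le> h \<and>
    f (x + h *\<^sub>R u + h *\<^sub>R v) - f (x + h *\<^sub>R u) - f (x + h *\<^sub>R v) + f x
    = h * h * frechet_derivative (\<lambda>y. frechet_derivative f (at y) u) (at (x + s *\<^sub>R u + t *\<^sub>R v)) v"
proof -
  define Du where "Du = (\<lambda>y. frechet_derivative f (at y) u)"
  have Du: "smooth_on S Du" unfolding Du_def by (rule smooth_on_derivative[OF assms(1)])
  have 1: "((\<lambda>s. f (x + s *\<^sub>R u + t *\<^sub>R v)) has_real_derivative Du (x + s *\<^sub>R u + t *\<^sub>R v)) (at s)"
    if "0 \<le> s" "s \<le> h" "0 \<le> t" "t \<le> h" for s t
  proof -
    have "x + s *\<^sub>R u + t *\<^sub>R v \<in> S" using assms(3) that by auto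
    note hd = smooth_on_has_derivative[OF assms(1) this]
    have g: "((\<lambda>s. x + s *\<^sub>R u + t *\<^sub>R v) has_derivative (\<lambda>r. r *\<^sub>R u)) (at s)"
      by (auto intro!: derivative_eq_intros)
    have "((\<lambda>s. f (x + s *\<^sub>R u + t *\<^sub>R v)) has_derivative
        (\<lambda>r. frechet_derivative f (at (x + s *\<^sub>R u + t *\<^sub>R v)) (r *\<^sub>R u))) (at s)"
      using has_derivative_compose[OF g hd] .
    moreover have "frechet_derivative f (at (x + s *\<^sub>R u + t *\<^sub>R v)) (r *\<^sub>R u) = Du (x + s *\<^sub>R u + t *\<^sub>R v) * r" for r
      using linear_cmul[OF has_derivative_linear[OF hd]] by (simp add: Du_def)
    ultimately show ?thesis by (simp add: has_field_derivative_def)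
  qed
  have 2: "((\<lambda>t. Du (x + s *\<^sub>R u + t *\<^sub>R v)) has_real_derivative
      frechet_derivative Du (at (x + s *\<^sub>R u + t *\<^sub>R v)) v) (at t)"
    if "0 \<le> s" "s \<le> h" "0 \<le> t" "t \<le> h" for s t
  proof -
    have "x + s *\<^sub>R u + t *\<^sub>R v \<in> S" using assms(3) that by auto
    note hd = smooth_on_has_derivative[OF Du this]
    have g: "((\<lambda>t. x + s *\<^sub>R u + t *\<^sub>R v) has_derivative (\<lambda>r. r *\<^sub>R v)) (at t)"
      by (auto intro!: derivative_eq_intros)
    have "((\<lambda>t. Du (x + s *\<^sub>R u + t *\<^sub>R v)) has_derivative
        (\<lambda>r. frechet_derivative Du (at (x + s *\<^sub>R u + t *\<^sub>R v)) (r *\<^sub>R v))) (at t)"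
      using has_derivative_compose[OF g hd] .
    moreover have "frechet_derivative Du (at (x + s *\<^sub>R u + t *\<^sub>R v)) (r *\<^sub>R v)
        = frechet_derivative Du (at (x + s *\<^sub>R u + t *\<^sub>R v)) v * r" for r
      using linear_cmul[OF has_derivative_linear[OF hd]] by simp
    ultimately show ?thesis by (simp add: has_field_derivative_def)
  qed
  have "\<exists>s. 0 < s \<and> s < h \<and> (f (x + h *\<^sub>R u + h *\<^sub>R v) - f (x + h *\<^sub>R u + 0 *\<^sub>R v))
      - (f (x + 0 *\<^sub>R u + h *\<^sub>R v) - f (x + 0 *\<^sub>R u + 0 *\<^sub>R v))
      = (h - 0) * (Du (x + s *\<^sub>R u + h *\<^sub>R v) - Du (x + s *\<^sub>R u + 0 *\<^sub>R v))"
    by (rule MVT2[where f="\<lambda>s. f (x + s *\<^sub>R u + h *\<^sub>R v) - f (x + s *\<^sub>R u + 0 *\<^sub>R v)" and a=0 and b=h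
          and f'="\<lambda>s. Du (x + s *\<^sub>R u + h *\<^sub>R v) - Du (x + s *\<^sub>R u + 0 *\<^sub>R v)"])
      (use assms(2) in \<open>auto intro!: DERIV_diff 1[where t=h] 1[where t=0]\<close>,
       insert 1[where t=0], simp add: scaleR_zero_left)
  then obtain s where s: "0 < s" "s < h" "(f (x + h *\<^sub>R u + h *\<^sub>R v) - f (x + h *\<^sub>R u + 0 *\<^sub>R v))
      - (f (x + 0 *\<^sub>R u + h *\<^sub>R v) - f (x + 0 *\<^sub>R u + 0 *\<^sub>R v))
      = (h - 0) * (Du (x + s *\<^sub>R u + h *\<^sub>R v) - Du (x + s *\<^sub>R u + 0 *\<^sub>R v))" by blast
  have "\<exists>t. 0 < t \<and> t < h \<and> Du (x + s *\<^sub>R u + h *\<^sub>R v) - Du (x + s *\<^sub>R u + 0 *\<^sub>R v)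
      = (h - 0) * frechet_derivative Du (at (x + s *\<^sub>R u + t *\<^sub>R v)) v"
    by (rule MVT2) (use assms(2) s in \<open>auto intro!: 2\<close>)
  then obtain t where t: "0 < t" "t < h" "Du (x + s *\<^sub>R u + h *\<^sub>R v) - Du (x + s *\<^sub>R u + 0 *\<^sub>R v)
      = (h - 0) * frechet_derivative Du (at (x + s *\<^sub>R u + t *\<^sub>R v)) v" by blast
  show ?thesis
    using s t unfolding Du_def by (intro exI[of _ s] exI[of _ t]) (auto simp: algebra_simps)
qed

text \<open>
  Both iterated derivatives are limits, as \<open>h\<close> tends to \<open>0\<close>, of the second difference divided by \<open>h\<^sup>2\<close>.
\<close>
lemma second_derivative_symmetric:
  fixes f :: "'a::euclidean_space \<Rightarrow> real"
  assumes "open S" "smooth_on S f" "x \<in> S"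
  shows "frechet_derivative (\<lambda>y. frechet_derivative f (at y) u) (at x) v
    = frechet_derivative (\<lambda>y. frechet_derivative f (at y) v) (at x) u"
proof -
  define F where "F = (\<lambda>y. frechet_derivative (\<lambda>y. frechet_derivative f (at y) u) (at y) v)"
  define G where "G = (\<lambda>y. frechet_derivative (\<lambda>y. frechet_derivative f (at y) v) (at y) u)"
  have "smooth_on S F" "smooth_on S G"
    unfolding F_def G_def by (intro smooth_on_derivative assms)+
  then have cF: "isCont F x" and cG: "isCont G x"
    using assms(1,3) smooth_on_continuous_on continuous_on_eq_continuous_at by blast+
  obtain r where r: "r > 0" "ball x r \<subseteq> S" using assms(1,3) openE by blast
  \<comment> \<open>steps so small that the whole parallelogram stays in the ball of radius \<open>r\<close>\<close>
  define h where "h n = r / (norm u + norm v + 1) / real (Suc (Suc n))" for n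
  have pos: "norm u + norm v + 1 > 0" by (simp add: add_nonneg_pos)
  have h0: "h n > 0" for n using r pos by (simp add: h_def)
  have bd: "norm (s *\<^sub>R u + t *\<^sub>R v) \<le> r / real (Suc (Suc n))"
    if "0 \<le> s" "s \<le> h n" "0 \<le> t" "t \<le> h n" for s t n
  proof -
    have "norm (s *\<^sub>R u + t *\<^sub>R v) \<le> s * norm u + t * norm v"
      using that norm_triangle_ineq[of "s *\<^sub>R u" "t *\<^sub>R v"] by simp
    also have "\<dots> \<le> h n * norm u + h n * norm v"
      using that by (intro add_mono mult_right_mono) auto
    also have "\<dots> \<le> h n * (norm u + norm v + 1)" using h0[of n] by (simp add: algebra_simps)
    also have "\<dots> = r / real (Suc (Suc n))" using pos by (simp add: h_def)
    finally show ?thesis .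
  qed
  have lt: "r / real (Suc (Suc n)) < r" for n using r by (simp add: divide_less_eq)
  have inS: "x + s *\<^sub>R u + t *\<^sub>R v \<in> S" "x + t *\<^sub>R v + s *\<^sub>R u \<in> S"
    if "0 \<le> s" "s \<le> h n" "0 \<le> t" "t \<le> h n" for s t n
  proof -
    have "norm (s *\<^sub>R u + t *\<^sub>R v) < r" using bd[OF that] lt[of n] by linarith
    then have "x + (s *\<^sub>R u + t *\<^sub>R v) \<in> ball x r"
      by (metis add_diff_cancel_left' dist_commute dist_norm mem_ball)
    then show "x + s *\<^sub>R u + t *\<^sub>R v \<in> S" "x + t *\<^sub>R v + s *\<^sub>R u \<in> S"
      using r(2) by (auto simp: algebra_simps)
  qed
  define D where "D n = f (x + h n *\<^sub>R u + h n *\<^sub>R v) - f (x + h n *\<^sub>R u) - f (x + h n *\<^sub>R v) + f x" for n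
  have "\<exists>y. norm (y - x) \<le> r / real (Suc (Suc n)) \<and> D n = h n * h n * F y" for n
    using second_difference_mean_value[OF assms(2) h0, of n x u v] inS(1) bd
    unfolding D_def F_def by (metis (no_types, lifting) add.assoc add_diff_cancel_left')
  then obtain y where y: "\<And>n. norm (y n - x) \<le> r / real (Suc (Suc n))" "\<And>n. D n = h n * h n * F (y n)"
    by metis
  have D2: "D n = f (x + h n *\<^sub>R v + h n *\<^sub>R u) - f (x + h n *\<^sub>R v) - f (x + h n *\<^sub>R u) + f x" for n
    unfolding D_def by (simp add: algebra_simps)
  have "\<exists>y. norm (y - x) \<le> r / real (Suc (Suc n)) \<and> D n = h n * h n * G y" for n
  proof -
    obtain s t where st: "0 \<le> s" "s \<le> h n" "0 \<le> t" "t \<le> h n" "D n = h n * h n * G (x + s *\<^sub>R v + t *\<^sub>R u)"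
      using second_difference_mean_value[OF assms(2) h0, of n x v u] inS(2)
      unfolding D2 G_def by blast
    then show ?thesis using bd[of t n s]
      by (intro exI[of _ "x + s *\<^sub>R v + t *\<^sub>R u"]) (auto simp: algebra_simps)
  qed
  then obtain z where z: "\<And>n. norm (z n - x) \<le> r / real (Suc (Suc n))" "\<And>n. D n = h n * h n * G (z n)"
    by metis
  have lim0: "(\<lambda>n. r / real (Suc (Suc n))) \<longlonglongrightarrow> 0"
    using LIMSEQ_Suc[OF LIMSEQ_Suc[OF lim_const_over_n[of r]]] by simp
  have "(\<lambda>n. y n - x) \<longlonglongrightarrow> 0" "(\<lambda>n. z n - x) \<longlonglongrightarrow> 0"
    using y(1) z(1) by (auto intro!: Lim_null_comparison[OF _ lim0])
  then have "y \<longlonglongrightarrow> x" "z \<longlonglongrightarrow> x" by (simp_all add: LIM_zero_iff)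
  then have "(\<lambda>n. F (y n)) \<longlonglongrightarrow> F x" "(\<lambda>n. G (z n)) \<longlonglongrightarrow> G x"
    using cF cG isCont_tendsto_compose by blast+
  moreover have "F (y n) = G (z n)" for n using y(2)[of n] z(2)[of n] h0[of n] by auto
  ultimately have "F x = G x" using LIMSEQ_unique by auto
  then show ?thesis by (simp add: F_def G_def)
qed

text \<open>
  In coordinates, \<open>X (Y f) - Y (X f)\<close> is the derivative of \<open>f\<close> along the bracket: the second-order
  terms cancel by the symmetry of the second derivative.
\<close>
lemma derivative_along_fields_commutator:
  fixes f :: "'a::euclidean_space \<Rightarrow> real" and X Y :: "'a \<Rightarrow> 'a"
  assumes "open S" "smooth_on S f" "smooth_on S X" "smooth_on S Y" "x \<in> S"
  shows "frechet_derivative (\<lambda>y. frechet_derivative f (at y) (Y y)) (at x) (X x)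
    - frechet_derivative (\<lambda>y. frechet_derivative f (at y) (X y)) (at x) (Y x)
    = frechet_derivative f (at x)
       (frechet_derivative Y (at x) (X x) - frechet_derivative X (at x) (Y x))"
proof -
  have main: "frechet_derivative (\<lambda>y. frechet_derivative f (at y) (Y y)) (at x) v
    = frechet_derivative f (at x) (frechet_derivative Y (at x) v)
    + (\<Sum>b\<in>Basis. (Y x \<bullet> b) * frechet_derivative (\<lambda>y. frechet_derivative f (at y) b) (at x) v)"
    if Y: "smooth_on S Y" for Y v
  proof -
    have "((\<lambda>y. \<Sum>b\<in>Basis. (Y y \<bullet> b) *\<^sub>R frechet_derivative f (at y) b) has_derivative
       (\<lambda>v. \<Sum>b\<in>Basis. (Y x \<bullet> b) *\<^sub>R frechet_derivative (\<lambda>y. frechet_derivative f (at y) b) (at x) v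
          + (frechet_derivative Y (at x) v \<bullet> b) *\<^sub>R frechet_derivative f (at x) b)) (at x)"
      by (rule has_derivative_sum, rule has_derivative_scaleR,
          rule bounded_linear.has_derivative[OF bounded_linear_inner_left],
          rule smooth_on_has_derivative[OF Y assms(5)],
          rule smooth_on_has_derivative[OF smooth_on_derivative[OF assms(2)] assms(5)])
    then have "((\<lambda>y. frechet_derivative f (at y) (Y y)) has_derivative
       (\<lambda>v. \<Sum>b\<in>Basis. (Y x \<bullet> b) *\<^sub>R frechet_derivative (\<lambda>y. frechet_derivative f (at y) b) (at x) v
          + (frechet_derivative Y (at x) v \<bullet> b) *\<^sub>R frechet_derivative f (at x) b)) (at x)"
      by (rule has_derivative_transform_within_open[OF _ assms(1,5)])
        (rule derivative_along_field_expansion[OF assms(2), symmetric])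
    from fun_cong[OF frechet_derivative_at[OF this, symmetric], of v]
    have "frechet_derivative (\<lambda>y. frechet_derivative f (at y) (Y y)) (at x) v =
      (\<Sum>b\<in>Basis. (Y x \<bullet> b) *\<^sub>R frechet_derivative (\<lambda>y. frechet_derivative f (at y) b) (at x) v
          + (frechet_derivative Y (at x) v \<bullet> b) *\<^sub>R frechet_derivative f (at x) b)"
      by simp
    then show ?thesis
      using derivative_along_field_expansion[OF assms(2,5), of "frechet_derivative Y (at x) v"]
      by (simp add: sum.distrib)
  qed
  define H where "H a b = frechet_derivative (\<lambda>y. frechet_derivative f (at y) b) (at x) a" for a b
  have Hlin: "H v b = (\<Sum>a\<in>Basis. (v \<bullet> a) * H a b)" for v b
    using derivative_along_field_expansion[OF smooth_on_derivative[OF assms(2)] assms(5), of b v]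
    by (simp add: H_def)
  have Hsym: "H a b = H b a" for a b
    unfolding H_def by (rule second_derivative_symmetric[OF assms(1,2,5)])
  have "(\<Sum>b\<in>Basis. (Y x \<bullet> b) * H (X x) b) = (\<Sum>b\<in>Basis. \<Sum>a\<in>Basis. (Y x \<bullet> b) * ((X x \<bullet> a) * H a b))"
    by (subst Hlin) (simp add: sum_distrib_left)
  also have "\<dots> = (\<Sum>a\<in>Basis. \<Sum>b\<in>Basis. (Y x \<bullet> b) * ((X x \<bullet> a) * H a b))"
    by (rule sum.swap)
  also have "\<dots> = (\<Sum>a\<in>Basis. \<Sum>b\<in>Basis. (X x \<bullet> a) * ((Y x \<bullet> b) * H b a))"
    by (intro sum.cong refl) (use Hsym in \<open>simp add: mult_ac\<close>)
  also have "\<dots> = (\<Sum>b\<in>Basis. (X x \<bullet> b) * H (Y x) b)"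
    by (subst Hlin) (simp add: sum_distrib_left)
  finally show ?thesis
    unfolding main[OF assms(4)] main[OF assms(3)]
    using linear_diff[OF smooth_on_linear_derivative[OF assms(2,5)]]
    by (simp add: H_def)
qed

section \<open>Tangent vectors and vector fields on a manifold\<close>

text \<open>
  The two sides are chosen from one and the same set of derivatives, so differentiability is not an
  issue: where there is no derivative, the two arbitrary values still agree.
\<close>
lemma frechet_derivative_cong_open:
  assumes "open S" "x \<in> S" "\<And>y. y \<in> S \<Longrightarrow> f y = g y"
  shows "frechet_derivative f (at x) = frechet_derivative g (at x)"
proof -
  have "(f has_derivative D) (at x) \<longleftrightarrow> (g has_derivative D) (at x)" for D
    using has_derivative_transform_within_open[OF _ assms(1,2), of f D UNIV g]
      has_derivative_transform_within_open[OF _ assms(1,2), of g D UNIV f] assms(3) by auto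
  then show ?thesis unfolding frechet_derivative_def by simp
qed

lemma tadd_apply [simp]: "(v +\<^sub>T w) c = v c + w c"
  by (simp add: tadd_def)

lemma tscale_apply [simp]: "(a *\<^sub>T v) c = a *\<^sub>R v c"
  by (simp add: tscale_def)

lemma tzero_apply [simp]: "tzero c = 0"
  by (simp add: tzero_def)

lemma vfield_subset:
  "smooth_vfield_on A U X \<Longrightarrow> V \<subseteq> U \<Longrightarrow> smooth_vfield_on A V X"
  unfolding smooth_vfield_on_def
  by (meson image_mono inf_mono order_refl smooth_on_subset subsetD)

lemma smooth_fun_on_const: "smooth_fun_on A U (\<lambda>p. a)"
  by (simp add: smooth_fun_on_def smooth_on_const)

lemma vfield_tangent: "smooth_vfield_on A U X \<Longrightarrow> p \<in> U \<Longrightarrow> X p \<in> tangent_space A p"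
  by (simp add: smooth_vfield_on_def)

locale manifold =
  fixes T :: "'m topology" and A :: "('m, 'e::euclidean_space) chart set"
  assumes manifold: "smooth_manifold T A"
begin

abbreviation "Tan \<equiv> tangent_space A"
abbreviation "jac c d p \<equiv> frechet_derivative (transition c d) (at (snd c p))"

lemma openin_chart: "c \<in> A \<Longrightarrow> openin T (fst c)"
  using manifold by (simp add: smooth_manifold_def)

lemma homeomorphic_chart:
  "c \<in> A \<Longrightarrow> homeomorphic_map (subtopology T (fst c)) (top_of_set (snd c ` fst c)) (snd c)"
  using manifold by (simp add: smooth_manifold_def)

lemma topspace_chart: "c \<in> A \<Longrightarrow> topspace (subtopology T (fst c)) = fst c"
  by (simp add: openin_subset[OF openin_chart] inf.absorb2)

lemma inj_chart: "c \<in> A \<Longrightarrow> inj_on (snd c) (fst c)"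
  using homeomorphic_imp_injective_map[OF homeomorphic_chart] topspace_chart by metis

lemma charts_at_nonempty: "p \<in> topspace T \<Longrightarrow> \<exists>c. c \<in> charts_at A p"
  using manifold unfolding smooth_manifold_def charts_at_def by blast

lemma charts_atD: "c \<in> charts_at A p \<Longrightarrow> c \<in> A" "c \<in> charts_at A p \<Longrightarrow> p \<in> fst c"
  by (auto simp: charts_at_def)

lemma charts_at_topspace: "c \<in> charts_at A p \<Longrightarrow> p \<in> topspace T"
  by (meson charts_atD openin_chart openin_subset subsetD)

lemma chart_inv_chart [simp]: "c \<in> A \<Longrightarrow> p \<in> fst c \<Longrightarrow> chart_inv c (snd c p) = p"
  by (simp add: chart_inv_def inj_chart)

lemma open_chart_image:
  assumes "c \<in> A" "openin T U" shows "open (snd c ` (fst c \<inter> U))"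
proof -
  have "openin (subtopology T (fst c)) (fst c \<inter> U)"
    using assms(2) by (auto simp: openin_subtopology)
  then have "openin (top_of_set (snd c ` fst c)) (snd c ` (fst c \<inter> U))"
    using homeomorphic_imp_open_map[OF homeomorphic_chart[OF assms(1)]] by (auto simp: open_map_def)
  moreover have "open (snd c ` fst c)" using manifold assms(1) by (simp add: smooth_manifold_def)
  ultimately show ?thesis using openin_open_eq by blast
qed

lemma smooth_transition:
  "c \<in> A \<Longrightarrow> d \<in> A \<Longrightarrow> smooth_on (snd c ` (fst c \<inter> fst d)) (transition c d)"
  using manifold by (simp add: smooth_manifold_def)

lemma transition_chart: "c \<in> A \<Longrightarrow> p \<in> fst c \<Longrightarrow> transition c d (snd c p) = snd d p"
  by (simp add: transition_def)

lemma transition_has_derivative: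
  assumes "c \<in> charts_at A p" "d \<in> charts_at A p"
  shows "(transition c d has_derivative jac c d p) (at (snd c p))"
  using assms by (intro smooth_on_has_derivative[OF smooth_transition]) (auto simp: charts_at_def)

lemma transition_linear:
  assumes "c \<in> charts_at A p" "d \<in> charts_at A p"
  shows "linear (jac c d p)"
  using has_derivative_linear[OF transition_has_derivative[OF assms]] .

lemma transition_derivative_self:
  assumes "c \<in> charts_at A p"
  shows "jac c c p u = u"
proof -
  have "jac c c p = frechet_derivative (\<lambda>x. x) (at (snd c p))"
    by (rule frechet_derivative_cong_open[OF open_chart_image[of c "fst c"]])
      (use assms in \<open>auto simp: charts_at_def openin_chart transition_chart\<close>)
  then show ?thesis by simp
qed

lemma transition_derivative_cocycle:
  assumes "c \<in> charts_at A p" "d \<in> charts_at A p" "e \<in> charts_at A p"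
  shows "jac d e p
      (jac c d p u)
    = jac c e p u"
proof -
  have A: "c \<in> A" "d \<in> A" "e \<in> A" and p: "p \<in> fst c" "p \<in> fst d" "p \<in> fst e"
    using assms by (auto simp: charts_at_def)
  have "transition c d (snd c p) = snd d p" using A p transition_chart by blast
  then have "((\<lambda>x. transition d e (transition c d x)) has_derivative
     (\<lambda>u. jac d e p
       (jac c d p u))) (at (snd c p))"
    using has_derivative_compose[OF transition_has_derivative[OF assms(1,2)], of "transition d e"]
      transition_has_derivative[OF assms(2,3)] by simp
  note 1 = frechet_derivative_at[OF this, symmetric]
  have "frechet_derivative (\<lambda>x. transition d e (transition c d x)) (at (snd c p))
    = jac c e p"
  proof (rule frechet_derivative_cong_open[OF open_chart_image[of c "fst d \<inter> fst e"]])
    show "openin T (fst d \<inter> fst e)" using A openin_chart by blast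
    show "snd c p \<in> snd c ` (fst c \<inter> (fst d \<inter> fst e))" using p by blast
    fix y assume "y \<in> snd c ` (fst c \<inter> (fst d \<inter> fst e))"
    then obtain q where "q \<in> fst c" "q \<in> fst d" "q \<in> fst e" "y = snd c q" by blast
    then show "transition d e (transition c d y) = transition c e y"
      using A by (simp add: transition_chart)
  qed (use A in auto)
  then show ?thesis using fun_cong[OF 1, of u] by simp
qed

lemma tangent_spaceI:
  assumes "\<And>c. c \<notin> charts_at A p \<Longrightarrow> v c = 0"
    and "\<And>c d. c \<in> charts_at A p \<Longrightarrow> d \<in> charts_at A p \<Longrightarrow>
      v d = jac c d p (v c)"
  shows "v \<in> Tan p"
  using assms unfolding tangent_space_def by blast

lemma tangent_outside: "v \<in> Tan p \<Longrightarrow> c \<notin> charts_at A p \<Longrightarrow> v c = 0"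
  unfolding tangent_space_def by blast

lemma tangent_transition:
  "v \<in> Tan p \<Longrightarrow> c \<in> charts_at A p \<Longrightarrow> d \<in> charts_at A p \<Longrightarrow>
    v d = jac c d p (v c)"
  unfolding tangent_space_def by blast

lemma tangent_add:
  assumes "v \<in> Tan p" "w \<in> Tan p" shows "v +\<^sub>T w \<in> Tan p"
proof (rule tangent_spaceI)
  fix c d assume cd: "c \<in> charts_at A p" "d \<in> charts_at A p"
  show "(v +\<^sub>T w) d = jac c d p ((v +\<^sub>T w) c)"
    using tangent_transition[OF assms(1) cd] tangent_transition[OF assms(2) cd]
      linear_add[OF transition_linear[OF cd]] by simp
qed (simp add: tangent_outside[OF assms(1)] tangent_outside[OF assms(2)])

lemma tangent_scale:
  assumes "v \<in> Tan p" shows "a *\<^sub>T v \<in> Tan p"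
proof (rule tangent_spaceI)
  fix c d assume cd: "c \<in> charts_at A p" "d \<in> charts_at A p"
  show "(a *\<^sub>T v) d = jac c d p ((a *\<^sub>T v) c)"
    using tangent_transition[OF assms(1) cd] linear_cmul[OF transition_linear[OF cd]] by simp
qed (simp add: tangent_outside[OF assms])

lemma tangent_zero: "tzero \<in> Tan p"
  by (rule tangent_spaceI) (simp_all add: linear_0[OF transition_linear])

lemma tangent_eqI:
  assumes "v \<in> Tan p" "w \<in> Tan p" "c \<in> charts_at A p" "v c = w c"
  shows "v = w"
proof
  fix d show "v d = w d"
  proof (cases "d \<in> charts_at A p")
    case True
    then show ?thesis
      using tangent_transition[OF assms(1,3)] tangent_transition[OF assms(2,3)] assms(4) by simp
  next
    case False
    then show ?thesis using tangent_outside[OF assms(1)] tangent_outside[OF assms(2)] by simp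
  qed
qed

lemma chart_vec_tangent: "c \<in> charts_at A p \<Longrightarrow> chart_vec A c p u \<in> Tan p"
  by (rule tangent_spaceI) (simp_all add: chart_vec_def transition_derivative_cocycle)

lemma chart_vec_self: "c \<in> charts_at A p \<Longrightarrow> chart_vec A c p u c = u"
  by (simp add: chart_vec_def transition_derivative_self)

lemma chart_vec_component:
  "v \<in> Tan p \<Longrightarrow> c \<in> charts_at A p \<Longrightarrow> chart_vec A c p (v c) = v"
  by (rule tangent_eqI) (auto simp: chart_vec_tangent chart_vec_self)

lemma chart_vec_expansion:
  assumes "c \<in> charts_at A p"
  shows "chart_vec A c p u d = (\<Sum>b\<in>Basis. (u \<bullet> b) *\<^sub>R chart_vec A c p b d)"
  using linear_Basis_expansion[OF transition_linear[OF assms], of d u]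
  by (simp add: chart_vec_def)

text \<open>
  Smoothness is demanded in all charts.  On a set that lies in the domain of one chart, a
  transition map transports it from there to all the others.
\<close>
lemma smooth_on_read_in_chart:
  assumes "c \<in> A" "d \<in> A" "openin T U" "U \<subseteq> fst c" "smooth_on (snd c ` U) (\<lambda>x. f (chart_inv c x))"
  shows "smooth_on (snd d ` (fst d \<inter> U)) (\<lambda>x. f (chart_inv d x))"
proof -
  have oU: "open (snd c ` U)" using open_chart_image[OF assms(1,3)] assms(4) by (simp add: inf.absorb2)
  have "smooth_on (snd d ` (fst d \<inter> U)) (\<lambda>x. f (chart_inv c (transition d c x)))"
  proof (rule smooth_on_compose[OF open_chart_image[OF assms(2,3)] oU _ assms(5)])
    show "transition d c ` snd d ` (fst d \<inter> U) \<subseteq> snd c ` U"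
      using assms by (auto simp: transition_chart)
    show "smooth_on (snd d ` (fst d \<inter> U)) (transition d c)"
      by (rule smooth_on_subset[OF smooth_transition]) (use assms in auto)
  qed
  then show ?thesis
    by (rule smooth_on_cong[OF open_chart_image[OF assms(2,3)], rotated])
      (use assms in \<open>auto simp: transition_chart subset_iff\<close>)
qed

lemma smooth_fun_onI:
  assumes "c \<in> A" "openin T U" "U \<subseteq> fst c" "smooth_on (snd c ` U) (\<lambda>x. f (chart_inv c x))"
  shows "smooth_fun_on A U f"
  unfolding smooth_fun_on_def using smooth_on_read_in_chart[OF assms(1) _ assms(2-4)] by blast

lemma smooth_fun_on_chart:
  "smooth_fun_on A U f \<Longrightarrow> c \<in> A \<Longrightarrow> smooth_on (snd c ` (fst c \<inter> U)) (\<lambda>x. f (chart_inv c x))"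
  by (simp add: smooth_fun_on_def)

lemma vfield_chart:
  "smooth_vfield_on A U X \<Longrightarrow> c \<in> A \<Longrightarrow> smooth_on (snd c ` (fst c \<inter> U)) (\<lambda>x. X (chart_inv c x) c)"
  by (simp add: smooth_vfield_on_def)

lemma smooth_fun_on_cong:
  assumes "openin T U" "\<And>p. p \<in> U \<Longrightarrow> f p = g p" "smooth_fun_on A U f"
  shows "smooth_fun_on A U g"
  unfolding smooth_fun_on_def
proof
  fix c assume c: "c \<in> A"
  show "smooth_on (snd c ` (fst c \<inter> U)) (\<lambda>x. g (chart_inv c x))"
    by (rule smooth_on_cong[OF open_chart_image[OF c assms(1)] _ smooth_fun_on_chart[OF assms(3) c]])
      (use assms(2) c in auto)
qed

lemma smooth_fun_on_add:
  assumes "openin T U" "smooth_fun_on A U f" "smooth_fun_on A U g"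
  shows "smooth_fun_on A U (\<lambda>p. f p + g p)"
  unfolding smooth_fun_on_def
  by (rule ballI, rule smooth_on_add[OF open_chart_image[OF _ assms(1)] smooth_fun_on_chart[OF assms(2)]
      smooth_fun_on_chart[OF assms(3)]])

lemma smooth_fun_on_mult:
  assumes "openin T U" "smooth_fun_on A U f" "smooth_fun_on A U g"
  shows "smooth_fun_on A U (\<lambda>p. f p * g p)"
  unfolding smooth_fun_on_def
  by (rule ballI, rule smooth_on_mult[OF open_chart_image[OF _ assms(1)] smooth_fun_on_chart[OF assms(2)]
      smooth_fun_on_chart[OF assms(3)]])

lemma vfield_add:
  assumes "openin T U" "smooth_vfield_on A U X" "smooth_vfield_on A U Y"
  shows "smooth_vfield_on A U (\<lambda>p. X p +\<^sub>T Y p)"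
  unfolding smooth_vfield_on_def
proof (intro conjI ballI)
  fix c assume "c \<in> A"
  from smooth_on_add[OF open_chart_image[OF this assms(1)] vfield_chart[OF assms(2) this]
      vfield_chart[OF assms(3) this]]
  show "smooth_on (snd c ` (fst c \<inter> U)) (\<lambda>x. (X (chart_inv c x) +\<^sub>T Y (chart_inv c x)) c)"
    by (simp only: tadd_apply)
qed (rule tangent_add[OF vfield_tangent[OF assms(2)] vfield_tangent[OF assms(3)]])

lemma vfield_scale:
  assumes "openin T U" "smooth_fun_on A U f" "smooth_vfield_on A U X"
  shows "smooth_vfield_on A U (\<lambda>p. f p *\<^sub>T X p)"
  unfolding smooth_vfield_on_def
proof (intro conjI ballI)
  fix c assume "c \<in> A"
  from smooth_on_scaleR[OF open_chart_image[OF this assms(1)] smooth_fun_on_chart[OF assms(2) this]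
      vfield_chart[OF assms(3) this]]
  show "smooth_on (snd c ` (fst c \<inter> U)) (\<lambda>x. (f (chart_inv c x) *\<^sub>T X (chart_inv c x)) c)"
    by (simp only: tscale_apply)
qed (rule tangent_scale[OF vfield_tangent[OF assms(3)]])

lemma vfield_cong:
  assumes "openin T U" "\<And>p. p \<in> U \<Longrightarrow> X p = Y p" "smooth_vfield_on A U X"
  shows "smooth_vfield_on A U Y"
  unfolding smooth_vfield_on_def
proof (intro conjI ballI)
  fix c assume c: "c \<in> A"
  show "smooth_on (snd c ` (fst c \<inter> U)) (\<lambda>x. Y (chart_inv c x) c)"
    by (rule smooth_on_cong[OF open_chart_image[OF c assms(1)] _ vfield_chart[OF assms(3) c]])
      (use assms(2) c in auto)
next
  fix p assume "p \<in> U"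
  then show "Y p \<in> Tan p" using assms(2) vfield_tangent[OF assms(3)] by metis
qed

lemma vfield_zero: "smooth_vfield_on A U (\<lambda>p. tzero)"
  by (simp add: smooth_vfield_on_def tangent_zero smooth_on_const)

lemma smooth_component:
  assumes "c \<in> A" "openin T U" "U \<subseteq> fst c" "smooth_vfield_on A U X"
  shows "smooth_fun_on A U (\<lambda>p. X p c \<bullet> b)"
proof (rule smooth_fun_onI[OF assms(1-3)])
  have "fst c \<inter> U = U" using assms(3) by blast
  then show "smooth_on (snd c ` U) (\<lambda>x. X (chart_inv c x) c \<bullet> b)"
    using smooth_on_inner_right[OF open_chart_image[OF assms(1,2)] vfield_chart[OF assms(4,1)]]
    by simp
qed

text \<open>
  Read in another chart \<open>d\<close>, a coordinate field of \<open>c\<close> is a combination of the columns of the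
  Jacobian of a transition map, evaluated at the image under the inverse transition.
\<close>
lemma smooth_chart_vec:
  assumes "c \<in> A" shows "smooth_vfield_on A (fst c) (\<lambda>p. chart_vec A c p u)"
  unfolding smooth_vfield_on_def
proof (intro conjI ballI)
  fix p assume "p \<in> fst c"
  then show "chart_vec A c p u \<in> Tan p"
    using assms by (intro chart_vec_tangent) (simp add: charts_at_def)
next
  fix d assume d: "d \<in> A"
  note o = open_chart_image[OF d openin_chart[OF assms]]
  have "smooth_on (snd d ` (fst d \<inter> fst c))
     (\<lambda>x. frechet_derivative (transition c d) (at (transition d c x)) u)"
  proof (rule smooth_on_compose[OF o open_chart_image[OF assms openin_chart[OF d]] _
        smooth_on_derivative[OF smooth_transition[OF assms d]] smooth_transition[OF d assms]])
    show "transition d c ` snd d ` (fst d \<inter> fst c) \<subseteq> snd c ` (fst c \<inter> fst d)"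
      using d by (auto simp: transition_chart)
  qed
  then show "smooth_on (snd d ` (fst d \<inter> fst c)) (\<lambda>x. chart_vec A c (chart_inv d x) u d)"
    by (rule smooth_on_cong[OF o, rotated])
      (use d assms in \<open>auto simp: chart_vec_def charts_at_def transition_chart\<close>)
qed

text \<open>
  Directional derivatives are taken in an arbitrarily chosen chart; by the chain rule and the
  transformation law of tangent vectors the choice does not matter.
\<close>
lemma derivative_change_chart:
  assumes "openin T U" "p \<in> U" "smooth_fun_on A U f" "c \<in> charts_at A p" "d \<in> charts_at A p"
    "v \<in> Tan p"
  shows "frechet_derivative (\<lambda>x. f (chart_inv c x)) (at (snd c p)) (v c)
    = frechet_derivative (\<lambda>x. f (chart_inv d x)) (at (snd d p)) (v d)"
proof -
  have A: "c \<in> A" "d \<in> A" and p: "p \<in> fst c" "p \<in> fst d"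
    using assms by (auto simp: charts_at_def)
  have "((\<lambda>x. f (chart_inv d x)) has_derivative
     frechet_derivative (\<lambda>x. f (chart_inv d x)) (at (snd d p))) (at (transition c d (snd c p)))"
    unfolding transition_chart[OF A(1) p(1)]
    by (rule smooth_on_has_derivative[OF smooth_fun_on_chart[OF assms(3) A(2)]]) (use p assms in auto)
  then have "((\<lambda>x. f (chart_inv d (transition c d x))) has_derivative
     (\<lambda>u. frechet_derivative (\<lambda>x. f (chart_inv d x)) (at (snd d p))
       (jac c d p u))) (at (snd c p))"
    by (rule has_derivative_compose[OF transition_has_derivative[OF assms(4,5)]])
  note 1 = frechet_derivative_at[OF this, symmetric]
  have "frechet_derivative (\<lambda>x. f (chart_inv d (transition c d x))) (at (snd c p))
    = frechet_derivative (\<lambda>x. f (chart_inv c x)) (at (snd c p))"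
  proof (rule frechet_derivative_cong_open[OF open_chart_image[of c "fst d"]])
    show "snd c p \<in> snd c ` (fst c \<inter> fst d)" using p by blast
  qed (use A in \<open>auto simp: transition_chart openin_chart\<close>)
  then show ?thesis
    using fun_cong[OF 1, of "v c"] tangent_transition[OF assms(6,4,5)] by simp
qed

lemma dir_deriv_chart:
  assumes "openin T U" "p \<in> U" "smooth_fun_on A U f" "c \<in> charts_at A p" "v \<in> Tan p"
  shows "dir_deriv A p v f = frechet_derivative (\<lambda>x. f (chart_inv c x)) (at (snd c p)) (v c)"
proof -
  have "(SOME c. c \<in> charts_at A p) \<in> charts_at A p" using assms(4) by (rule someI)
  from derivative_change_chart[OF assms(1-3) this assms(4,5)] show ?thesis
    by (simp add: dir_deriv_def Let_def)
qed

lemma fun_chart_has_derivative: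
  assumes "p \<in> U" "smooth_fun_on A U f" "c \<in> charts_at A p"
  shows "((\<lambda>x. f (chart_inv c x)) has_derivative
    frechet_derivative (\<lambda>x. f (chart_inv c x)) (at (snd c p))) (at (snd c p))"
  by (rule smooth_on_has_derivative[OF smooth_fun_on_chart[OF assms(2)]])
    (use assms in \<open>auto simp: charts_at_def\<close>)

lemma dir_deriv_cong:
  assumes "openin T U" "p \<in> U" "\<And>q. q \<in> U \<Longrightarrow> f q = g q"
  shows "dir_deriv A p v f = dir_deriv A p v g"
proof -
  define c where "c = (SOME c. c \<in> charts_at A p)"
  have "p \<in> topspace T" using assms openin_subset by blast
  then have "c \<in> charts_at A p" unfolding c_def using charts_at_nonempty someI_ex by metis
  then have c: "c \<in> A" "p \<in> fst c" by (auto simp: charts_at_def)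
  have "frechet_derivative (\<lambda>x. f (chart_inv c x)) (at (snd c p))
      = frechet_derivative (\<lambda>x. g (chart_inv c x)) (at (snd c p))"
    by (rule frechet_derivative_cong_open[OF open_chart_image[OF c(1) assms(1)]]) (use c assms in auto)
  then show ?thesis by (simp add: dir_deriv_def flip: c_def)
qed

lemma dir_deriv_const: "dir_deriv A p v (\<lambda>q. a) = 0"
  by (simp add: dir_deriv_def Let_def)

context
  fixes U p assumes U: "openin T U" "p \<in> U"
begin

lemma chart_at_point: obtains c where "c \<in> charts_at A p"
  using U charts_at_nonempty openin_subset by blast

lemma dir_deriv_add:
  assumes "smooth_fun_on A U f" "smooth_fun_on A U g" "v \<in> Tan p"
  shows "dir_deriv A p v (\<lambda>q. f q + g q) = dir_deriv A p v f + dir_deriv A p v g"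
proof -
  obtain c where c: "c \<in> charts_at A p" by (rule chart_at_point)
  note D = has_derivative_add[OF fun_chart_has_derivative[OF U(2) assms(1) c]
      fun_chart_has_derivative[OF U(2) assms(2) c]]
  show ?thesis
    unfolding dir_deriv_chart[OF U smooth_fun_on_add[OF U(1) assms(1,2)] c assms(3)]
      dir_deriv_chart[OF U assms(1) c assms(3)] dir_deriv_chart[OF U assms(2) c assms(3)]
    using fun_cong[OF frechet_derivative_at[OF D, symmetric], of "v c"] by simp
qed

end

lemma smooth_dir_deriv:
  assumes "openin T U" "smooth_fun_on A U f" "smooth_vfield_on A U X"
  shows "smooth_fun_on A U (\<lambda>q. dir_deriv A q (X q) f)"
  unfolding smooth_fun_on_def
proof
  fix c assume c: "c \<in> A"
  note o = open_chart_image[OF c assms(1)]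
  show "smooth_on (snd c ` (fst c \<inter> U)) (\<lambda>x. dir_deriv A (chart_inv c x) (X (chart_inv c x)) f)"
  proof (rule smooth_on_cong[OF o _ smooth_on_derivative_along_field[OF o
          smooth_fun_on_chart[OF assms(2) c] vfield_chart[OF assms(3) c]]])
    fix x assume "x \<in> snd c ` (fst c \<inter> U)"
    then obtain q where q: "q \<in> fst c" "q \<in> U" "x = snd c q" by blast
    have "c \<in> charts_at A q" using c q by (simp add: charts_at_def)
    from dir_deriv_chart[OF assms(1) q(2) assms(2) this vfield_tangent[OF assms(3) q(2)]]
    show "frechet_derivative (\<lambda>x. f (chart_inv c x)) (at x) (X (chart_inv c x) c)
      = dir_deriv A (chart_inv c x) (X (chart_inv c x)) f"
      using q c by simp
  qed
qed

lemma lie_bracket_chart: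
  "c \<in> charts_at A p \<Longrightarrow> lie_bracket A X Y p c =
    frechet_derivative (\<lambda>x. Y (chart_inv c x) c) (at (snd c p)) (X p c)
    - frechet_derivative (\<lambda>x. X (chart_inv c x) c) (at (snd c p)) (Y p c)"
  by (simp add: lie_bracket_def)

text \<open>
  The bracket is given by its components in every chart.  That it transforms as a vector is an
  assumption here; for the fields below it follows from the existence of a torsion-free connection.
\<close>
lemma dir_deriv_commutator:
  assumes "openin T U" "p \<in> U" "smooth_fun_on A U f" "smooth_vfield_on A U X" "smooth_vfield_on A U Y"
    and "lie_bracket A X Y p \<in> Tan p"
  shows "dir_deriv A p (X p) (\<lambda>q. dir_deriv A q (Y q) f) - dir_deriv A p (Y p) (\<lambda>q. dir_deriv A q (X q) f)
    = dir_deriv A p (lie_bracket A X Y p) f"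
proof -
  obtain c where c: "c \<in> charts_at A p" using assms(1,2) by (rule chart_at_point)
  then have cA: "c \<in> A" "p \<in> fst c" by (auto simp: charts_at_def)
  note o = open_chart_image[OF cA(1) assms(1)]
  have m: "snd c p \<in> snd c ` (fst c \<inter> U)" using cA assms(2) by blast
  have D: "dir_deriv A p (Z p) (\<lambda>q. dir_deriv A q (W q) f)
    = frechet_derivative (\<lambda>x. frechet_derivative (\<lambda>x. f (chart_inv c x)) (at x) (W (chart_inv c x) c))
        (at (snd c p)) (Z (chart_inv c (snd c p)) c)"
    if Z: "smooth_vfield_on A U Z" and W: "smooth_vfield_on A U W" for Z W
  proof -
    have "dir_deriv A p (Z p) (\<lambda>q. dir_deriv A q (W q) f) =
      frechet_derivative (\<lambda>x. dir_deriv A (chart_inv c x) (W (chart_inv c x)) f) (at (snd c p)) (Z p c)"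
      by (rule dir_deriv_chart[OF assms(1,2) smooth_dir_deriv[OF assms(1,3) W] c
            vfield_tangent[OF Z assms(2)]])
    also have "frechet_derivative (\<lambda>x. dir_deriv A (chart_inv c x) (W (chart_inv c x)) f) (at (snd c p))
      = frechet_derivative (\<lambda>x. frechet_derivative (\<lambda>x. f (chart_inv c x)) (at x) (W (chart_inv c x) c))
        (at (snd c p))"
    proof (rule frechet_derivative_cong_open[OF o m])
      fix x assume "x \<in> snd c ` (fst c \<inter> U)"
      then obtain q where q: "q \<in> fst c" "q \<in> U" "x = snd c q" by blast
      have "c \<in> charts_at A q" using cA q by (simp add: charts_at_def)
      from dir_deriv_chart[OF assms(1) q(2) assms(3) this vfield_tangent[OF W q(2)]]
      show "dir_deriv A (chart_inv c x) (W (chart_inv c x)) f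
        = frechet_derivative (\<lambda>x. f (chart_inv c x)) (at x) (W (chart_inv c x) c)"
        using q cA by simp
    qed
    finally show ?thesis using cA by simp
  qed
  show ?thesis
    unfolding D[OF assms(4,5)] D[OF assms(5,4)] dir_deriv_chart[OF assms(1-3) c assms(6)]
      derivative_along_fields_commutator[OF o smooth_fun_on_chart[OF assms(3) cA(1)]
        vfield_chart[OF assms(4) cA(1)] vfield_chart[OF assms(5) cA(1)] m]
    using cA c by (simp add: lie_bracket_chart)
qed

lemma lie_bracket_chart_vec:
  assumes "c \<in> charts_at A p"
  shows "lie_bracket A (\<lambda>q. chart_vec A c q u) (\<lambda>q. chart_vec A c q v) p c = 0"
proof -
  have c: "c \<in> A" "p \<in> fst c" using assms by (auto simp: charts_at_def)
  have "frechet_derivative (\<lambda>x. chart_vec A c (chart_inv c x) w c) (at (snd c p))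
    = frechet_derivative (\<lambda>x. w) (at (snd c p))" for w
  proof (rule frechet_derivative_cong_open[OF open_chart_image[OF c(1) openin_chart[OF c(1)]]])
    fix y assume "y \<in> snd c ` (fst c \<inter> fst c)"
    then show "chart_vec A c (chart_inv c y) w c = w"
      using c by (auto intro!: chart_vec_self simp: charts_at_def)
  qed (use c in auto)
  then show ?thesis by (simp add: lie_bracket_chart[OF assms])
qed

end

section \<open>The Levi-Civita connection and its curvature tensor\<close>

text \<open>
  Linearity of \<open>Q\<close> over the functions on a neighbourhood \<open>U\<close> of \<open>p\<close>.  It makes \<open>Q X\<close> depend only on
  the vector \<open>X p\<close> (\<open>tensorial_pointwise\<close>).
\<close>
definition tensorial_at ::
  "('m, 'e::euclidean_space) chart set \<Rightarrow> 'm set \<Rightarrow> 'm \<Rightarrow> (('m, 'e) vfield \<Rightarrow> ('m, 'e) tvec) \<Rightarrow> bool" where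
  "tensorial_at A U p Q \<longleftrightarrow>
     (\<forall>X Y. smooth_vfield_on A U X \<and> smooth_vfield_on A U Y \<longrightarrow> Q (\<lambda>q. X q +\<^sub>T Y q) = Q X +\<^sub>T Q Y) \<and>
     (\<forall>f X. smooth_fun_on A U f \<and> smooth_vfield_on A U X \<longrightarrow> Q (\<lambda>q. f q *\<^sub>T X q) = f p *\<^sub>T Q X)"

lemma tensorial_at_add:
  "tensorial_at A U p Q \<Longrightarrow> smooth_vfield_on A U X \<Longrightarrow> smooth_vfield_on A U Y \<Longrightarrow>
    Q (\<lambda>q. X q +\<^sub>T Y q) = Q X +\<^sub>T Q Y"
  unfolding tensorial_at_def by blast

lemma tensorial_at_scale:
  "tensorial_at A U p Q \<Longrightarrow> smooth_fun_on A U f \<Longrightarrow> smooth_vfield_on A U X \<Longrightarrow>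
    Q (\<lambda>q. f q *\<^sub>T X q) = f p *\<^sub>T Q X"
  unfolding tensorial_at_def by blast

lemma tscale_one [simp]: "1 *\<^sub>T v = v" and tscale_zero [simp]: "0 *\<^sub>T v = tzero"
  and tscale_tzero [simp]: "a *\<^sub>T tzero = tzero" and tadd_tzero [simp]: "v +\<^sub>T tzero = v" "tzero +\<^sub>T v = v"
  by (simp_all add: fun_eq_iff)

context manifold
begin

lemma smooth_indicator: "openin T U \<Longrightarrow> smooth_fun_on A U (\<lambda>q. if q \<in> U then 1 else 0)"
  by (rule smooth_fun_on_cong[OF _ _ smooth_fun_on_const[of A U 1]]) auto

lemma indicator_scale_eq:
  "(\<And>q. q \<in> U \<Longrightarrow> X q = Y q) \<Longrightarrow>
    (\<lambda>q. (if q \<in> U then 1 else 0) *\<^sub>T X q) = (\<lambda>q. (if q \<in> U then 1 else 0) *\<^sub>T Y q)"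
  by (rule ext) simp

text \<open>
  Fields are total functions, so even the irrelevance of their values outside \<open>U\<close> has to be derived:
  the indicator function of \<open>U\<close> is smooth on \<open>U\<close>, and multiplication by it erases these values.
\<close>
lemma tensorial_local:
  assumes "openin T U" "p \<in> U" "tensorial_at A U p Q"
    and "smooth_vfield_on A U X" "smooth_vfield_on A U Y" "\<And>q. q \<in> U \<Longrightarrow> X q = Y q"
  shows "Q X = Q Y"
proof -
  have 1: "Q (\<lambda>q. (if q \<in> U then 1 else 0) *\<^sub>T Z q) = Q Z" if "smooth_vfield_on A U Z" for Z
    using tensorial_at_scale[OF assms(3) smooth_indicator[OF assms(1)] that] assms(2) by simp
  show ?thesis
    using 1[OF assms(4)] 1[OF assms(5)] arg_cong[OF indicator_scale_eq[of U X Y, OF assms(6)], of Q]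
    by (simp only:)
qed

text \<open>
  The component functions of \<open>X\<close> in a chart are smooth, so they may be pulled out of \<open>Q\<close>; only their
  values at \<open>p\<close> survive.
\<close>
lemma tensorial_chart_expansion:
  assumes U: "openin T U" "p \<in> U" and Q: "tensorial_at A U p Q" and c: "c \<in> A" "U \<subseteq> fst c"
    and X: "smooth_vfield_on A U X"
  shows "Q X = (\<lambda>d. \<Sum>b\<in>Basis. (X p c \<bullet> b) *\<^sub>R Q (\<lambda>q. chart_vec A c q b) d)"
proof -
  define F where "F B = (\<lambda>q d. \<Sum>b\<in>B. (X q c \<bullet> b) *\<^sub>R chart_vec A c q b d)" for B :: "'e set"
  have E: "smooth_vfield_on A U (\<lambda>q. chart_vec A c q b)" for b
    by (rule vfield_subset[OF smooth_chart_vec[OF c(1)] c(2)])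
  have main: "smooth_vfield_on A U (F B) \<and>
     Q (F B) = (\<lambda>d. \<Sum>b\<in>B. (X p c \<bullet> b) *\<^sub>R Q (\<lambda>q. chart_vec A c q b) d)" if "finite B" for B
    using that
  proof (induction B rule: finite_induct)
    case empty
    have F0: "F {} = (\<lambda>q. tzero)" by (simp add: F_def fun_eq_iff)
    have "Q (\<lambda>q. 0 *\<^sub>T tzero) = 0 *\<^sub>T Q (\<lambda>q. tzero)"
      by (rule tensorial_at_scale[OF Q smooth_fun_on_const vfield_zero])
    then have "Q (\<lambda>q. tzero) = tzero" by simp
    then show ?case unfolding F0 using vfield_zero by (simp add: tzero_def)
  next
    case (insert b B)
    have FI: "F (insert b B) = (\<lambda>q. (X q c \<bullet> b) *\<^sub>T chart_vec A c q b +\<^sub>T F B q)"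
      using insert.hyps by (simp add: F_def fun_eq_iff)
    note f = smooth_component[OF c(1) U(1) c(2) X, of b]
    note 1 = vfield_scale[OF U(1) f E]
    have "Q (\<lambda>q. (X q c \<bullet> b) *\<^sub>T chart_vec A c q b +\<^sub>T F B q)
       = (X p c \<bullet> b) *\<^sub>T Q (\<lambda>q. chart_vec A c q b) +\<^sub>T Q (F B)"
      using tensorial_at_add[OF Q 1 insert.IH[THEN conjunct1]] tensorial_at_scale[OF Q f E] by simp
    then have "Q (F (insert b B)) = (\<lambda>d. \<Sum>b\<in>insert b B. (X p c \<bullet> b) *\<^sub>R Q (\<lambda>q. chart_vec A c q b) d)"
      unfolding FI using insert by (simp add: fun_eq_iff)
    moreover have "smooth_vfield_on A U (F (insert b B))"
      unfolding FI by (rule vfield_add[OF U(1) 1 insert.IH[THEN conjunct1]])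
    ultimately show ?case by blast
  qed
  have "X q = F Basis q" if "q \<in> U" for q
  proof -
    have cq: "c \<in> charts_at A q" using that c by (auto simp: charts_at_def)
    have "X q = chart_vec A c q (X q c)"
      using chart_vec_component[OF vfield_tangent[OF X that] cq] by simp
    then show ?thesis using chart_vec_expansion[OF cq, of "X q c"] by (simp add: F_def fun_eq_iff)
  qed
  then have "Q X = Q (F Basis)"
    using tensorial_local[OF U Q X] main[OF finite_Basis] by blast
  then show ?thesis using main[OF finite_Basis] by simp
qed

lemma tensorial_pointwise:
  assumes U: "openin T U" "p \<in> U"
    and Q: "\<And>V. openin T V \<Longrightarrow> p \<in> V \<Longrightarrow> V \<subseteq> U \<Longrightarrow> tensorial_at A V p Q"
    and X: "smooth_vfield_on A U X" and Y: "smooth_vfield_on A U Y" and "X p = Y p"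
  shows "Q X = Q Y"
proof -
  obtain c where "c \<in> charts_at A p" using U by (rule chart_at_point)
  then have c: "c \<in> A" "p \<in> fst c" by (auto simp: charts_at_def)
  let ?V = "U \<inter> fst c"
  have V: "openin T ?V" "p \<in> ?V" "?V \<subseteq> U" "?V \<subseteq> fst c" using U c openin_Int[OF U(1) openin_chart[OF c(1)]] by auto
  show ?thesis
    unfolding tensorial_chart_expansion[OF V(1,2) Q[OF V(1-3)] c(1) V(4) vfield_subset[OF X V(3)]]
      tensorial_chart_expansion[OF V(1,2) Q[OF V(1-3)] c(1) V(4) vfield_subset[OF Y V(3)]]
      assms(6) ..
qed

end

locale riemannian_manifold = manifold T A
  for T :: "'m topology" and A :: "('m, 'e::euclidean_space) chart set" +
  fixes g :: "('m, 'e) form2"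
  assumes metric: "riemannian_metric T A g"
begin

lemma metric_linear:
  "p \<in> topspace T \<Longrightarrow> x \<in> Tan p \<Longrightarrow> y \<in> Tan p \<Longrightarrow> z \<in> Tan p \<Longrightarrow>
    g p (a *\<^sub>T x +\<^sub>T b *\<^sub>T y) z = a * g p x z + b * g p y z"
  by (rule metric[unfolded riemannian_metric_def, THEN conjunct1, rule_format])

lemma metric_sym:
  "p \<in> topspace T \<Longrightarrow> x \<in> Tan p \<Longrightarrow> y \<in> Tan p \<Longrightarrow> g p x y = g p y x"
  by (rule metric[unfolded riemannian_metric_def, THEN conjunct2, THEN conjunct1, rule_format])

lemma metric_pos:
  "p \<in> topspace T \<Longrightarrow> x \<in> Tan p \<Longrightarrow> x \<noteq> tzero \<Longrightarrow> g p x x > 0"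
  by (rule metric[unfolded riemannian_metric_def, THEN conjunct2, THEN conjunct2, THEN conjunct1, rule_format])

lemma smooth_metric:
  "openin T U \<Longrightarrow> smooth_vfield_on A U X \<Longrightarrow> smooth_vfield_on A U Y \<Longrightarrow>
    smooth_fun_on A U (\<lambda>p. g p (X p) (Y p))"
  by (rule metric[unfolded riemannian_metric_def, THEN conjunct2, THEN conjunct2, THEN conjunct2, rule_format]; (intro conjI)?; assumption)

lemma metric_add:
  "p \<in> topspace T \<Longrightarrow> x \<in> Tan p \<Longrightarrow> y \<in> Tan p \<Longrightarrow> z \<in> Tan p \<Longrightarrow>
    g p (x +\<^sub>T y) z = g p x z + g p y z"
  using metric_linear[of p x y z 1 1] by simp

lemma metric_scale:
  "p \<in> topspace T \<Longrightarrow> x \<in> Tan p \<Longrightarrow> z \<in> Tan p \<Longrightarrow>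
    g p (a *\<^sub>T x) z = a * g p x z"
  using metric_linear[of p x x z a 0] by simp

lemma metric_linear_right:
  assumes "p \<in> topspace T" "x \<in> Tan p" "y \<in> Tan p" "z \<in> Tan p"
  shows "g p z (a *\<^sub>T x +\<^sub>T b *\<^sub>T y) = a * g p z x + b * g p z y"
  using metric_linear[OF assms, of a b] metric_sym[OF assms(1) _ assms(4)]
    tangent_add[OF tangent_scale[OF assms(2)] tangent_scale[OF assms(3)]] assms(2,3) by metis

lemma metric_scale_right:
  "p \<in> topspace T \<Longrightarrow> x \<in> Tan p \<Longrightarrow> z \<in> Tan p \<Longrightarrow>
    g p z (a *\<^sub>T x) = a * g p z x"
  using metric_linear_right[of p x x z a 0] by simp

lemma metric_zero: "p \<in> topspace T \<Longrightarrow> z \<in> Tan p \<Longrightarrow> g p tzero z = 0"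
  using metric_scale[of p tzero z 0] tangent_zero by simp

lemma metric_nonneg: "p \<in> topspace T \<Longrightarrow> x \<in> Tan p \<Longrightarrow> g p x x \<ge> 0"
  using metric_pos[of p x] metric_zero[of p x] by (cases "x = tzero") auto

text \<open>Vectors are identified through their inner products, which is what Koszul's formula computes.\<close>
lemma metric_nondegenerate:
  assumes "p \<in> topspace T" "x \<in> Tan p" "y \<in> Tan p"
    and "\<And>z. z \<in> Tan p \<Longrightarrow> g p x z = g p y z"
  shows "x = y"
proof (rule ccontr)
  assume "x \<noteq> y"
  then have "x -\<^sub>T y \<noteq> tzero" by (simp add: fun_eq_iff)
  moreover have d: "x -\<^sub>T y \<in> Tan p" using assms tangent_add tangent_scale by blast
  ultimately have "g p (x -\<^sub>T y) (x -\<^sub>T y) > 0" using metric_pos assms(1) by blast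
  moreover have "g p (x -\<^sub>T y) (x -\<^sub>T y) = g p x (x -\<^sub>T y) - g p y (x -\<^sub>T y)"
    using metric_linear[of p x y "x -\<^sub>T y" 1 "-1"] assms d by simp
  ultimately show False using assms(4)[OF d] by simp
qed

end

locale levi_civita_manifold = riemannian_manifold T A g
  for T :: "'m topology" and A :: "('m, 'e::euclidean_space) chart set" and g :: "('m, 'e) form2" +
  fixes nabla :: "('m, 'e) vfield \<Rightarrow> ('m, 'e) vfield \<Rightarrow> ('m, 'e) vfield"
  assumes levi_civita: "levi_civita T A g nabla"
begin

abbreviation "curv \<equiv> curvature_fields A nabla"
abbreviation "curv_op \<equiv> curvature_op T A nabla"

context
  fixes U assumes U: "openin T U"
begin

lemma affine: "affine_connection T A nabla"
  using levi_civita unfolding levi_civita_def by blast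

lemma nabla_smooth:
  "smooth_vfield_on A U X \<Longrightarrow> smooth_vfield_on A U Y \<Longrightarrow> smooth_vfield_on A U (nabla X Y)"
  by (rule affine[unfolded affine_connection_def, rule_format, OF U, THEN conjunct1, rule_format]; (intro conjI)?; assumption)

lemma nabla_add_left:
  "smooth_vfield_on A U X \<Longrightarrow> smooth_vfield_on A U X' \<Longrightarrow> smooth_vfield_on A U Y \<Longrightarrow> p \<in> U \<Longrightarrow>
    nabla (\<lambda>q. X q +\<^sub>T X' q) Y p = nabla X Y p +\<^sub>T nabla X' Y p"
  by (rule affine[unfolded affine_connection_def, rule_format, OF U, THEN conjunct2, THEN conjunct1, rule_format]; (intro conjI)?; assumption)

lemma nabla_scale_left:
  "smooth_fun_on A U f \<Longrightarrow> smooth_vfield_on A U X \<Longrightarrow> smooth_vfield_on A U Y \<Longrightarrow> p \<in> U \<Longrightarrow>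
    nabla (\<lambda>q. f q *\<^sub>T X q) Y p = f p *\<^sub>T nabla X Y p"
  by (rule affine[unfolded affine_connection_def, rule_format, OF U, THEN conjunct2, THEN conjunct2, THEN conjunct1, rule_format]; (intro conjI)?; assumption)

lemma nabla_add_right:
  "smooth_vfield_on A U X \<Longrightarrow> smooth_vfield_on A U Y \<Longrightarrow> smooth_vfield_on A U Y' \<Longrightarrow> p \<in> U \<Longrightarrow>
    nabla X (\<lambda>q. Y q +\<^sub>T Y' q) p = nabla X Y p +\<^sub>T nabla X Y' p"
  by (rule affine[unfolded affine_connection_def, rule_format, OF U, THEN conjunct2, THEN conjunct2, THEN conjunct2, THEN conjunct1, rule_format]; (intro conjI)?; assumption)

lemma nabla_leibniz:
  "smooth_fun_on A U f \<Longrightarrow> smooth_vfield_on A U X \<Longrightarrow> smooth_vfield_on A U Y \<Longrightarrow> p \<in> U \<Longrightarrow>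
    nabla X (\<lambda>q. f q *\<^sub>T Y q) p = dir_deriv A p (X p) f *\<^sub>T Y p +\<^sub>T f p *\<^sub>T nabla X Y p"
  by (rule affine[unfolded affine_connection_def, rule_format, OF U, THEN conjunct2, THEN conjunct2, THEN conjunct2, THEN conjunct2, rule_format]; (intro conjI)?; assumption)

lemma torsion_free:
  "smooth_vfield_on A U X \<Longrightarrow> smooth_vfield_on A U Y \<Longrightarrow> p \<in> U \<Longrightarrow>
    lie_bracket A X Y p = nabla X Y p -\<^sub>T nabla Y X p"
  by (rule levi_civita[unfolded levi_civita_def, THEN conjunct2, THEN conjunct1, rule_format, symmetric]; (intro conjI)?; (assumption | rule U))

lemma metric_compatible:
  "smooth_vfield_on A U X \<Longrightarrow> smooth_vfield_on A U Y \<Longrightarrow> smooth_vfield_on A U Z \<Longrightarrow> p \<in> U \<Longrightarrow>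
    dir_deriv A p (X p) (\<lambda>q. g q (Y q) (Z q)) = g p (nabla X Y p) (Z p) + g p (Y p) (nabla X Z p)"
  by (rule levi_civita[unfolded levi_civita_def, THEN conjunct2, THEN conjunct2, rule_format]; (intro conjI)?; (assumption | rule U))

lemma topspaceI: "p \<in> U \<Longrightarrow> p \<in> topspace T"
  using U openin_subset by blast

lemma nabla_tensorial_left:
  "smooth_vfield_on A U Y \<Longrightarrow> p \<in> U \<Longrightarrow> tensorial_at A U p (\<lambda>X. nabla X Y p)"
  unfolding tensorial_at_def using nabla_add_left nabla_scale_left by blast

lemma nabla_cong_left:
  assumes "smooth_vfield_on A U X" "smooth_vfield_on A U X'" "smooth_vfield_on A U Y" "p \<in> U"
    "\<And>q. q \<in> U \<Longrightarrow> X q = X' q"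
  shows "nabla X Y p = nabla X' Y p"
  using tensorial_local[OF U assms(4) nabla_tensorial_left[OF assms(3,4)] assms(1,2,5)] .

text \<open>
  Multiplication by the indicator function of \<open>U\<close> makes the two fields equal as total functions; the
  additional term of the Leibniz rule is \<open>0\<close>, because the indicator is constant near \<open>p\<close>.
\<close>
lemma nabla_cong_right:
  assumes "smooth_vfield_on A U X" "smooth_vfield_on A U Y" "smooth_vfield_on A U Y'" "p \<in> U"
    "\<And>q. q \<in> U \<Longrightarrow> Y q = Y' q"
  shows "nabla X Y p = nabla X Y' p"
proof -
  have d0: "dir_deriv A p (X p) (\<lambda>q. if q \<in> U then 1 else 0) = 0"
    using dir_deriv_cong[OF U assms(4), of "\<lambda>q. if q \<in> U then 1 else 0" "\<lambda>q. 1" "X p"]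
      dir_deriv_const by simp
  have 1: "nabla X (\<lambda>q. (if q \<in> U then 1 else 0) *\<^sub>T Z q) p = nabla X Z p"
    if "smooth_vfield_on A U Z" for Z
    using nabla_leibniz[OF smooth_indicator[OF U] assms(1) that assms(4)] assms(4) d0 by simp
  show ?thesis
    using 1[OF assms(2)] 1[OF assms(3)]
      arg_cong[OF indicator_scale_eq[of U Y Y', OF assms(5)], of "\<lambda>Y. nabla X Y p"]
    by (simp only:)
qed

lemma nabla_scale_const_left:
  assumes "smooth_vfield_on A U X" "smooth_vfield_on A U Y" "p \<in> U"
  shows "nabla (\<lambda>q. a *\<^sub>T X q) Y p = a *\<^sub>T nabla X Y p"
  by (rule nabla_scale_left[OF smooth_fun_on_const assms])

lemma nabla_scale_const_right:
  assumes "smooth_vfield_on A U X" "smooth_vfield_on A U Y" "p \<in> U"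
  shows "nabla X (\<lambda>q. a *\<^sub>T Y q) p = a *\<^sub>T nabla X Y p"
  using nabla_leibniz[OF smooth_fun_on_const assms] by (simp add: dir_deriv_const)

lemma smooth_scale_const: "smooth_vfield_on A U X \<Longrightarrow> smooth_vfield_on A U (\<lambda>q. a *\<^sub>T X q)"
  by (rule vfield_scale[OF U smooth_fun_on_const])

text \<open>
  That the bracket is a field, which in coordinates needs the symmetry of the second derivatives of
  the transition maps, comes for free from the torsion-free connection.
\<close>
lemma smooth_lie_bracket:
  assumes "smooth_vfield_on A U X" "smooth_vfield_on A U Y"
  shows "smooth_vfield_on A U (lie_bracket A X Y)"
  by (rule vfield_cong[OF U torsion_free[OF assms, symmetric]
        vfield_add[OF U nabla_smooth[OF assms] smooth_scale_const[OF nabla_smooth[OF assms(2,1)]]]])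

text \<open>
  Torsion-freeness removes the bracket from the curvature; what remains are second covariant
  derivatives, to which the rules for a connection apply.
\<close>
lemma curvature_torsion_free:
  assumes "smooth_vfield_on A U X" "smooth_vfield_on A U Y" "smooth_vfield_on A U Z" "p \<in> U"
  shows "curv X Y Z p =
    (nabla X (nabla Y Z) p -\<^sub>T nabla Y (nabla X Z) p)
      -\<^sub>T (nabla (nabla X Y) Z p -\<^sub>T nabla (nabla Y X) Z p)"
proof -
  note XY = nabla_smooth[OF assms(1,2)] and YX = nabla_smooth[OF assms(2,1)]
  have "nabla (lie_bracket A X Y) Z p = nabla (\<lambda>q. nabla X Y q -\<^sub>T nabla Y X q) Z p"
    by (rule nabla_cong_left[OF smooth_lie_bracket[OF assms(1,2)]
          vfield_add[OF U XY smooth_scale_const[OF YX]] assms(3,4)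
          torsion_free[OF assms(1,2)]])
  also have "\<dots> = nabla (nabla X Y) Z p -\<^sub>T nabla (nabla Y X) Z p"
    using nabla_add_left[OF XY smooth_scale_const[OF YX] assms(3,4)]
      nabla_scale_const_left[OF YX assms(3,4)] by simp
  finally show ?thesis by (simp add: curvature_fields_def)
qed

lemma curvature_fields_antisym:
  assumes "smooth_vfield_on A U X" "smooth_vfield_on A U Y" "smooth_vfield_on A U Z" "p \<in> U"
  shows "curv X Y Z p = (-1) *\<^sub>T curv Y X Z p"
  unfolding curvature_torsion_free[OF assms] curvature_torsion_free[OF assms(2,1,3,4)]
  by (simp add: fun_eq_iff)

text \<open>
  The derivative \<open>Y f\<close> enters twice, through \<open>\<nabla>\<^sub>Y (f \<nabla>\<^sub>X Z)\<close> and through the covariant derivative of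
  \<open>Z\<close> along \<open>\<nabla>\<^sub>Y (f X)\<close>, with opposite signs.
\<close>
lemma curvature_fields_tensorial_1:
  assumes Y: "smooth_vfield_on A U Y" and Z: "smooth_vfield_on A U Z" and p: "p \<in> U"
  shows "tensorial_at A U p (\<lambda>X. curv X Y Z p)"
  unfolding tensorial_at_def
proof (intro conjI allI impI; elim conjE)
  fix X X' assume X: "smooth_vfield_on A U X" and X': "smooth_vfield_on A U X'"
  note XX = vfield_add[OF U X X']
  have 1: "nabla Y (nabla (\<lambda>q. X q +\<^sub>T X' q) Z) p = nabla Y (nabla X Z) p +\<^sub>T nabla Y (nabla X' Z) p"
    using nabla_cong_right[OF Y nabla_smooth[OF XX Z]
        vfield_add[OF U nabla_smooth[OF X Z] nabla_smooth[OF X' Z]] p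
        nabla_add_left[OF X X' Z]]
      nabla_add_right[OF Y nabla_smooth[OF X Z] nabla_smooth[OF X' Z] p] by simp
  have 2: "nabla (nabla (\<lambda>q. X q +\<^sub>T X' q) Y) Z p = nabla (nabla X Y) Z p +\<^sub>T nabla (nabla X' Y) Z p"
    using nabla_cong_left[OF nabla_smooth[OF XX Y]
        vfield_add[OF U nabla_smooth[OF X Y] nabla_smooth[OF X' Y]] Z p
        nabla_add_left[OF X X' Y]]
      nabla_add_left[OF nabla_smooth[OF X Y] nabla_smooth[OF X' Y] Z p] by simp
  have 3: "nabla (nabla Y (\<lambda>q. X q +\<^sub>T X' q)) Z p = nabla (nabla Y X) Z p +\<^sub>T nabla (nabla Y X') Z p"
    using nabla_cong_left[OF nabla_smooth[OF Y XX]
        vfield_add[OF U nabla_smooth[OF Y X] nabla_smooth[OF Y X']] Z p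
        nabla_add_right[OF Y X X']]
      nabla_add_left[OF nabla_smooth[OF Y X] nabla_smooth[OF Y X'] Z p] by simp
  show "curv (\<lambda>q. X q +\<^sub>T X' q) Y Z p
     = curv X Y Z p +\<^sub>T curv X' Y Z p"
    unfolding curvature_torsion_free[OF XX Y Z p] curvature_torsion_free[OF X Y Z p]
      curvature_torsion_free[OF X' Y Z p] 1 2 3
      nabla_add_left[OF X X' nabla_smooth[OF Y Z] p]
    by (simp add: fun_eq_iff algebra_simps)
next
  fix f X assume f: "smooth_fun_on A U f" and X: "smooth_vfield_on A U X"
  note fX = vfield_scale[OF U f X]
  note Yf = smooth_dir_deriv[OF U f Y]
  have 1: "nabla Y (nabla (\<lambda>q. f q *\<^sub>T X q) Z) p
      = dir_deriv A p (Y p) f *\<^sub>T nabla X Z p +\<^sub>T f p *\<^sub>T nabla Y (nabla X Z) p"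
    using nabla_cong_right[OF Y nabla_smooth[OF fX Z]
        vfield_scale[OF U f nabla_smooth[OF X Z]] p nabla_scale_left[OF f X Z]]
      nabla_leibniz[OF f Y nabla_smooth[OF X Z] p] by simp
  have 2: "nabla (nabla (\<lambda>q. f q *\<^sub>T X q) Y) Z p = f p *\<^sub>T nabla (nabla X Y) Z p"
    using nabla_cong_left[OF nabla_smooth[OF fX Y]
        vfield_scale[OF U f nabla_smooth[OF X Y]] Z p nabla_scale_left[OF f X Y]]
      nabla_scale_left[OF f nabla_smooth[OF X Y] Z p] by simp
  have 3: "nabla (nabla Y (\<lambda>q. f q *\<^sub>T X q)) Z p
      = dir_deriv A p (Y p) f *\<^sub>T nabla X Z p +\<^sub>T f p *\<^sub>T nabla (nabla Y X) Z p"
    using nabla_cong_left[OF nabla_smooth[OF Y fX]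
        vfield_add[OF U vfield_scale[OF U Yf X]
          vfield_scale[OF U f nabla_smooth[OF Y X]]] Z p nabla_leibniz[OF f Y X]]
      nabla_add_left[OF vfield_scale[OF U Yf X]
          vfield_scale[OF U f nabla_smooth[OF Y X]] Z p]
      nabla_scale_left[OF Yf X Z p] nabla_scale_left[OF f nabla_smooth[OF Y X] Z p] by simp
  show "curv (\<lambda>q. f q *\<^sub>T X q) Y Z p = f p *\<^sub>T curv X Y Z p"
    unfolding curvature_torsion_free[OF fX Y Z p] curvature_torsion_free[OF X Y Z p]
      1 2 3 nabla_scale_left[OF f X nabla_smooth[OF Y Z] p]
    by (simp add: fun_eq_iff algebra_simps)
qed

lemma curvature_fields_tensorial_2:
  assumes X: "smooth_vfield_on A U X" and Z: "smooth_vfield_on A U Z" and p: "p \<in> U"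
  shows "tensorial_at A U p (\<lambda>Y. curv X Y Z p)"
  unfolding tensorial_at_def
proof (intro conjI allI impI; elim conjE)
  note t = curvature_fields_tensorial_1[OF X Z p]
  note s = curvature_fields_antisym[OF X _ Z p]
  fix Y Y' assume Y: "smooth_vfield_on A U Y" "smooth_vfield_on A U Y'"
  show "curv X (\<lambda>q. Y q +\<^sub>T Y' q) Z p
     = curv X Y Z p +\<^sub>T curv X Y' Z p"
    unfolding s[OF vfield_add[OF U Y]] s[OF Y(1)] s[OF Y(2)] tensorial_at_add[OF t Y]
    by (simp add: fun_eq_iff)
next
  note t = curvature_fields_tensorial_1[OF X Z p]
  note s = curvature_fields_antisym[OF X _ Z p]
  fix f Y assume f: "smooth_fun_on A U f" and Y: "smooth_vfield_on A U Y"
  show "curv X (\<lambda>q. f q *\<^sub>T Y q) Z p = f p *\<^sub>T curv X Y Z p"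
    unfolding s[OF vfield_scale[OF U f Y]] s[OF Y] tensorial_at_scale[OF t f Y]
    by (simp add: fun_eq_iff)
qed

lemma lie_bracket_tangent:
  "smooth_vfield_on A U X \<Longrightarrow> smooth_vfield_on A U Y \<Longrightarrow> p \<in> U \<Longrightarrow>
    lie_bracket A X Y p \<in> Tan p"
  using vfield_tangent[OF smooth_lie_bracket] .

text \<open>The second derivatives of \<open>f\<close> in \<open>R (X, Y) (f Z)\<close> cancel because \<open>[X, Y]\<close> is their commutator.\<close>
lemma curvature_fields_tensorial_3:
  assumes X: "smooth_vfield_on A U X" and Y: "smooth_vfield_on A U Y" and p: "p \<in> U"
  shows "tensorial_at A U p (\<lambda>Z. curv X Y Z p)"
  unfolding tensorial_at_def
proof (intro conjI allI impI; elim conjE)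
  fix Z Z' assume Z: "smooth_vfield_on A U Z" and Z': "smooth_vfield_on A U Z'"
  note ZZ = vfield_add[OF U Z Z']
  have 1: "nabla V (nabla W (\<lambda>q. Z q +\<^sub>T Z' q)) p = nabla V (nabla W Z) p +\<^sub>T nabla V (nabla W Z') p"
    if V: "smooth_vfield_on A U V" and W: "smooth_vfield_on A U W" for V W
    using nabla_cong_right[OF V nabla_smooth[OF W ZZ]
        vfield_add[OF U nabla_smooth[OF W Z] nabla_smooth[OF W Z']] p
        nabla_add_right[OF W Z Z']]
      nabla_add_right[OF V nabla_smooth[OF W Z] nabla_smooth[OF W Z'] p] by simp
  show "curv X Y (\<lambda>q. Z q +\<^sub>T Z' q) p
     = curv X Y Z p +\<^sub>T curv X Y Z' p"
    unfolding curvature_fields_def 1[OF X Y] 1[OF Y X]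
      nabla_add_right[OF smooth_lie_bracket[OF X Y] Z Z' p]
    by (simp add: fun_eq_iff algebra_simps)
next
  fix f Z assume f: "smooth_fun_on A U f" and Z: "smooth_vfield_on A U Z"
  note fZ = vfield_scale[OF U f Z]
  have 1: "nabla V (nabla W (\<lambda>q. f q *\<^sub>T Z q)) p
      = (dir_deriv A p (V p) (\<lambda>q. dir_deriv A q (W q) f) *\<^sub>T Z p
          +\<^sub>T dir_deriv A p (W p) f *\<^sub>T nabla V Z p)
        +\<^sub>T (dir_deriv A p (V p) f *\<^sub>T nabla W Z p +\<^sub>T f p *\<^sub>T nabla V (nabla W Z) p)"
    if V: "smooth_vfield_on A U V" and W: "smooth_vfield_on A U W" for V W
  proof -
    note Wf = smooth_dir_deriv[OF U f W]
    note a = vfield_scale[OF U Wf Z] and b = vfield_scale[OF U f nabla_smooth[OF W Z]]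
    have "nabla V (nabla W (\<lambda>q. f q *\<^sub>T Z q)) p
      = nabla V (\<lambda>q. dir_deriv A q (W q) f *\<^sub>T Z q +\<^sub>T f q *\<^sub>T nabla W Z q) p"
      by (rule nabla_cong_right[OF V nabla_smooth[OF W fZ] vfield_add[OF U a b] p
            nabla_leibniz[OF f W Z]])
    then show ?thesis
      unfolding nabla_add_right[OF V a b p] nabla_leibniz[OF Wf V Z p]
        nabla_leibniz[OF f V nabla_smooth[OF W Z] p] .
  qed
  note c = dir_deriv_commutator[OF U p f X Y lie_bracket_tangent[OF X Y p], symmetric]
  show "curv X Y (\<lambda>q. f q *\<^sub>T Z q) p = f p *\<^sub>T curv X Y Z p"
    unfolding curvature_fields_def 1[OF X Y] 1[OF Y X]
      nabla_leibniz[OF f smooth_lie_bracket[OF X Y] Z p] c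
    by (simp add: fun_eq_iff algebra_simps)
qed

lemma curvature_fields_tangent:
  assumes X: "smooth_vfield_on A U X" and Y: "smooth_vfield_on A U Y" and Z: "smooth_vfield_on A U Z"
    and p: "p \<in> U"
  shows "curv X Y Z p \<in> Tan p"
  unfolding curvature_fields_def
  by (rule tangent_add[OF tangent_add[OF _ tangent_scale] tangent_scale],
      rule vfield_tangent[OF nabla_smooth[OF X nabla_smooth[OF Y Z]] p],
      rule vfield_tangent[OF nabla_smooth[OF Y nabla_smooth[OF X Z]] p],
      rule vfield_tangent[OF nabla_smooth[OF smooth_lie_bracket[OF X Y] Z] p])

text \<open>
  \<open>R (X, Y)\<close> is skew: \<open>2 g (R (X, Y) Z, Z)\<close> is the value of the commutator
  \<open>X Y - Y X - [X, Y] = 0\<close> on the function \<open>g (Z, Z)\<close>.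
\<close>
lemma curvature_fields_skew:
  assumes X: "smooth_vfield_on A U X" and Y: "smooth_vfield_on A U Y" and Z: "smooth_vfield_on A U Z"
    and p: "p \<in> U"
  shows "g p (curv X Y Z p) (Z p) = 0"
proof -
  define f where "f = (\<lambda>q. g q (Z q) (Z q))"
  have f: "smooth_fun_on A U f" unfolding f_def by (rule smooth_metric[OF U Z Z])
  note tan = vfield_tangent[OF _ p]
  have D: "dir_deriv A q (V q) f = 2 * g q (nabla V Z q) (Z q)"
    if V: "smooth_vfield_on A U V" and q: "q \<in> U" for V q
    using metric_compatible[OF V Z Z q] metric_sym[OF topspaceI[OF q]
        vfield_tangent[OF nabla_smooth[OF V Z] q] vfield_tangent[OF Z q]]
    by (simp add: f_def)
  have DD: "dir_deriv A p (V p) (\<lambda>q. dir_deriv A q (W q) f)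
      = 2 * (g p (nabla V (nabla W Z) p) (Z p) + g p (nabla W Z p) (nabla V Z p))"
    if V: "smooth_vfield_on A U V" and W: "smooth_vfield_on A U W" for V W
  proof -
    note WZ = nabla_smooth[OF W Z]
    have "dir_deriv A p (V p) (\<lambda>q. dir_deriv A q (W q) f)
      = dir_deriv A p (V p) (\<lambda>q. g q (nabla W Z q) (Z q) + g q (nabla W Z q) (Z q))"
      by (rule dir_deriv_cong[OF U p]) (simp add: D[OF W])
    also have "\<dots> = 2 * dir_deriv A p (V p) (\<lambda>q. g q (nabla W Z q) (Z q))"
      using dir_deriv_add[OF U p smooth_metric[OF U WZ Z] smooth_metric[OF U WZ Z] tan[OF V]] by simp
    finally show ?thesis using metric_compatible[OF V WZ Z p] by simp
  qed
  note XY = lie_bracket_tangent[OF X Y p]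
  note nXY = nabla_smooth[OF smooth_lie_bracket[OF X Y] Z]
  note a = tan[OF nabla_smooth[OF X nabla_smooth[OF Y Z]]]
    and b = tan[OF nabla_smooth[OF Y nabla_smooth[OF X Z]]] and c = tan[OF nXY]
  have "g p (curv X Y Z p) (Z p) = g p (nabla X (nabla Y Z) p) (Z p)
     - g p (nabla Y (nabla X Z) p) (Z p) - g p (nabla (lie_bracket A X Y) Z p) (Z p)"
    unfolding curvature_fields_def
    using metric_add[OF topspaceI[OF p] tangent_add[OF a tangent_scale[OF b, of "-1"]]
        tangent_scale[OF c, of "-1"] tan[OF Z]]
      metric_add[OF topspaceI[OF p] a tangent_scale[OF b, of "-1"] tan[OF Z]]
      metric_scale[OF topspaceI[OF p] b tan[OF Z], of "-1"]
      metric_scale[OF topspaceI[OF p] c tan[OF Z], of "-1"] by simp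
  moreover have "dir_deriv A p (X p) (\<lambda>q. dir_deriv A q (Y q) f)
      - dir_deriv A p (Y p) (\<lambda>q. dir_deriv A q (X q) f) = 2 * g p (nabla (lie_bracket A X Y) Z p) (Z p)"
    using dir_deriv_commutator[OF U p f X Y XY] D[OF smooth_lie_bracket[OF X Y] p] by simp
  moreover have "g p (nabla Y Z p) (nabla X Z p) = g p (nabla X Z p) (nabla Y Z p)"
    by (rule metric_sym[OF topspaceI[OF p] tan[OF nabla_smooth[OF Y Z]] tan[OF nabla_smooth[OF X Z]]])
  ultimately show ?thesis unfolding DD[OF X Y] DD[OF Y X] by simp
qed

end

lemma curvature_fields_pointwise:
  assumes U: "openin T U" "p \<in> U"
    and s: "smooth_vfield_on A U X" "smooth_vfield_on A U Y" "smooth_vfield_on A U Z"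
    "smooth_vfield_on A U X'" "smooth_vfield_on A U Y'" "smooth_vfield_on A U Z'"
    and "X p = X' p" "Y p = Y' p" "Z p = Z' p"
  shows "curv X Y Z p = curv X' Y' Z' p"
proof -
  have "curv X Y Z p = curv X' Y Z p"
    by (rule tensorial_pointwise[OF U _ s(1,4) assms(9)], rule curvature_fields_tensorial_1)
      (auto intro: vfield_subset[OF s(2)] vfield_subset[OF s(3)])
  also have "\<dots> = curv X' Y' Z p"
    by (rule tensorial_pointwise[OF U _ s(2,5) assms(10)], rule curvature_fields_tensorial_2)
      (auto intro: vfield_subset[OF s(4)] vfield_subset[OF s(3)])
  also have "\<dots> = curv X' Y' Z' p"
    by (rule tensorial_pointwise[OF U _ s(3,6) assms(11)], rule curvature_fields_tensorial_3)
      (auto intro: vfield_subset[OF s(4)] vfield_subset[OF s(5)])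
  finally show ?thesis .
qed

lemma local_extension:
  assumes "p \<in> topspace T" "v \<in> Tan p"
  shows "local_extension T A p v p = v"
    and "\<exists>U. openin T U \<and> p \<in> U \<and> smooth_vfield_on A U (local_extension T A p v)"
proof -
  obtain c where c: "c \<in> charts_at A p" using charts_at_nonempty[OF assms(1)] by blast
  then have cA: "c \<in> A" "p \<in> fst c" by (auto simp: charts_at_def)
  let ?X = "\<lambda>q. chart_vec A c q (v c)"
  have "(\<exists>U. openin T U \<and> p \<in> U \<and> smooth_vfield_on A U ?X) \<and> ?X p = v"
    using openin_chart[OF cA(1)] cA(2) smooth_chart_vec[OF cA(1)] chart_vec_component[OF assms(2) c] by blast
  then have "(\<exists>U. openin T U \<and> p \<in> U \<and> smooth_vfield_on A U (local_extension T A p v))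
     \<and> local_extension T A p v p = v"
    unfolding local_extension_def
    by (rule someI[where P="\<lambda>X. (\<exists>U. openin T U \<and> p \<in> U \<and> smooth_vfield_on A U X) \<and> X p = v"])
  then show "local_extension T A p v p = v"
    "\<exists>U. openin T U \<and> p \<in> U \<and> smooth_vfield_on A U (local_extension T A p v)" by blast+
qed

text \<open>The arbitrary extensions in the definition of \<open>curvature_op\<close> may be replaced by any others.\<close>
lemma curvature_op_eq:
  assumes U: "openin T U" "p \<in> U"
    and s: "smooth_vfield_on A U X" "smooth_vfield_on A U Y" "smooth_vfield_on A U Z"
    and v: "X p = x" "Y p = y" "Z p = z"
  shows "curv_op p x y z = curv X Y Z p"
proof -
  have p: "p \<in> topspace T" using U openin_subset by blast
  have t: "x \<in> Tan p" "y \<in> Tan p" "z \<in> Tan p"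
    using vfield_tangent[OF s(1) U(2)] vfield_tangent[OF s(2) U(2)]
      vfield_tangent[OF s(3) U(2)] v by auto
  note le = local_extension(1)[OF p] and lx = local_extension(2)[OF p]
  obtain V1 where V1: "openin T V1" "p \<in> V1" "smooth_vfield_on A V1 (local_extension T A p x)"
    using lx[OF t(1)] by blast
  obtain V2 where V2: "openin T V2" "p \<in> V2" "smooth_vfield_on A V2 (local_extension T A p y)"
    using lx[OF t(2)] by blast
  obtain V3 where V3: "openin T V3" "p \<in> V3" "smooth_vfield_on A V3 (local_extension T A p z)"
    using lx[OF t(3)] by blast
  let ?V = "U \<inter> (V1 \<inter> (V2 \<inter> V3))"
  have V: "openin T ?V" "p \<in> ?V" "?V \<subseteq> U" "?V \<subseteq> V1" "?V \<subseteq> V2" "?V \<subseteq> V3"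
    using U V1 V2 V3 by auto
  show ?thesis
    unfolding curvature_op_def
    by (rule curvature_fields_pointwise[OF V(1,2)
          vfield_subset[OF V1(3) V(4)] vfield_subset[OF V2(3) V(5)]
          vfield_subset[OF V3(3) V(6)]
          vfield_subset[OF s(1) V(3)] vfield_subset[OF s(2) V(3)]
          vfield_subset[OF s(3) V(3)]])
      (simp_all add: le[OF t(1)] le[OF t(2)] le[OF t(3)] v)
qed

text \<open>
  The identities for fields become identities for vectors at \<open>p\<close> when each vector is extended to the
  field with the same constant components in the chart \<open>c\<close>.
\<close>
context
  fixes p c assumes p: "p \<in> topspace T" and c: "c \<in> charts_at A p"
begin

abbreviation (input) "Ext v \<equiv> \<lambda>q. chart_vec A c q (v c)"

lemma chart_facts: "openin T (fst c)" "p \<in> fst c" "smooth_vfield_on A (fst c) (Ext v)"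
  using c by (auto simp: charts_at_def openin_chart smooth_chart_vec)

lemma curvature_op_chart:
  assumes "x \<in> Tan p" "y \<in> Tan p" "z \<in> Tan p"
  shows "curv_op p x y z = curv (Ext x) (Ext y) (Ext z) p"
  by (rule curvature_op_eq[where X="Ext x" and Y="Ext y" and Z="Ext z", OF chart_facts(1,2)])
    (simp_all only: chart_facts(3) chart_vec_component[OF _ c] assms)

lemma curvature_op_linear_1:
  assumes "x \<in> Tan p" "x' \<in> Tan p" "y \<in> Tan p" "z \<in> Tan p"
  shows "curv_op p (a *\<^sub>T x +\<^sub>T b *\<^sub>T x') y z
    = a *\<^sub>T curv_op p x y z +\<^sub>T b *\<^sub>T curv_op p x' y z"
proof -
  note o = chart_facts(1,2) and s = chart_facts(3) and v = chart_vec_component[OF _ c]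
  note t = curvature_fields_tensorial_1[OF o(1) s s o(2)]
  note sc = smooth_scale_const[OF o(1) s]
  have "curv_op p (a *\<^sub>T x +\<^sub>T b *\<^sub>T x') y z
    = curv (\<lambda>q. a *\<^sub>T Ext x q +\<^sub>T b *\<^sub>T Ext x' q) (Ext y) (Ext z) p"
    by (rule curvature_op_eq[OF o vfield_add[OF o(1) sc sc] s s])
      (simp_all add: v assms fun_eq_iff)
  then show ?thesis
    unfolding tensorial_at_add[OF t sc sc] tensorial_at_scale[OF t smooth_fun_on_const s]
      curvature_op_chart[OF assms(1) assms(3) assms(4)]
      curvature_op_chart[OF assms(2) assms(3) assms(4)] .
qed

lemma curvature_op_linear_3:
  assumes "x \<in> Tan p" "y \<in> Tan p" "z \<in> Tan p" "z' \<in> Tan p"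
  shows "curv_op p x y (a *\<^sub>T z +\<^sub>T b *\<^sub>T z')
    = a *\<^sub>T curv_op p x y z +\<^sub>T b *\<^sub>T curv_op p x y z'"
proof -
  note o = chart_facts(1,2) and s = chart_facts(3) and v = chart_vec_component[OF _ c]
  note t = curvature_fields_tensorial_3[OF o(1) s s o(2)]
  note sc = smooth_scale_const[OF o(1) s]
  have "curv_op p x y (a *\<^sub>T z +\<^sub>T b *\<^sub>T z')
    = curv (Ext x) (Ext y) (\<lambda>q. a *\<^sub>T Ext z q +\<^sub>T b *\<^sub>T Ext z' q) p"
    by (rule curvature_op_eq[OF o s s vfield_add[OF o(1) sc sc]])
      (simp_all add: v assms fun_eq_iff)
  then show ?thesis
    unfolding tensorial_at_add[OF t sc sc] tensorial_at_scale[OF t smooth_fun_on_const s]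
      curvature_op_chart[OF assms(1) assms(2) assms(3)]
      curvature_op_chart[OF assms(1) assms(2) assms(4)] .
qed

lemma curvature_op_antisym:
  assumes "x \<in> Tan p" "y \<in> Tan p" "z \<in> Tan p"
  shows "curv_op p x y z = (-1) *\<^sub>T curv_op p y x z"
proof -
  note o = chart_facts(1,2) and s = chart_facts(3) and v = chart_vec_component[OF _ c]
  show ?thesis
    unfolding curvature_op_chart[OF assms(1) assms(2) assms(3)]
      curvature_op_chart[OF assms(2) assms(1) assms(3)]
    by (rule curvature_fields_antisym[OF o(1) s s s o(2)])
qed

lemma curvature_op_tangent:
  assumes "x \<in> Tan p" "y \<in> Tan p" "z \<in> Tan p"
  shows "curv_op p x y z \<in> Tan p"
proof -
  note o = chart_facts(1,2) and s = chart_facts(3) and v = chart_vec_component[OF _ c]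
  show ?thesis
    unfolding curvature_op_chart[OF assms(1) assms(2) assms(3)]
    by (rule curvature_fields_tangent[OF o(1) s s s o(2)])
qed

lemma curvature_op_skew:
  assumes "x \<in> Tan p" "y \<in> Tan p" "z \<in> Tan p"
  shows "g p (curv_op p x y z) z = 0"
proof -
  note o = chart_facts(1,2) and s = chart_facts(3) and v = chart_vec_component[OF _ c]
  show ?thesis
    unfolding curvature_op_chart[OF assms(1) assms(2) assms(3)]
    using curvature_fields_skew[OF o(1) s s s o(2), of x y z] v[OF assms(3)] by simp
qed

end

context
  fixes p assumes p: "p \<in> topspace T"
begin

abbreviation "Rm \<equiv> curvature T A g nabla p"
abbreviation "Tp \<equiv> Tan p"

lemma chart_exists: obtains c where "c \<in> charts_at A p"
  using charts_at_nonempty[OF p] by blast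

lemma curvature_linear_1:
  assumes "x \<in> Tp" "x' \<in> Tp" "y \<in> Tp" "z \<in> Tp" "w \<in> Tp"
  shows "Rm (a *\<^sub>T x +\<^sub>T b *\<^sub>T x') y z w = a * Rm x y z w + b * Rm x' y z w"
proof -
  obtain c where c: "c \<in> charts_at A p" by (rule chart_exists)
  show ?thesis
    unfolding curvature_def curvature_op_linear_1[OF p c assms(1-4)]
    by (rule metric_linear[OF p curvature_op_tangent[OF p c assms(1,3,4)]
          curvature_op_tangent[OF p c assms(2,3,4)] assms(5)])
qed

lemma curvature_linear_3:
  assumes "x \<in> Tp" "y \<in> Tp" "z \<in> Tp" "z' \<in> Tp" "w \<in> Tp"
  shows "Rm x y (a *\<^sub>T z +\<^sub>T b *\<^sub>T z') w = a * Rm x y z w + b * Rm x y z' w"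
proof -
  obtain c where c: "c \<in> charts_at A p" by (rule chart_exists)
  show ?thesis
    unfolding curvature_def curvature_op_linear_3[OF p c assms(1-4)]
    by (rule metric_linear[OF p curvature_op_tangent[OF p c assms(1,2,3)]
          curvature_op_tangent[OF p c assms(1,2,4)] assms(5)])
qed

lemma curvature_linear_4:
  assumes "x \<in> Tp" "y \<in> Tp" "z \<in> Tp" "w \<in> Tp" "w' \<in> Tp"
  shows "Rm x y z (a *\<^sub>T w +\<^sub>T b *\<^sub>T w') = a * Rm x y z w + b * Rm x y z w'"
proof -
  obtain c where c: "c \<in> charts_at A p" by (rule chart_exists)
  note R = curvature_op_tangent[OF p c assms(1-3)]
  note t = tangent_add[OF tangent_scale[OF assms(4)] tangent_scale[OF assms(5)]]
  show ?thesis
    unfolding curvature_def metric_sym[OF p R t] metric_sym[OF p R assms(4)] metric_sym[OF p R assms(5)]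
    by (rule metric_linear[OF p assms(4,5) R])
qed

lemma curvature_antisym_12:
  assumes "x \<in> Tp" "y \<in> Tp" "z \<in> Tp" "w \<in> Tp"
  shows "Rm x y z w = - Rm y x z w"
proof -
  obtain c where c: "c \<in> charts_at A p" by (rule chart_exists)
  show ?thesis
    unfolding curvature_def
    by (subst curvature_op_antisym[OF p c assms(1-3)])
      (use metric_scale[OF p curvature_op_tangent[OF p c assms(2,1,3)] assms(4), of "-1"] in simp)
qed

lemma curvature_linear_2:
  assumes "x \<in> Tp" "y \<in> Tp" "y' \<in> Tp" "z \<in> Tp" "w \<in> Tp"
  shows "Rm x (a *\<^sub>T y +\<^sub>T b *\<^sub>T y') z w = a * Rm x y z w + b * Rm x y' z w"
  using curvature_linear_1[OF assms(2,3,1,4,5), of a b]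
    curvature_antisym_12[OF assms(1) tangent_add[OF tangent_scale[OF assms(2)] tangent_scale[OF assms(3)]]
      assms(4,5), of a b]
    curvature_antisym_12[OF assms(1,2,4,5)] curvature_antisym_12[OF assms(1,3,4,5)] by simp

text \<open>Polarisation of \<open>curvature_op_skew\<close>.\<close>
lemma curvature_antisym_34:
  assumes "x \<in> Tp" "y \<in> Tp" "z \<in> Tp" "w \<in> Tp"
  shows "Rm x y z w = - Rm x y w z"
proof -
  obtain c where c: "c \<in> charts_at A p" by (rule chart_exists)
  have skew: "Rm x y v v = 0" if "v \<in> Tp" for v
    unfolding curvature_def by (rule curvature_op_skew[OF p c assms(1,2) that])
  let ?s = "1 *\<^sub>T z +\<^sub>T 1 *\<^sub>T w"
  have s: "?s \<in> Tp" using tangent_add[OF tangent_scale tangent_scale] assms by blast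
  have "0 = Rm x y ?s ?s" using skew[OF s] by simp
  also have "\<dots> = Rm x y z w + Rm x y w z"
    unfolding curvature_linear_3[OF assms s] curvature_linear_4[OF assms(1,2,3,3,4)]
      curvature_linear_4[OF assms(1,2,4,3,4)]
    by (simp add: skew assms)
  finally show ?thesis by simp
qed

end

end

section \<open>The manifold \<open>\<real>\<^sup>+ \<times> N\<close> and its paracontact structure\<close>

lemma second_countable_prod_topology:
  assumes "second_countable X" "second_countable Y"
  shows "second_countable (prod_topology X Y)"
proof -
  obtain B where B0: "countable B \<and> (\<forall>V\<in>B. openin X V) \<and>
      (\<forall>U x. openin X U \<and> x \<in> U \<longrightarrow> (\<exists>V\<in>B. x \<in> V \<and> V \<subseteq> U))"
    using assms(1)[unfolded second_countable_def] ..
  note B = B0[THEN conjunct1] B0[THEN conjunct2, THEN conjunct1, rule_format]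
    B0[THEN conjunct2, THEN conjunct2, rule_format, OF conjI]
  obtain C where C0: "countable C \<and> (\<forall>V\<in>C. openin Y V) \<and>
      (\<forall>U x. openin Y U \<and> x \<in> U \<longrightarrow> (\<exists>V\<in>C. x \<in> V \<and> V \<subseteq> U))"
    using assms(2)[unfolded second_countable_def] ..
  note C = C0[THEN conjunct1] C0[THEN conjunct2, THEN conjunct1, rule_format]
    C0[THEN conjunct2, THEN conjunct2, rule_format, OF conjI]
  let ?D = "(\<lambda>(V, W). V \<times> W) ` (B \<times> C)"
  show ?thesis
    unfolding second_countable_def
  proof (intro exI[of _ ?D] conjI ballI allI impI)
    show "countable ?D" using B(1) C(1) by simp
  next
    fix V assume "V \<in> ?D"
    then show "openin (prod_topology X Y) V"
      using B(2) C(2) by (auto simp: openin_prod_Times_iff)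
  next
    fix U z assume "openin (prod_topology X Y) U \<and> z \<in> U"
    then have U: "openin (prod_topology X Y) U" "(fst z, snd z) \<in> U" by simp_all
    obtain V W where VW: "openin X V" "openin Y W" "fst z \<in> V" "snd z \<in> W" "V \<times> W \<subseteq> U"
      using U(1)[unfolded openin_prod_topology_alt, rule_format, OF U(2)] by (elim exE conjE)
    obtain V' where V': "V' \<in> B" "fst z \<in> V'" "V' \<subseteq> V" using B(3)[OF VW(1,3)] by (elim bexE conjE)
    obtain W' where W': "W' \<in> C" "snd z \<in> W'" "W' \<subseteq> W" using C(3)[OF VW(2,4)] by (elim bexE conjE)
    have "V' \<times> W' \<in> ?D" using V'(1) W'(1) by auto
    moreover have "z \<in> V' \<times> W'" "V' \<times> W' \<subseteq> U"
      using VW(5) V' W' by (auto simp: mem_Times_iff)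
    ultimately show "\<exists>V\<in>?D. z \<in> V \<and> V \<subseteq> U" by blast
  qed
qed

lemma fst_S_chart [simp]: "fst (S_chart c) = {0<..} \<times> fst c"
  by (simp add: S_chart_def)

lemma snd_S_chart: "snd (S_chart c) z = (fst z, snd c (snd z))"
  by (simp add: S_chart_def case_prod_beta)

lemma inj_S_chart: "inj S_chart"
proof (rule injI)
  fix c d :: "('a, 'b) chart"
  assume e: "S_chart c = S_chart d"
  then have "{0<..} \<times> fst c = ({0<..} \<times> fst d :: (real \<times> 'a) set)" by (metis fst_S_chart)
  then have "(1, x) \<in> {0::real<..} \<times> fst c \<longleftrightarrow> (1, x) \<in> {0::real<..} \<times> fst d" for x by simp
  then have "fst c = fst d" by auto
  moreover have "snd c p = snd d p" for p
    using snd_S_chart[of c "(0, p)"] snd_S_chart[of d "(0, p)"] e by simp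
  ultimately show "c = d" by (simp add: prod_eq_iff fun_eq_iff)
qed

lemma S_chart_eq_iff [simp]: "S_chart c = S_chart d \<longleftrightarrow> c = d"
  using inj_S_chart by (auto dest: injD)

lemma S_chart_in_atlas [simp]: "S_chart c \<in> S_atlas A \<longleftrightarrow> c \<in> A"
  by (auto simp: S_atlas_def)

lemma S_charts_at_iff: "d \<in> charts_at (S_atlas A) z \<longleftrightarrow> 0 < fst z \<and> (\<exists>c\<in>charts_at A (snd z). d = S_chart c)"
  by (auto simp: charts_at_def S_atlas_def mem_Times_iff)

lemma S_chart_at [simp]:
  "S_chart c \<in> charts_at (S_atlas A) z \<longleftrightarrow> 0 < fst z \<and> c \<in> charts_at A (snd z)"
  by (auto simp: S_charts_at_iff)

lemma topspace_S: "topspace (S_top T) = {0<..} \<times> topspace T"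
  by (simp add: S_top_def)

lemma S_chart_image: "snd (S_chart c) ` ({0<..} \<times> V) = {0<..} \<times> snd c ` V"
  by (force simp: snd_S_chart)

lemma smooth_on_snd:
  fixes f :: "'a::euclidean_space \<Rightarrow> 'b::real_normed_vector"
  assumes "open S" "open (U :: (real \<times> 'a) set)" "snd ` U \<subseteq> S" "smooth_on S f"
  shows "smooth_on U (\<lambda>z. f (snd z))"
  by (rule smooth_on_compose[OF assms(2,1,3,4) smooth_on_bounded_linear[OF bounded_linear_snd]])

context manifold
begin

lemma S_chart_inv:
  assumes "c \<in> A" "0 < fst z" "snd z \<in> snd c ` fst c"
  shows "chart_inv (S_chart c) z = (fst z, chart_inv c (snd z))"
proof -
  obtain p where p: "p \<in> fst c" "snd z = snd c p" using assms(3) by blast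
  have "inj_on (snd (S_chart c)) (fst (S_chart c))"
    using inj_chart[OF assms(1)] by (auto simp: inj_on_def snd_S_chart)
  then have "inv_into (fst (S_chart c)) (snd (S_chart c)) z = (fst z, p)"
    by (rule inv_into_f_eq) (use assms p in \<open>auto simp: snd_S_chart prod_eq_iff\<close>)
  then show ?thesis
    unfolding chart_inv_def[of "S_chart c"] using chart_inv_chart[OF assms(1) p(1)] p by simp
qed

lemma S_transition:
  assumes "c \<in> A" "0 < fst z" "snd z \<in> snd c ` fst c"
  shows "transition (S_chart c) (S_chart d) z = (fst z, transition c d (snd z))"
  by (simp add: transition_def S_chart_inv[OF assms] snd_S_chart)

lemma open_transition_domain:
  "c \<in> A \<Longrightarrow> d \<in> A \<Longrightarrow> open ({0::real<..} \<times> snd c ` (fst c \<inter> fst d))"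
  using open_chart_image openin_chart by (simp add: open_Times)

lemma smooth_S_transition:
  assumes "c \<in> A" "d \<in> A"
  shows "smooth_on ({0<..} \<times> snd c ` (fst c \<inter> fst d)) (transition (S_chart c) (S_chart d))"
proof -
  let ?D = "snd c ` (fst c \<inter> fst d)"
  have o: "open ({0::real<..} \<times> ?D)" "open ?D"
    using open_transition_domain[OF assms] open_chart_image[OF assms(1) openin_chart[OF assms(2)]] by auto
  have "bounded_linear (\<lambda>z::real \<times> 'e. (fst z, 0::'e))" "bounded_linear (\<lambda>y::'e. (0::real, y))"
    by (intro bounded_linear_Pair bounded_linear_fst bounded_linear_zero bounded_linear_ident)+
  note L = this
  have "smooth_on ({0::real<..} \<times> ?D) (\<lambda>z. transition c d (snd z))"
    by (rule smooth_on_snd[OF o(2,1) _ smooth_transition[OF assms]]) auto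
  note smooth_on_add[OF o(1) smooth_on_bounded_linear[OF L(1)]
      smooth_on_bounded_linear_comp[OF o(1) L(2) this]]
  then show ?thesis
    by (rule smooth_on_cong[OF o(1), rotated]) (auto simp: S_transition[OF assms(1)])
qed

lemma homeomorphic_S_chart:
  assumes "c \<in> A"
  shows "homeomorphic_map (subtopology (S_top T) ({0<..} \<times> fst c)) (top_of_set ({0<..} \<times> snd c ` fst c))
     (snd (S_chart c))"
proof -
  obtain f' where f': "homeomorphic_maps (subtopology T (fst c)) (top_of_set (snd c ` fst c)) (snd c) f'"
    using homeomorphic_chart[OF assms] homeomorphic_map_maps by blast
  have "homeomorphic_maps (top_of_set {0::real<..}) (top_of_set {0<..}) (\<lambda>x. x) (\<lambda>x. x)"
    by (simp add: homeomorphic_maps_def)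
  then have "homeomorphic_maps
      (prod_topology (top_of_set {0::real<..}) (subtopology T (fst c)))
      (prod_topology (top_of_set {0<..}) (top_of_set (snd c ` fst c)))
      (\<lambda>(x, y). (x, snd c y)) (\<lambda>(x, y). (x, f' y))"
    using f' unfolding homeomorphic_maps_prod by blast
  moreover have "subtopology (S_top T) ({0<..} \<times> fst c)
      = prod_topology (top_of_set {0::real<..}) (subtopology T (fst c))"
    by (simp add: S_top_def subtopology_Times subtopology_subtopology)
  moreover have "snd (S_chart c) = (\<lambda>(x, y). (x, snd c y))" by (simp add: S_chart_def)
  ultimately show ?thesis
    using homeomorphic_map_maps by (metis prod_topology_subtopology_eu)
qed

lemma smooth_manifold_S: "smooth_manifold (S_top T) (S_atlas A)"
  unfolding smooth_manifold_def
proof (intro conjI ballI)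
  have "Hausdorff_space T" "second_countable T" using manifold by (auto simp: smooth_manifold_def)
  then show "Hausdorff_space (S_top T)"
    unfolding S_top_def Hausdorff_space_prod_topology
    by (simp add: Hausdorff_space_subtopology)
  obtain B :: "real set set" where B: "countable B" "\<And>V. V \<in> B \<Longrightarrow> open V"
    "\<And>W. open W \<Longrightarrow> \<exists>V. V \<subseteq> B \<and> W = \<Union>V"
    using univ_second_countable by metis
  have "\<exists>V\<in>B. x \<in> V \<and> V \<subseteq> W" if "open W" "x \<in> W" for W x
    using B(3)[OF that(1)] that(2) by blast
  then have "second_countable (euclidean :: real topology)"
    unfolding second_countable_def using B(1,2) by (intro exI[of _ B]) simp
  then show "second_countable (S_top T)"
    unfolding S_top_def
    by (intro second_countable_prod_topology second_countable_subtopology \<open>second_countable T\<close>)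
  have "(\<Union>c\<in>A. fst c) = topspace T" using manifold by (simp add: smooth_manifold_def)
  then show "(\<Union>c\<in>S_atlas A. fst c) = topspace (S_top T)"
    by (auto simp: topspace_S S_atlas_def)
next
  fix C assume "C \<in> S_atlas A"
  then obtain c where c: "c \<in> A" "C = S_chart c" by (auto simp: S_atlas_def)
  have o: "open (snd c ` fst c)" using manifold c by (simp add: smooth_manifold_def)
  show "openin (S_top T) (fst C)"
    using c openin_chart[OF c(1)] by (auto simp: S_top_def openin_prod_Times_iff)
  show "open (snd C ` fst C)" using o by (simp add: c S_chart_image open_Times)
  show "homeomorphic_map (subtopology (S_top T) (fst C)) (top_of_set (snd C ` fst C)) (snd C)"
    using homeomorphic_S_chart[OF c(1)] by (simp add: c S_chart_image)
next
  fix C D assume "C \<in> S_atlas A" "D \<in> S_atlas A"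
  then obtain c d where "c \<in> A" "C = S_chart c" "d \<in> A" "D = S_chart d" by (auto simp: S_atlas_def)
  then show "smooth_on (snd C ` (fst C \<inter> fst D)) (transition C D)"
    using smooth_S_transition[of c d] by (simp add: Times_Int_Times S_chart_image)
qed

lemma S_transition_derivative:
  assumes "0 < fst z" "c \<in> charts_at A (snd z)" "d \<in> charts_at A (snd z)"
  shows "frechet_derivative (transition (S_chart c) (S_chart d)) (at (snd (S_chart c) z)) w
    = (fst w, jac c d (snd z) (snd w))"
proof -
  have A: "c \<in> A" "d \<in> A" "snd z \<in> fst c" "snd z \<in> fst d" using assms by (auto simp: charts_at_def)
  let ?x = "snd (S_chart c) z"
  have "(transition c d has_derivative jac c d (snd z)) (at (snd ?x))"
    using transition_has_derivative[OF assms(2,3)] by (simp add: snd_S_chart)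
  then have "((\<lambda>y. transition c d (snd y)) has_derivative
      (\<lambda>w. jac c d (snd z) (snd w))) (at ?x)"
    by (rule has_derivative_compose[OF bounded_linear_imp_has_derivative[OF bounded_linear_snd]])
  then have "((\<lambda>y. (fst y, transition c d (snd y))) has_derivative
      (\<lambda>w. (fst w, jac c d (snd z) (snd w)))) (at ?x)"
    by (rule has_derivative_Pair[OF bounded_linear_imp_has_derivative[OF bounded_linear_fst]])
  note 1 = frechet_derivative_at[OF this, symmetric]
  have "frechet_derivative (transition (S_chart c) (S_chart d)) (at ?x)
      = frechet_derivative (\<lambda>y. (fst y, transition c d (snd y))) (at ?x)"
    by (rule frechet_derivative_cong_open[OF open_transition_domain[OF A(1,2)]])
      (use A assms in \<open>auto simp: S_transition snd_S_chart\<close>)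
  then show ?thesis using fun_cong[OF 1, of w] by simp
qed

lemma chart_vec_linear:
  assumes "c \<in> charts_at A p"
  shows "chart_vec A c p (a *\<^sub>R u + b *\<^sub>R v) = a *\<^sub>T chart_vec A c p u +\<^sub>T b *\<^sub>T chart_vec A c p v"
  by (rule tangent_eqI[OF chart_vec_tangent[OF assms] _ assms])
    (auto intro!: tangent_add tangent_scale chart_vec_tangent[OF assms] simp: chart_vec_self[OF assms])

text \<open>
  The smoothness of \<open>P\<close> and \<open>h\<close> is stated for fields on \<open>N\<close>, but they are to be applied to the
  \<open>N\<close>-parts of fields on the product, which depend on \<open>t\<close>.  Expanding these in the coordinate basis
  of \<open>N\<close> moves the dependence on \<open>t\<close> into the coefficients.
\<close>
lemma linear_map_expansion:
  fixes l :: "('m, 'e) tvec \<Rightarrow> 'v::real_vector"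
  assumes c: "c \<in> charts_at A p" and v: "v \<in> Tan p"
    and l: "\<And>x y a b. x \<in> Tan p \<Longrightarrow> y \<in> Tan p \<Longrightarrow>
      l (a *\<^sub>T x +\<^sub>T b *\<^sub>T y) = a *\<^sub>R l x + b *\<^sub>R l y"
  shows "l v = (\<Sum>b\<in>Basis. (v c \<bullet> b) *\<^sub>R l (chart_vec A c p b))"
proof -
  note t = chart_vec_tangent[OF c]
  have L: "l (chart_vec A c p (a *\<^sub>R u + b *\<^sub>R w)) = a *\<^sub>R l (chart_vec A c p u) + b *\<^sub>R l (chart_vec A c p w)"
    for a b u w
    unfolding chart_vec_linear[OF c] by (rule l[OF t t])
  have "linear (\<lambda>u. l (chart_vec A c p u))"
  proof (rule linearI)
    show "l (chart_vec A c p (u + w)) = l (chart_vec A c p u) + l (chart_vec A c p w)" for u w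
      using L[of 1 u 1 w] by simp
    show "l (chart_vec A c p (r *\<^sub>R u)) = r *\<^sub>R l (chart_vec A c p u)" for r u
      using L[of r u 0 u] by simp
  qed
  from linear_Basis_expansion[OF this, of "v c"] show ?thesis
    unfolding chart_vec_component[OF v c] .
qed

end

text \<open>
  A locale of its own, because making \<open>manifold\<close> a sublocale of itself for the product with \<open>\<real>\<^sup>+\<close>
  would iterate the construction.
\<close>
locale cone = manifold T A for T :: "'m topology" and A :: "('m, 'e::euclidean_space) chart set"

sublocale cone \<subseteq> S: manifold "S_top T" "S_atlas A"
  by unfold_locales (rule smooth_manifold_S)

context cone
begin

abbreviation "STan \<equiv> tangent_space (S_atlas A)"

lemma topspace_SD: "z \<in> topspace (S_top T) \<Longrightarrow> 0 < fst z" "z \<in> topspace (S_top T) \<Longrightarrow> snd z \<in> topspace T"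
  by (auto simp: topspace_S)

lemma S_open_subset: "openin (S_top T) U \<Longrightarrow> z \<in> U \<Longrightarrow> z \<in> topspace (S_top T)"
  using openin_subset by blast

lemma N_part_apply: "N_part w c = snd (w (S_chart c))"
  by (simp add: N_part_def)

lemma N_part_add: "N_part (v +\<^sub>T w) = N_part v +\<^sub>T N_part w"
  by (simp add: fun_eq_iff N_part_apply)

lemma N_part_scale: "N_part (a *\<^sub>T w) = a *\<^sub>T N_part w"
  by (simp add: fun_eq_iff N_part_apply)

lemma N_part_tangent:
  assumes z: "z \<in> topspace (S_top T)" and w: "w \<in> STan z"
  shows "N_part w \<in> Tan (snd z)"
proof (rule tangent_spaceI)
  fix c assume "c \<notin> charts_at A (snd z)"
  then show "N_part w c = 0" using S.tangent_outside[OF w, of "S_chart c"] by (simp add: N_part_apply)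
next
  fix c d assume cd: "c \<in> charts_at A (snd z)" "d \<in> charts_at A (snd z)"
  have "S_chart c \<in> charts_at (S_atlas A) z" "S_chart d \<in> charts_at (S_atlas A) z"
    using cd topspace_SD(1)[OF z] by auto
  from S.tangent_transition[OF w this]
  show "N_part w d = jac c d (snd z) (N_part w c)"
    unfolding S_transition_derivative[OF topspace_SD(1)[OF z] cd] by (simp add: N_part_apply)
qed

lemma S_vec_S_chart:
  assumes "0 < fst z" "c \<in> charts_at A (snd z)" shows "S_vec A z x a (S_chart c) = (a, x c)"
proof -
  have "inv_into A S_chart (S_chart c) = c"
    using assms(2) inj_S_chart by (simp add: charts_at_def inv_into_f_f inj_on_subset[OF inj_S_chart])
  then show ?thesis using assms by (simp add: S_vec_def)
qed

lemma S_vec_outside: "d \<notin> charts_at (S_atlas A) z \<Longrightarrow> S_vec A z x a d = 0"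
  by (simp add: S_vec_def)

lemma S_vec_tangent:
  assumes z: "z \<in> topspace (S_top T)" and x: "x \<in> Tan (snd z)"
  shows "S_vec A z x a \<in> STan z"
proof (rule S.tangent_spaceI)
  fix C D assume "C \<in> charts_at (S_atlas A) z" "D \<in> charts_at (S_atlas A) z"
  then obtain c d where cd: "c \<in> charts_at A (snd z)" "C = S_chart c" "d \<in> charts_at A (snd z)" "D = S_chart d"
    unfolding S_charts_at_iff by blast
  note t = topspace_SD(1)[OF z]
  show "S_vec A z x a D = jac C D z (S_vec A z x a C)"
    unfolding cd S_transition_derivative[OF t cd(1,3)] S_vec_S_chart[OF t cd(1)] S_vec_S_chart[OF t cd(3)]
    using tangent_transition[OF x cd(1,3)] by simp
qed (rule S_vec_outside)

lemma N_part_S_vec: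
  assumes z: "z \<in> topspace (S_top T)" and x: "x \<in> Tan (snd z)"
  shows "N_part (S_vec A z x a) = x"
proof
  fix c show "N_part (S_vec A z x a) c = x c"
    using S_vec_S_chart[OF topspace_SD(1)[OF z], of c x a] tangent_outside[OF x, of c]
      S_vec_outside[of "S_chart c" z x a] by (cases "c \<in> charts_at A (snd z)") (auto simp: N_part_apply)
qed

lemma open_S_chart_image: "c \<in> A \<Longrightarrow> openin (S_top T) U \<Longrightarrow> open (snd (S_chart c) ` (fst (S_chart c) \<inter> U))"
  by (rule S.open_chart_image) simp_all

lemma smooth_fst: "smooth_fun_on (S_atlas A) U fst" if U: "openin (S_top T) U"
  unfolding smooth_fun_on_def
proof
  fix C assume C: "C \<in> S_atlas A"
  then obtain c where c: "c \<in> A" "C = S_chart c" by (auto simp: S_atlas_def)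
  show "smooth_on (snd C ` (fst C \<inter> U)) (\<lambda>x. fst (chart_inv C x))"
    by (rule smooth_on_cong[OF S.open_chart_image[OF C U] _ smooth_on_bounded_linear[OF bounded_linear_fst]])
      (use c in \<open>auto simp: S_chart_inv snd_S_chart mem_Times_iff\<close>)
qed

lemma S_eta_chart:
  assumes z: "z \<in> topspace (S_top T)" and w: "w \<in> STan z" and c: "c \<in> charts_at A (snd z)"
  shows "S_eta A z w = fst (w (S_chart c))"
proof -
  have C: "S_chart c \<in> charts_at (S_atlas A) z" using c topspace_SD(1)[OF z] by simp
  have cA: "c \<in> A" "snd z \<in> fst c" using c by (auto simp: charts_at_def)
  have "S_eta A z w = frechet_derivative (\<lambda>x. fst (chart_inv (S_chart c) x)) (at (snd (S_chart c) z)) (w (S_chart c))"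
    unfolding S_eta_def by (rule S.dir_deriv_chart[OF openin_topspace z smooth_fst[OF openin_topspace] C w])
  also have "frechet_derivative (\<lambda>x. fst (chart_inv (S_chart c) x)) (at (snd (S_chart c) z))
    = frechet_derivative fst (at (snd (S_chart c) z))"
    by (rule frechet_derivative_cong_open[OF open_S_chart_image[OF cA(1) openin_topspace]])
      (use cA z in \<open>auto simp: S_chart_inv snd_S_chart mem_Times_iff topspace_S\<close>)
  also have "frechet_derivative fst (at (snd (S_chart c) z)) = fst"
    by (rule frechet_derivative_at[OF bounded_linear_imp_has_derivative[OF bounded_linear_fst], symmetric])
  finally show ?thesis .
qed

lemma S_chart_obtain:
  assumes z: "z \<in> topspace (S_top T)" obtains c where "c \<in> charts_at A (snd z)"
  using charts_at_nonempty[OF topspace_SD(2)[OF z]] by blast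

lemma S_eta_linear:
  assumes z: "z \<in> topspace (S_top T)" and v: "v \<in> STan z" and w: "w \<in> STan z"
  shows "S_eta A z (a *\<^sub>T v +\<^sub>T b *\<^sub>T w) = a * S_eta A z v + b * S_eta A z w"
proof -
  obtain c where c: "c \<in> charts_at A (snd z)" using z by (rule S_chart_obtain)
  show ?thesis
    unfolding S_eta_chart[OF z v c] S_eta_chart[OF z w c]
      S_eta_chart[OF z S.tangent_add[OF S.tangent_scale[OF v] S.tangent_scale[OF w]] c]
    by simp
qed

lemma S_eta_S_vec:
  assumes z: "z \<in> topspace (S_top T)" and x: "x \<in> Tan (snd z)"
  shows "S_eta A z (S_vec A z x a) = a"
proof -
  obtain c where c: "c \<in> charts_at A (snd z)" using z by (rule S_chart_obtain)
  show ?thesis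
    unfolding S_eta_chart[OF z S_vec_tangent[OF z x] c] S_vec_S_chart[OF topspace_SD(1)[OF z] c] by simp
qed

lemma S_vec_decomposition:
  assumes z: "z \<in> topspace (S_top T)" and w: "w \<in> STan z"
  shows "w = S_vec A z (N_part w) (S_eta A z w)"
proof -
  obtain c where c: "c \<in> charts_at A (snd z)" using z by (rule S_chart_obtain)
  then have C: "S_chart c \<in> charts_at (S_atlas A) z" using topspace_SD(1)[OF z] by simp
  show ?thesis
    by (rule S.tangent_eqI[OF w S_vec_tangent[OF z N_part_tangent[OF z w]] C])
      (simp add: S_vec_S_chart[OF topspace_SD(1)[OF z] c] S_eta_chart[OF z w c] N_part_apply prod_eq_iff)
qed

lemma S_vec_linear:
  "S_vec A z (a *\<^sub>T x +\<^sub>T b *\<^sub>T y) (a * s + b * t) = a *\<^sub>T S_vec A z x s +\<^sub>T b *\<^sub>T S_vec A z y t"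
  by (auto simp: fun_eq_iff S_vec_def)

lemma S_xi_tangent: "z \<in> topspace (S_top T) \<Longrightarrow> S_xi A z \<in> STan z"
  unfolding S_xi_def by (rule S_vec_tangent[OF _ tangent_zero])

lemma N_part_xi: "z \<in> topspace (S_top T) \<Longrightarrow> N_part (S_xi A z) = tzero"
  unfolding S_xi_def by (rule N_part_S_vec[OF _ tangent_zero])

lemma S_eta_xi: "z \<in> topspace (S_top T) \<Longrightarrow> S_eta A z (S_xi A z) = 1"
  unfolding S_xi_def by (rule S_eta_S_vec[OF _ tangent_zero])

lemma S_xi_chart: "z \<in> topspace (S_top T) \<Longrightarrow> c \<in> charts_at A (snd z) \<Longrightarrow> S_xi A z (S_chart c) = (1, 0)"
  unfolding S_xi_def by (simp add: S_vec_S_chart topspace_SD)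

lemma smooth_xi: "smooth_vfield_on (S_atlas A) (topspace (S_top T)) (S_xi A)"
  unfolding smooth_vfield_on_def
proof (intro conjI ballI)
  fix C assume C: "C \<in> S_atlas A"
  then obtain c where c: "c \<in> A" "C = S_chart c" by (auto simp: S_atlas_def)
  show "smooth_on (snd C ` (fst C \<inter> topspace (S_top T))) (\<lambda>x. S_xi A (chart_inv C x) C)"
  proof (rule smooth_on_cong[OF S.open_chart_image[OF C openin_topspace] _ smooth_on_const])
    fix x assume "x \<in> snd C ` (fst C \<inter> topspace (S_top T))"
    then obtain z where z: "z \<in> fst C" "z \<in> topspace (S_top T)" "x = snd C z" by blast
    have "c \<in> charts_at A (snd z)" using z c by (auto simp: charts_at_def)
    then show "(1, 0) = S_xi A (chart_inv C x) C"
      using z S.chart_inv_chart[OF C z(1)] S_xi_chart[OF z(2)] c by simp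
  qed
qed (rule S_xi_tangent)

text \<open>
  Over the domain \<open>snd C ` (fst C \<inter> U)\<close> of a product chart \<open>C = S_chart c\<close>, an expression that reads
  only the \<open>N\<close>-coordinate is smooth as soon as it is smooth on \<open>N\<close>.
\<close>
lemma smooth_on_N_coordinate:
  assumes c: "c \<in> A" and U: "openin (S_top T) U"
    and f: "smooth_on (snd c ` fst c) (\<lambda>y. f (chart_inv c y))"
  shows "smooth_on (snd (S_chart c) ` (fst (S_chart c) \<inter> U)) (\<lambda>x. f (snd (chart_inv (S_chart c) x)))"
proof -
  note o = open_S_chart_image[OF c U]
  have oc: "open (snd c ` fst c)" using open_chart_image[OF c openin_chart[OF c]] by simp
  have "smooth_on (snd (S_chart c) ` (fst (S_chart c) \<inter> U)) (\<lambda>x. f (chart_inv c (snd x)))"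
    by (rule smooth_on_snd[OF oc o _ f]) (auto simp: snd_S_chart)
  then show ?thesis
    by (rule smooth_on_cong[OF o, rotated]) (auto simp: S_chart_inv[OF c] snd_S_chart)
qed

lemma smooth_N_component:
  assumes c: "c \<in> A" and U: "openin (S_top T) U" and X: "smooth_vfield_on (S_atlas A) U X"
  shows "smooth_on (snd (S_chart c) ` (fst (S_chart c) \<inter> U))
    (\<lambda>x. N_part (X (chart_inv (S_chart c) x)) c \<bullet> b)"
proof -
  have "S_chart c \<in> S_atlas A" using c by simp
  from smooth_on_inner_right[OF open_S_chart_image[OF c U]
      smooth_on_bounded_linear_comp[OF open_S_chart_image[OF c U] bounded_linear_snd
        S.vfield_chart[OF X this]]]
  show ?thesis by (simp add: N_part_apply)
qed

lemma S_chart_image_at: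
  assumes c: "c \<in> A" and U: "openin (S_top T) U" and x: "x \<in> snd (S_chart c) ` (fst (S_chart c) \<inter> U)"
  defines "z \<equiv> chart_inv (S_chart c) x"
  shows "z \<in> U" "z \<in> topspace (S_top T)" "c \<in> charts_at A (snd z)" "x = snd (S_chart c) z"
proof -
  obtain w where w: "w \<in> fst (S_chart c)" "w \<in> U" "x = snd (S_chart c) w" using x by blast
  have "z = w" unfolding z_def w(3) by (rule S.chart_inv_chart) (use c w in auto)
  then show "z \<in> U" "z \<in> topspace (S_top T)" "c \<in> charts_at A (snd z)" "x = snd (S_chart c) z"
    using w c S_open_subset[OF U] by (auto simp: charts_at_def)
qed

text \<open>This serves for both \<open>h\<close> and the associated metric.\<close>
lemma smooth_pulled_back_form:
  assumes linear_left: "\<And>p x y z a b. p \<in> topspace T \<Longrightarrow> x \<in> Tan p \<Longrightarrow> y \<in> Tan p \<Longrightarrow>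
      z \<in> Tan p \<Longrightarrow> B p (a *\<^sub>T x +\<^sub>T b *\<^sub>T y) z = a * B p x z + b * B p y z"
    and linear_right: "\<And>p x y z a b. p \<in> topspace T \<Longrightarrow> x \<in> Tan p \<Longrightarrow> y \<in> Tan p \<Longrightarrow>
      z \<in> Tan p \<Longrightarrow> B p z (a *\<^sub>T x +\<^sub>T b *\<^sub>T y) = a * B p z x + b * B p z y"
    and smooth: "\<And>U X Y. openin T U \<Longrightarrow> smooth_vfield_on A U X \<Longrightarrow> smooth_vfield_on A U Y \<Longrightarrow>
      smooth_fun_on A U (\<lambda>p. B p (X p) (Y p))"
    and U: "openin (S_top T) U" and X: "smooth_vfield_on (S_atlas A) U X"
    and Y: "smooth_vfield_on (S_atlas A) U Y"
  shows "smooth_fun_on (S_atlas A) U (\<lambda>z. B (snd z) (N_part (X z)) (N_part (Y z)))"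
  unfolding smooth_fun_on_def
proof
  fix C assume C: "C \<in> S_atlas A"
  then obtain c where c: "c \<in> A" and C_eq: "C = S_chart c" by (auto simp: S_atlas_def)
  let ?D = "snd (S_chart c) ` (fst (S_chart c) \<inter> U)"
  let ?z = "chart_inv (S_chart c)"
  note o = open_S_chart_image[OF c U]
  have B: "smooth_on ?D (\<lambda>x. B (snd (?z x)) (chart_vec A c (snd (?z x)) b) (chart_vec A c (snd (?z x)) b'))"
    for b b'
  proof (rule smooth_on_N_coordinate[OF c U])
    show "smooth_on (snd c ` fst c) (\<lambda>y. B (chart_inv c y) (chart_vec A c (chart_inv c y) b)
        (chart_vec A c (chart_inv c y) b'))"
      using smooth_fun_on_chart[OF smooth[OF openin_chart[OF c] smooth_chart_vec[OF c, of b]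
            smooth_chart_vec[OF c, of b']] c] by simp
  qed
  have "smooth_on ?D (\<lambda>x. \<Sum>b\<in>Basis. (N_part (X (?z x)) c \<bullet> b) *\<^sub>R (\<Sum>b'\<in>Basis. (N_part (Y (?z x)) c \<bullet> b') *\<^sub>R
      B (snd (?z x)) (chart_vec A c (snd (?z x)) b) (chart_vec A c (snd (?z x)) b')))"
    by (rule smooth_on_sum[OF o smooth_on_scaleR[OF o smooth_N_component[OF c U X]
            smooth_on_sum[OF o smooth_on_scaleR[OF o smooth_N_component[OF c U Y] B]]]])
  then show "smooth_on (snd C ` (fst C \<inter> U)) (\<lambda>x. B (snd (chart_inv C x)) (N_part (X (chart_inv C x))) (N_part (Y (chart_inv C x))))"
    unfolding C_eq
  proof (rule smooth_on_cong[OF o, rotated])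
    fix x assume x: "x \<in> ?D"
    note z = S_chart_image_at[OF c U x]
    note p = topspace_SD(2)[OF z(2)]
    have NX: "N_part (X (?z x)) \<in> Tan (snd (?z x))"
      and NY: "N_part (Y (?z x)) \<in> Tan (snd (?z x))"
      using N_part_tangent[OF z(2)] vfield_tangent[OF X z(1)] vfield_tangent[OF Y z(1)]
      by auto
    have "B (snd (?z x)) (N_part (X (?z x))) (N_part (Y (?z x)))
      = (\<Sum>b\<in>Basis. (N_part (X (?z x)) c \<bullet> b) *\<^sub>R
        B (snd (?z x)) (chart_vec A c (snd (?z x)) b) (N_part (Y (?z x))))"
      by (rule linear_map_expansion[OF z(3) NX]) (simp only: linear_left[OF p _ _ NY] real_scaleR_def)
    moreover have "B (snd (?z x)) (chart_vec A c (snd (?z x)) b) (N_part (Y (?z x)))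
      = (\<Sum>b'\<in>Basis. (N_part (Y (?z x)) c \<bullet> b') *\<^sub>R
        B (snd (?z x)) (chart_vec A c (snd (?z x)) b) (chart_vec A c (snd (?z x)) b'))" for b
      by (rule linear_map_expansion[OF z(3) NY])
        (simp only: linear_right[OF p _ _ chart_vec_tangent[OF z(3)]] real_scaleR_def)
    ultimately show "(\<Sum>b\<in>Basis. (N_part (X (?z x)) c \<bullet> b) *\<^sub>R (\<Sum>b'\<in>Basis. (N_part (Y (?z x)) c \<bullet> b') *\<^sub>R
      B (snd (?z x)) (chart_vec A c (snd (?z x)) b) (chart_vec A c (snd (?z x)) b')))
      = B (snd (?z x)) (N_part (X (?z x))) (N_part (Y (?z x)))"
      by (simp only:)
  qed
qed

lemma smooth_eta:
  assumes U: "openin (S_top T) U" and X: "smooth_vfield_on (S_atlas A) U X"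
  shows "smooth_fun_on (S_atlas A) U (\<lambda>z. S_eta A z (X z))"
  unfolding S_eta_def by (rule S.smooth_dir_deriv[OF U smooth_fst[OF U] X])

lemma smooth_cosh_sinh:
  assumes U: "openin (S_top T) U"
  shows "smooth_fun_on (S_atlas A) U (\<lambda>z. cosh (2 * fst z))" "smooth_fun_on (S_atlas A) U (\<lambda>z. sinh (2 * fst z))"
proof -
  have bl: "bounded_linear (\<lambda>x::real \<times> 'e. 2 * fst x)"
    by (rule bounded_linear_const_mult[OF bounded_linear_fst])
  have e: "fst (chart_inv C x) = fst x" if C: "C \<in> S_atlas A" and x: "x \<in> snd C ` (fst C \<inter> U)" for C x
  proof -
    obtain c where c: "c \<in> A" "C = S_chart c" using C by (auto simp: S_atlas_def)
    show ?thesis using S_chart_image_at(4)[OF c(1) U] x c snd_S_chart by (metis fst_conv)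
  qed
  show "smooth_fun_on (S_atlas A) U (\<lambda>z. cosh (2 * fst z))"
    unfolding smooth_fun_on_def
    by (rule ballI, rule smooth_on_cong[OF S.open_chart_image[OF _ U] _
          smooth_on_cosh_sinh_linear(1)[OF S.open_chart_image[OF _ U] bl]]) (simp_all add: e)
  show "smooth_fun_on (S_atlas A) U (\<lambda>z. sinh (2 * fst z))"
    unfolding smooth_fun_on_def
    by (rule ballI, rule smooth_on_cong[OF S.open_chart_image[OF _ U] _
          smooth_on_cosh_sinh_linear(2)[OF S.open_chart_image[OF _ U] bl]]) (simp_all add: e)
qed

end

lemma sum_Basis_prod:
  "(\<Sum>b\<in>(Basis :: ('a::euclidean_space \<times> 'b::euclidean_space) set). f b)
    = (\<Sum>i\<in>Basis. f (i, 0)) + (\<Sum>i\<in>Basis. f (0, i))"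
proof -
  have "inj_on (\<lambda>u. (u::'a, 0::'b)) Basis" "inj_on (\<lambda>u. (0::'a, u::'b)) Basis"
    by (auto intro!: inj_onI Pair_inject)
  then show ?thesis
    unfolding Basis_prod_def
    by (subst sum.union_disjoint) (auto simp: sum.reindex)
qed

locale paracomplex_manifold = riemannian_manifold T A h
  for T :: "'m topology" and A :: "('m, 'e::euclidean_space) chart set" and h :: "('m, 'e) form2" +
  fixes P :: "'m \<Rightarrow> ('m, 'e) tvec \<Rightarrow> ('m, 'e) tvec"
  assumes paracomplex: "almost_paracomplex_riemannian T A P h"
begin

lemma P_endomorphism: "endomorphism_field T A P"
  using paracomplex unfolding almost_paracomplex_riemannian_def by (elim conjE)

lemma P_tangent: "p \<in> topspace T \<Longrightarrow> x \<in> Tan p \<Longrightarrow> P p x \<in> Tan p"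
  by (rule P_endomorphism[unfolded endomorphism_field_def, THEN conjunct1, rule_format])

lemma P_linear:
  "p \<in> topspace T \<Longrightarrow> x \<in> Tan p \<Longrightarrow> y \<in> Tan p \<Longrightarrow>
    P p (a *\<^sub>T x +\<^sub>T b *\<^sub>T y) = a *\<^sub>T P p x +\<^sub>T b *\<^sub>T P p y"
  by (rule P_endomorphism[unfolded endomorphism_field_def, THEN conjunct2, THEN conjunct1, rule_format])

lemma P_smooth:
  "openin T U \<Longrightarrow> smooth_vfield_on A U X \<Longrightarrow> smooth_vfield_on A U (\<lambda>p. P p (X p))"
  by (rule P_endomorphism[unfolded endomorphism_field_def, THEN conjunct2, THEN conjunct2, rule_format])
    (intro conjI)

lemma P_involution: "p \<in> topspace T \<Longrightarrow> x \<in> Tan p \<Longrightarrow> P p (P p x) = x"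
  by (rule paracomplex[unfolded almost_paracomplex_riemannian_def, THEN conjunct2, THEN conjunct2,
        THEN conjunct2, THEN conjunct2, THEN conjunct1, rule_format])

lemma P_traceless: "traceless A P"
  using paracomplex unfolding almost_paracomplex_riemannian_def by (elim conjE)

lemma P_isometry:
  "p \<in> topspace T \<Longrightarrow> x \<in> Tan p \<Longrightarrow> y \<in> Tan p \<Longrightarrow>
    h p (P p x) (P p y) = h p x y"
  by (rule paracomplex[unfolded almost_paracomplex_riemannian_def, THEN conjunct2, THEN conjunct2,
        THEN conjunct2, THEN conjunct2, THEN conjunct2, THEN conjunct2, THEN conjunct2, rule_format])

lemma P_self_adjoint:
  assumes "p \<in> topspace T" "x \<in> Tan p" "y \<in> Tan p"
  shows "h p (P p x) y = h p x (P p y)"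
  using P_isometry[OF assms(1,2) P_tangent[OF assms(1,3)]] P_involution[OF assms(1,3)] by simp

lemma associated_metric_sym:
  assumes "p \<in> topspace T" "x \<in> Tan p" "y \<in> Tan p"
  shows "associated_metric P h p x y = associated_metric P h p y x"
  unfolding associated_metric_def
  using P_self_adjoint[OF assms(1,3,2)] metric_sym[OF assms(1) P_tangent[OF assms(1,3)] assms(2)] by simp

lemma associated_metric_linear:
  "p \<in> topspace T \<Longrightarrow> x \<in> Tan p \<Longrightarrow> y \<in> Tan p \<Longrightarrow> z \<in> Tan p \<Longrightarrow>
    associated_metric P h p (a *\<^sub>T x +\<^sub>T b *\<^sub>T y) z
      = a * associated_metric P h p x z + b * associated_metric P h p y z"
  unfolding associated_metric_def by (rule metric_linear[OF _ _ _ P_tangent])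

lemma associated_metric_linear_right:
  "p \<in> topspace T \<Longrightarrow> x \<in> Tan p \<Longrightarrow> y \<in> Tan p \<Longrightarrow> z \<in> Tan p \<Longrightarrow>
    associated_metric P h p z (a *\<^sub>T x +\<^sub>T b *\<^sub>T y)
      = a * associated_metric P h p z x + b * associated_metric P h p z y"
  unfolding associated_metric_def by (simp only: P_linear metric_linear_right P_tangent)

lemma smooth_associated_metric:
  "openin T U \<Longrightarrow> smooth_vfield_on A U X \<Longrightarrow> smooth_vfield_on A U Y \<Longrightarrow>
    smooth_fun_on A U (\<lambda>p. associated_metric P h p (X p) (Y p))"
  unfolding associated_metric_def by (rule smooth_metric[OF _ _ P_smooth])

text \<open>Half of \<open>h (x + P x, x + P x) \<ge> 0\<close>.\<close>
lemma associated_metric_bound: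
  assumes p: "p \<in> topspace T" and x: "x \<in> Tan p"
  shows "associated_metric P h p x x \<ge> - h p x x"
proof -
  note Px = P_tangent[OF p x]
  let ?s = "1 *\<^sub>T x +\<^sub>T 1 *\<^sub>T P p x"
  have s: "?s \<in> Tan p" by (rule tangent_add[OF tangent_scale[OF x] tangent_scale[OF Px]])
  have "0 \<le> h p ?s ?s" by (rule metric_nonneg[OF p s])
  also have "\<dots> = 2 * h p x x + 2 * h p x (P p x)"
    unfolding metric_linear[OF p x Px s] metric_linear_right[OF p x Px x] metric_linear_right[OF p x Px Px]
    using P_isometry[OF p x x] P_self_adjoint[OF p x x] by simp
  finally show ?thesis by (simp add: associated_metric_def)
qed

text \<open>
  A traceless endomorphism is nowhere \<open>I\<close> or \<open>- I\<close>.  If \<open>P x \<noteq> - a x\<close> with \<open>a\<^sup>2 = 1\<close>, then \<open>a x + P x\<close>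
  is an eigenvector for the eigenvalue \<open>a\<close>.
\<close>
lemma P_eigenvectors:
  assumes p: "p \<in> topspace T"
  shows "\<exists>x\<in>Tan p. x \<noteq> tzero \<and> P p x = x"
    and "\<exists>x\<in>Tan p. x \<noteq> tzero \<and> P p x = (-1) *\<^sub>T x"
proof -
  obtain c where c: "c \<in> charts_at A p" using charts_at_nonempty[OF p] by blast
  have tr: "(\<Sum>b\<in>Basis. P p (chart_vec A c p b) c \<bullet> b) = 0"
    using P_traceless c unfolding traceless_def trace_in_chart_def by blast
  have no: "\<exists>x\<in>Tan p. P p x \<noteq> a *\<^sub>T x" if "a \<noteq> 0" for a
  proof (rule ccontr)
    assume "\<not> ?thesis"
    then have "P p (chart_vec A c p b) c = a *\<^sub>R b" for b
      using chart_vec_tangent[OF c, of b] chart_vec_self[OF c, of b] by simp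
    then have "(\<Sum>b\<in>(Basis::'e set). a) = 0" using tr by (simp add: inner_Basis)
    then show False using that by simp
  qed
  have eig: "\<exists>x\<in>Tan p. x \<noteq> tzero \<and> P p x = a *\<^sub>T x" if a: "a * a = 1" for a
  proof -
    have "- a \<noteq> 0" using a by auto
    from no[OF this] obtain x where x: "x \<in> Tan p" "P p x \<noteq> (- a) *\<^sub>T x" by blast
    note Px = P_tangent[OF p x(1)]
    let ?y = "a *\<^sub>T x +\<^sub>T 1 *\<^sub>T P p x"
    have "P p ?y = a *\<^sub>T P p x +\<^sub>T 1 *\<^sub>T x"
      unfolding P_linear[OF p x(1) Px] P_involution[OF p x(1)] ..
    also have "\<dots> = a *\<^sub>T ?y" using a by (simp add: fun_eq_iff scaleR_add_right)
    finally have "P p ?y = a *\<^sub>T ?y" .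
    moreover have "?y \<noteq> tzero"
    proof
      assume 0: "?y = tzero"
      have "P p x c = ((- a) *\<^sub>T x) c" for c using fun_cong[OF 0, of c] by (simp add: eq_neg_iff_add_eq_0 add.commute)
      then show False using x(2) by blast
    qed
    moreover have "?y \<in> Tan p" by (rule tangent_add[OF tangent_scale[OF x(1)] tangent_scale[OF Px]])
    ultimately show ?thesis by blast
  qed
  show "\<exists>x\<in>Tan p. x \<noteq> tzero \<and> P p x = x" using eig[of 1] by simp
  show "\<exists>x\<in>Tan p. x \<noteq> tzero \<and> P p x = (-1) *\<^sub>T x" using eig[of "-1"] by simp
qed

end

sublocale paracomplex_manifold \<subseteq> cone T A
  by unfold_locales

context paracomplex_manifold
begin

abbreviation "\<phi> \<equiv> S_phi A P"
abbreviation "\<xi> \<equiv> S_xi A"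
abbreviation "\<eta> \<equiv> S_eta A"
abbreviation "gS \<equiv> S_metric A P h"

lemma S_vec_zero: "S_vec A z tzero 0 = tzero"
  by (simp add: fun_eq_iff S_vec_def zero_prod_def)

lemma phi_tangent: "z \<in> topspace (S_top T) \<Longrightarrow> w \<in> STan z \<Longrightarrow> \<phi> z w \<in> STan z"
  unfolding S_phi_def by (rule S_vec_tangent[OF _ P_tangent[OF topspace_SD(2) N_part_tangent]])

lemma N_part_phi:
  "z \<in> topspace (S_top T) \<Longrightarrow> w \<in> STan z \<Longrightarrow> N_part (\<phi> z w) = P (snd z) (N_part w)"
  unfolding S_phi_def by (rule N_part_S_vec[OF _ P_tangent[OF topspace_SD(2) N_part_tangent]])

lemma eta_phi: "z \<in> topspace (S_top T) \<Longrightarrow> w \<in> STan z \<Longrightarrow> \<eta> z (\<phi> z w) = 0"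
  unfolding S_phi_def by (rule S_eta_S_vec[OF _ P_tangent[OF topspace_SD(2) N_part_tangent]])

lemma phi_chart:
  "z \<in> topspace (S_top T) \<Longrightarrow> c \<in> charts_at A (snd z) \<Longrightarrow>
    \<phi> z w (S_chart c) = (0, P (snd z) (N_part w) c)"
  unfolding S_phi_def by (rule S_vec_S_chart[OF topspace_SD(1)])

lemma N_part_linear: "N_part (a *\<^sub>T v +\<^sub>T b *\<^sub>T w) = a *\<^sub>T N_part v +\<^sub>T b *\<^sub>T N_part w"
  unfolding N_part_add N_part_scale ..

lemma phi_linear:
  assumes z: "z \<in> topspace (S_top T)" and v: "v \<in> STan z" and w: "w \<in> STan z"
  shows "\<phi> z (a *\<^sub>T v +\<^sub>T b *\<^sub>T w) = a *\<^sub>T \<phi> z v +\<^sub>T b *\<^sub>T \<phi> z w"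
  unfolding S_phi_def N_part_linear P_linear[OF topspace_SD(2)[OF z] N_part_tangent[OF z v] N_part_tangent[OF z w]]
  using S_vec_linear[of z a _ b _ 0 0] by simp

lemma phi_phi:
  assumes z: "z \<in> topspace (S_top T)" and w: "w \<in> STan z"
  shows "\<phi> z (\<phi> z w) = w -\<^sub>T \<eta> z w *\<^sub>T \<xi> z"
proof -
  have "\<phi> z (\<phi> z w) = S_vec A z (N_part w) 0"
    using P_involution[OF topspace_SD(2)[OF z] N_part_tangent[OF z w]] N_part_phi[OF z w]
    by (simp only: S_phi_def[of A P z "\<phi> z w"])
  also have "\<dots> = S_vec A z (N_part w) (\<eta> z w) -\<^sub>T \<eta> z w *\<^sub>T \<xi> z"
    by (auto simp: fun_eq_iff S_vec_def S_xi_def)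
  finally show ?thesis using S_vec_decomposition[OF z w] by simp
qed

lemma phi_xi: assumes z: "z \<in> topspace (S_top T)" shows "\<phi> z (\<xi> z) = tzero"
proof -
  have "P (snd z) tzero = tzero"
    using P_linear[OF topspace_SD(2)[OF z] tangent_zero tangent_zero, of 0 0] by simp
  then show ?thesis unfolding S_phi_def N_part_xi[OF z] by (simp only: S_vec_zero)
qed

lemma smooth_phi:
  assumes U: "openin (S_top T) U" and X: "smooth_vfield_on (S_atlas A) U X"
  shows "smooth_vfield_on (S_atlas A) U (\<lambda>z. \<phi> z (X z))"
  unfolding smooth_vfield_on_def
proof (intro conjI ballI)
  fix z assume "z \<in> U"
  then show "\<phi> z (X z) \<in> STan z"
    using phi_tangent[OF S_open_subset[OF U] vfield_tangent[OF X]] by blast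
next
  fix C assume C: "C \<in> S_atlas A"
  then obtain c where c: "c \<in> A" and C_eq: "C = S_chart c" by (auto simp: S_atlas_def)
  let ?D = "snd (S_chart c) ` (fst (S_chart c) \<inter> U)"
  let ?z = "chart_inv (S_chart c)"
  note o = open_S_chart_image[OF c U]
  have PE: "smooth_on ?D (\<lambda>x. P (snd (?z x)) (chart_vec A c (snd (?z x)) b) c)" for b
  proof (rule smooth_on_N_coordinate[OF c U])
    show "smooth_on (snd c ` fst c) (\<lambda>y. P (chart_inv c y) (chart_vec A c (chart_inv c y) b) c)"
      using vfield_chart[OF P_smooth[OF openin_chart[OF c] smooth_chart_vec[OF c, of b]] c] by simp
  qed
  have L: "bounded_linear (\<lambda>y::'e. (0::real, y))"
    by (intro bounded_linear_Pair bounded_linear_zero bounded_linear_ident)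
  have "smooth_on ?D (\<lambda>x. (0::real, \<Sum>b\<in>Basis. (N_part (X (?z x)) c \<bullet> b) *\<^sub>R
      P (snd (?z x)) (chart_vec A c (snd (?z x)) b) c))"
    by (rule smooth_on_bounded_linear_comp[OF o L smooth_on_sum[OF o smooth_on_scaleR[OF o
              smooth_N_component[OF c U X] PE]]])
  then show "smooth_on (snd C ` (fst C \<inter> U)) (\<lambda>x. \<phi> (chart_inv C x) (X (chart_inv C x)) C)"
    unfolding C_eq
  proof (rule smooth_on_cong[OF o, rotated])
    fix x assume x: "x \<in> ?D"
    note z = S_chart_image_at[OF c U x]
    note p = topspace_SD(2)[OF z(2)]
    have "P (snd (?z x)) (N_part (X (?z x))) c = (\<Sum>b\<in>Basis. (N_part (X (?z x)) c \<bullet> b) *\<^sub>R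
      P (snd (?z x)) (chart_vec A c (snd (?z x)) b) c)"
      by (rule linear_map_expansion[OF z(3) N_part_tangent[OF z(2) vfield_tangent[OF X z(1)]]])
        (subst P_linear[OF p], assumption+, simp)
    then show "(0::real, \<Sum>b\<in>Basis. (N_part (X (?z x)) c \<bullet> b) *\<^sub>R
      P (snd (?z x)) (chart_vec A c (snd (?z x)) b) c) = \<phi> (?z x) (X (?z x)) (S_chart c)"
      unfolding phi_chart[OF z(2,3)] by (simp only:)
  qed
qed

lemma S_metric_linear:
  assumes z: "z \<in> topspace (S_top T)" and x: "x \<in> STan z" and y: "y \<in> STan z" and w: "w \<in> STan z"
  shows "gS z (a *\<^sub>T x +\<^sub>T b *\<^sub>T y) w = a * gS z x w + b * gS z y w"
proof -
  note N = N_part_tangent[OF z x] N_part_tangent[OF z y] N_part_tangent[OF z w] and p = topspace_SD(2)[OF z]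
  show ?thesis
    unfolding S_metric_def S_eta_linear[OF z x y] N_part_linear metric_linear[OF p N] associated_metric_linear[OF p N]
    by (simp add: algebra_simps)
qed

text \<open>
  As \<open>h~ (x', x') \<ge> - h (x', x')\<close> and \<open>t > 0\<close>, the metric on the slices is at least
  \<open>(cosh 2t - sinh 2t) h\<close>, where the factor is a value of the exponential function.
\<close>
lemma S_metric_pos:
  assumes z: "z \<in> topspace (S_top T)" and x: "x \<in> STan z" and "x \<noteq> tzero"
  shows "gS z x x > 0"
proof -
  note N = N_part_tangent[OF z x] and p = topspace_SD(2)[OF z]
  let ?H = "h (snd z) (N_part x) (N_part x)"
  have "sinh (2 * fst z) \<ge> 0" using topspace_SD(1)[OF z] by simp
  then have "sinh (2 * fst z) * - ?H \<le> sinh (2 * fst z) * associated_metric P h (snd z) (N_part x) (N_part x)"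
    by (rule mult_left_mono[OF associated_metric_bound[OF p N]])
  moreover have "cosh (2 * fst z) * ?H = exp (- (2 * fst z)) * ?H + sinh (2 * fst z) * ?H"
    unfolding cosh_minus_sinh[symmetric] by (simp add: algebra_simps)
  ultimately have ge: "gS z x x \<ge> \<eta> z x * \<eta> z x + exp (- (2 * fst z)) * ?H"
    unfolding S_metric_def by simp
  show ?thesis
  proof (cases "N_part x = tzero")
    case True
    have "\<eta> z x \<noteq> 0"
    proof
      assume "\<eta> z x = 0"
      then have "x = S_vec A z tzero 0" using S_vec_decomposition[OF z x] True by simp
      then show False using assms(3) by (simp only: S_vec_zero)
    qed
    then have "\<eta> z x * \<eta> z x > 0" by (metis not_real_square_gt_zero)
    moreover have "exp (- (2 * fst z)) * ?H \<ge> 0" using metric_nonneg[OF p N] by simp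
    ultimately show ?thesis using ge by linarith
  next
    case False
    then have "exp (- (2 * fst z)) * ?H > 0" using metric_pos[OF p N] by simp
    moreover have "\<eta> z x * \<eta> z x \<ge> 0" by simp
    ultimately show ?thesis using ge by linarith
  qed
qed

lemma riemannian_metric_S: "riemannian_metric (S_top T) (S_atlas A) gS"
  unfolding riemannian_metric_def
proof (intro conjI ballI allI impI)
  fix z x y w a b assume "z \<in> topspace (S_top T)" "x \<in> STan z" "y \<in> STan z" "w \<in> STan z"
  then show "gS z (a *\<^sub>T x +\<^sub>T b *\<^sub>T y) w = a * gS z x w + b * gS z y w" by (rule S_metric_linear)
next
  fix z x y assume z: "z \<in> topspace (S_top T)" and x: "x \<in> STan z" and y: "y \<in> STan z"
  show "gS z x y = gS z y x"
    unfolding S_metric_def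
    using metric_sym[OF topspace_SD(2)[OF z] N_part_tangent[OF z x] N_part_tangent[OF z y]]
      associated_metric_sym[OF topspace_SD(2)[OF z] N_part_tangent[OF z x] N_part_tangent[OF z y]] by simp
next
  fix z x assume "z \<in> topspace (S_top T)" "x \<in> STan z" "x \<noteq> tzero"
  then show "gS z x x > 0" by (rule S_metric_pos)
next
  fix U X Y
  assume "openin (S_top T) U \<and> smooth_vfield_on (S_atlas A) U X \<and> smooth_vfield_on (S_atlas A) U Y"
  then have U: "openin (S_top T) U" and X: "smooth_vfield_on (S_atlas A) U X"
    and Y: "smooth_vfield_on (S_atlas A) U Y" by blast+
  have 1: "smooth_fun_on (S_atlas A) U (\<lambda>z. h (snd z) (N_part (X z)) (N_part (Y z)))"
    by (rule smooth_pulled_back_form[OF metric_linear metric_linear_right smooth_metric U X Y])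
  have 2: "smooth_fun_on (S_atlas A) U (\<lambda>z. associated_metric P h (snd z) (N_part (X z)) (N_part (Y z)))"
    by (rule smooth_pulled_back_form[OF associated_metric_linear associated_metric_linear_right
          smooth_associated_metric U X Y])
  show "smooth_fun_on (S_atlas A) U (\<lambda>z. gS z (X z) (Y z))"
    unfolding S_metric_def
    by (rule S.smooth_fun_on_add[OF U S.smooth_fun_on_add[OF U
            S.smooth_fun_on_mult[OF U smooth_eta[OF U X] smooth_eta[OF U Y]]
            S.smooth_fun_on_mult[OF U smooth_cosh_sinh(1)[OF U] 1]]
          S.smooth_fun_on_mult[OF U smooth_cosh_sinh(2)[OF U] 2]])
qed

lemma N_part_chart_vec:
  assumes z: "z \<in> topspace (S_top T)" and c: "c \<in> charts_at A (snd z)"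
  shows "N_part (chart_vec (S_atlas A) (S_chart c) z u) = chart_vec A c (snd z) (snd u)"
proof -
  have C: "S_chart c \<in> charts_at (S_atlas A) z" using c topspace_SD(1)[OF z] by simp
  show ?thesis
    by (rule tangent_eqI[OF N_part_tangent[OF z S.chart_vec_tangent[OF C]] chart_vec_tangent[OF c] c])
      (simp add: N_part_apply S.chart_vec_self[OF C] chart_vec_self[OF c])
qed

lemma traceless_phi: "traceless (S_atlas A) \<phi>"
  unfolding traceless_def
proof (intro allI ballI)
  fix z C assume C: "C \<in> charts_at (S_atlas A) z"
  then obtain c where c: "c \<in> charts_at A (snd z)" and C_eq: "C = S_chart c" unfolding S_charts_at_iff by blast
  have z: "z \<in> topspace (S_top T)" using S.charts_at_topspace[OF C] .
  have "trace_in_chart A c (snd z) (P (snd z)) = 0" using P_traceless c unfolding traceless_def by blast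
  then show "trace_in_chart (S_atlas A) C z (\<phi> z) = 0"
    unfolding C_eq trace_in_chart_def phi_chart[OF z c] N_part_chart_vec[OF z c] sum_Basis_prod
    by simp
qed

lemma S_metric_phi:
  assumes z: "z \<in> topspace (S_top T)" and x: "x \<in> STan z" and y: "y \<in> STan z"
  shows "gS z (\<phi> z x) (\<phi> z y) = gS z x y - \<eta> z x * \<eta> z y"
proof -
  note N = N_part_tangent[OF z x] N_part_tangent[OF z y] and p = topspace_SD(2)[OF z]
  show ?thesis
    unfolding S_metric_def eta_phi[OF z x] eta_phi[OF z y] N_part_phi[OF z x] N_part_phi[OF z y]
      associated_metric_def P_isometry[OF p N] P_isometry[OF p N(1) P_tangent[OF p N(2)]]
    by simp
qed

theorem apapR_S: "apapR_manifold (S_top T) (S_atlas A) \<phi> \<xi> \<eta> gS"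
  unfolding apapR_manifold_def
proof (intro conjI ballI)
  have "even DIM('e)" using paracomplex unfolding almost_paracomplex_riemannian_def by (elim conjE)
  then show "odd DIM(real \<times> 'e)" by simp
  show "smooth_manifold (S_top T) (S_atlas A)" by (rule smooth_manifold_S)
  show "endomorphism_field (S_top T) (S_atlas A) \<phi>"
    unfolding endomorphism_field_def
    by (intro conjI ballI allI impI; (elim conjE)?) (rule phi_tangent phi_linear smooth_phi; assumption)+
  show "one_form (S_top T) (S_atlas A) \<eta>"
    unfolding one_form_def
    by (intro conjI ballI allI impI; (elim conjE)?) (rule S_eta_linear smooth_eta; assumption)+
  show "smooth_vfield_on (S_atlas A) (topspace (S_top T)) \<xi>" by (rule smooth_xi)
  show "riemannian_metric (S_top T) (S_atlas A) gS" by (rule riemannian_metric_S)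
  show "traceless (S_atlas A) \<phi>" by (rule traceless_phi)
qed (rule phi_phi S_eta_xi eta_phi phi_xi S_metric_phi; assumption)+

end

section \<open>The curvature of the product in the direction of \<open>\<xi>\<close>\<close>

locale paracomplex_cone = paracomplex_manifold T A h P
  for T :: "'m topology" and A :: "('m, 'e::euclidean_space) chart set" and h :: "('m, 'e) form2"
    and P :: "'m \<Rightarrow> ('m, 'e) tvec \<Rightarrow> ('m, 'e) tvec" +
  fixes nabla :: "(real \<times> 'm, real \<times> 'e) vfield \<Rightarrow> (real \<times> 'm, real \<times> 'e) vfield \<Rightarrow> (real \<times> 'm, real \<times> 'e) vfield"
  assumes levi_civita_S: "levi_civita (S_top T) (S_atlas A) (S_metric A P h) nabla"

sublocale paracomplex_cone \<subseteq> L: levi_civita_manifold "S_top T" "S_atlas A" "S_metric A P h" nabla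
  by unfold_locales (rule riemannian_metric_S, rule levi_civita_S)

context paracomplex_cone
begin

lemma metric_xi:
  assumes z: "z \<in> topspace (S_top T)" and w: "w \<in> STan z"
  shows "gS z (\<xi> z) w = \<eta> z w"
proof -
  note N = N_part_tangent[OF z w] and p = topspace_SD(2)[OF z]
  show ?thesis
    unfolding S_metric_def S_eta_xi[OF z] N_part_xi[OF z] associated_metric_def
      metric_zero[OF p N] metric_zero[OF p P_tangent[OF p N]] by simp
qed

context
  fixes c assumes c: "c \<in> A"
begin

text \<open>
  In the product chart \<open>C\<close> over the chart \<open>c\<close> of \<open>N\<close>, the fields \<open>E u\<close> have the constant components
  \<open>u\<close>.  They commute, and \<open>\<xi> = E (1, 0)\<close> is one of them.
\<close>
abbreviation (input) "C \<equiv> S_chart c"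
abbreviation (input) "U \<equiv> fst (S_chart c)"
abbreviation (input) "E u \<equiv> \<lambda>z. chart_vec (S_atlas A) (S_chart c) z u"

lemma U_open: "openin (S_top T) U"
  by (rule S.openin_chart) (simp only: S_chart_in_atlas c)

lemma E_smooth: "smooth_vfield_on (S_atlas A) U (E u)"
  by (rule S.smooth_chart_vec) (simp only: S_chart_in_atlas c)

lemma U_facts:
  assumes "z \<in> U"
  shows "z \<in> topspace (S_top T)" "0 < fst z" "c \<in> charts_at A (snd z)" "C \<in> charts_at (S_atlas A) z"
  using S_open_subset[OF U_open assms] assms c by (auto simp: charts_at_def)

lemma E_xi: assumes z: "z \<in> U" shows "E (1, 0) z = \<xi> z"
  by (rule S.tangent_eqI[OF S.chart_vec_tangent[OF U_facts(4)[OF z]] S_xi_tangent[OF U_facts(1)[OF z]]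
        U_facts(4)[OF z]])
    (simp only: S.chart_vec_self[OF U_facts(4)[OF z]] S_xi_chart[OF U_facts(1,3)[OF z]])

lemma eta_E: assumes z: "z \<in> U" shows "\<eta> z (E u z) = fst u"
  unfolding S_eta_chart[OF U_facts(1)[OF z] S.chart_vec_tangent[OF U_facts(4)[OF z]] U_facts(3)[OF z]]
    S.chart_vec_self[OF U_facts(4)[OF z]] ..

lemma metric_E:
  assumes z: "z \<in> U"
  shows "gS z (E u z) (E v z) = fst u * fst v
    + cosh (2 * fst z) * h (snd z) (chart_vec A c (snd z) (snd u)) (chart_vec A c (snd z) (snd v))
    + sinh (2 * fst z) * associated_metric P h (snd z) (chart_vec A c (snd z) (snd u)) (chart_vec A c (snd z) (snd v))"
  unfolding S_metric_def eta_E[OF z] N_part_chart_vec[OF U_facts(1,3)[OF z]] ..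

lemma E_commute:
  assumes z: "z \<in> U" shows "lie_bracket (S_atlas A) (E u) (E v) z = tzero"
  by (rule S.tangent_eqI[OF L.lie_bracket_tangent[OF U_open E_smooth E_smooth z] S.tangent_zero U_facts(4)[OF z]])
    (simp only: S.lie_bracket_chart_vec[OF U_facts(4)[OF z]] tzero_apply)

lemma nabla_E_commute:
  assumes z: "z \<in> U" shows "nabla (E u) (E v) z = nabla (E v) (E u) z"
proof -
  have "nabla (E u) (E v) z -\<^sub>T nabla (E v) (E u) z = tzero"
    using L.torsion_free[OF U_open E_smooth E_smooth z, of u v] E_commute[OF z, of u v] by simp
  then show ?thesis by (simp add: fun_eq_iff)
qed

text \<open>
  A product chart leaves the first coordinate unchanged, so that the time derivative of the metric is
  an ordinary derivative, in which \<open>h\<close> and \<open>h~\<close> at a fixed point of \<open>N\<close> are constants.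
\<close>
lemma dir_deriv_xi:
  assumes z: "z \<in> U" and F: "smooth_fun_on (S_atlas A) U F"
    and D: "((\<lambda>s. F (s, snd z)) has_real_derivative D) (at (fst z))"
  shows "dir_deriv (S_atlas A) z (E (1, 0) z) F = D"
proof -
  note zf = U_facts[OF z]
  let ?G = "\<lambda>x. F (chart_inv C x)"
  let ?G' = "frechet_derivative ?G (at (snd C z))"
  have G: "(?G has_derivative ?G') (at (snd C z))"
    by (rule S.fun_chart_has_derivative[OF z F zf(4)])
  have eq: "dir_deriv (S_atlas A) z (E (1, 0) z) F = ?G' (1, 0)"
    unfolding S.dir_deriv_chart[OF U_open z F zf(4) S.chart_vec_tangent[OF zf(4)]] S.chart_vec_self[OF zf(4)] ..
  have l: "((\<lambda>s. (s, snd c (snd z))) has_derivative (\<lambda>r. (r, 0))) (at (fst z))"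
    by (rule has_derivative_Pair[OF has_derivative_ident has_derivative_const])
  have "(?G has_derivative ?G') (at (fst z, snd c (snd z)))" using G by (simp only: snd_S_chart)
  from has_derivative_compose[OF l this]
  have "((\<lambda>s. ?G (s, snd c (snd z))) has_derivative (\<lambda>r. ?G' (r, 0))) (at (fst z))" .
  then have "((\<lambda>s. F (s, snd z)) has_derivative (\<lambda>r. ?G' (r, 0))) (at (fst z))"
  proof (rule has_derivative_transform_within_open[OF _ open_greaterThan[of 0]])
    fix s :: real assume "s \<in> {0<..}"
    moreover have "snd z \<in> fst c" using zf(3) by (simp add: charts_at_def)
    ultimately show "?G (s, snd c (snd z)) = F (s, snd z)" using S_chart_inv[OF c] c by simp
  qed (use zf in simp_all)
  moreover have "(\<lambda>r. ?G' (r, 0)) = (*) (?G' (1, 0))"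
  proof
    fix r
    have "?G' (r *\<^sub>R (1, 0)) = r *\<^sub>R ?G' (1, 0)" by (rule linear_cmul[OF has_derivative_linear[OF G]])
    then show "?G' (r, 0) = ?G' (1, 0) * r" by (simp add: mult.commute)
  qed
  ultimately have "((\<lambda>s. F (s, snd z)) has_real_derivative ?G' (1, 0)) (at (fst z))"
    unfolding has_field_derivative_def by (simp only:)
  then show ?thesis unfolding eq using D DERIV_unique by blast
qed

text \<open>
  The time derivative of \<open>cosh 2t h + sinh 2t h~\<close> is \<open>2 g (\<phi> \<cdot>, \<cdot>)\<close>, since composition with \<open>P\<close>
  interchanges \<open>h\<close> and \<open>h~\<close>.
\<close>
lemma dir_deriv_xi_metric:
  assumes z: "z \<in> U"
  shows "dir_deriv (S_atlas A) z (E (1, 0) z) (\<lambda>q. gS q (E u q) (E v q)) = 2 * gS z (\<phi> z (E u z)) (E v z)"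
proof -
  note zf = U_facts[OF z] and p = topspace_SD(2)[OF U_facts(1)[OF z]]
  let ?x = "chart_vec A c (snd z) (snd u)" and ?y = "chart_vec A c (snd z) (snd v)"
  let ?H = "h (snd z) ?x ?y" and ?K = "associated_metric P h (snd z) ?x ?y"
  have xy: "?x \<in> Tan (snd z)" "?y \<in> Tan (snd z)"
    by (rule chart_vec_tangent[OF zf(3)])+
  have "((\<lambda>s. fst u * fst v + cosh (2 * s) * ?H + sinh (2 * s) * ?K)
      has_real_derivative (2 * sinh (2 * fst z) * ?H + 2 * cosh (2 * fst z) * ?K)) (at (fst z))"
    by (auto intro!: derivative_eq_intros)
  then have "((\<lambda>s. gS (s, snd z) (E u (s, snd z)) (E v (s, snd z)))
      has_real_derivative (2 * sinh (2 * fst z) * ?H + 2 * cosh (2 * fst z) * ?K)) (at (fst z))"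
  proof (rule has_field_derivative_transform_within_open[where S="{0<..}"])
    fix s :: real assume "s \<in> {0<..}"
    then have "(s, snd z) \<in> U" using z by auto
    from metric_E[OF this, of u v]
    show "fst u * fst v + cosh (2 * s) * ?H + sinh (2 * s) * ?K = gS (s, snd z) (E u (s, snd z)) (E v (s, snd z))"
      by simp
  qed (use zf in simp_all)
  from dir_deriv_xi[OF z L.smooth_metric[OF U_open E_smooth E_smooth] this]
  have "dir_deriv (S_atlas A) z (E (1, 0) z) (\<lambda>q. gS q (E u q) (E v q))
      = 2 * sinh (2 * fst z) * ?H + 2 * cosh (2 * fst z) * ?K" .
  moreover have "gS z (\<phi> z (E u z)) (E v z) = cosh (2 * fst z) * ?K + sinh (2 * fst z) * ?H"
    unfolding S_metric_def eta_phi[OF zf(1) S.chart_vec_tangent[OF zf(4)]]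
      N_part_phi[OF zf(1) S.chart_vec_tangent[OF zf(4)]] N_part_chart_vec[OF zf(1,3)]
      associated_metric_def P_isometry[OF p xy] P_self_adjoint[OF p xy] by simp
  ultimately show ?thesis by simp
qed

text \<open>
  Koszul's formula for commuting fields reduces to \<open>2 g (\<nabla>\<^sub>u \<xi>, v) = \<xi> g (u, v)\<close>, because
  \<open>g (\<xi>, v) = dt (v)\<close> is constant for a coordinate field \<open>v\<close>.
\<close>
lemma nabla_E_xi:
  assumes z: "z \<in> U" shows "nabla (E u) (E (1, 0)) z = \<phi> z (E u z)"
proof -
  note zf = U_facts[OF z]
  note tE = S.chart_vec_tangent[OF zf(4)]
  note tn = vfield_tangent[OF L.nabla_smooth[OF U_open E_smooth E_smooth] z]
  have 0: "gS z (nabla (E a) (E (1, 0)) z) (E b z) + gS z (E (1, 0) z) (nabla (E a) (E b) z) = 0" for a b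
  proof -
    have "gS q (E (1, 0) q) (E b q) = fst b" if "q \<in> U" for q
      using metric_xi[OF U_facts(1)[OF that] S.chart_vec_tangent[OF U_facts(4)[OF that], of b]]
        E_xi[OF that] eta_E[OF that, of b] by simp
    then have "dir_deriv (S_atlas A) z (E a z) (\<lambda>q. gS q (E (1, 0) q) (E b q))
        = dir_deriv (S_atlas A) z (E a z) (\<lambda>q. fst b)"
      by (rule S.dir_deriv_cong[OF U_open z])
    then show ?thesis
      using L.metric_compatible[OF U_open E_smooth E_smooth E_smooth z, of a "(1, 0)" b] S.dir_deriv_const
      by simp
  qed
  \<comment> \<open>\<open>\<nabla>\<xi>\<close> is self-adjoint, so the two terms of \<open>\<xi> g (u, v)\<close> are equal\<close>
  have key: "gS z (nabla (E u) (E (1, 0)) z) (E v z) = gS z (\<phi> z (E u z)) (E v z)" for v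
  proof -
    have "gS z (nabla (E u) (E (1, 0)) z) (E v z) = gS z (nabla (E v) (E (1, 0)) z) (E u z)"
      using 0[of u v] 0[of v u] nabla_E_commute[OF z, of u v] by simp
    also have "\<dots> = gS z (E u z) (nabla (E v) (E (1, 0)) z)"
      by (rule L.metric_sym[OF zf(1) tn tE])
    finally have s: "gS z (nabla (E u) (E (1, 0)) z) (E v z) = gS z (E u z) (nabla (E v) (E (1, 0)) z)" .
    have "2 * gS z (\<phi> z (E u z)) (E v z)
       = gS z (nabla (E (1, 0)) (E u) z) (E v z) + gS z (E u z) (nabla (E (1, 0)) (E v) z)"
      using dir_deriv_xi_metric[OF z, of u v] L.metric_compatible[OF U_open E_smooth E_smooth E_smooth z, of "(1, 0)" u v]
      by simp
    then show ?thesis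
      using s nabla_E_commute[OF z, of "(1, 0)" u] nabla_E_commute[OF z, of "(1, 0)" v] by simp
  qed
  show ?thesis
  proof (rule L.metric_nondegenerate[OF zf(1) tn phi_tangent[OF zf(1) tE]])
    fix w assume "w \<in> STan z"
    from S.chart_vec_component[OF this zf(4)] key[of "w C"]
    show "gS z (nabla (E u) (E (1, 0)) z) w = gS z (\<phi> z (E u z)) w" by simp
  qed
qed

text \<open>Both sides are tensorial in \<open>X\<close>, so the coordinate fields determine them.\<close>
lemma nabla_xi:
  assumes z: "z \<in> U" and X: "smooth_vfield_on (S_atlas A) U X"
  shows "nabla X (E (1, 0)) z = \<phi> z (X z)"
proof -
  note zf = U_facts[OF z]
  have e: "E (X z C) z = X z"
    by (rule S.chart_vec_component[OF vfield_tangent[OF X z] zf(4)])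
  have "nabla X (E (1, 0)) z = nabla (E (X z C)) (E (1, 0)) z"
  proof (rule S.tensorial_pointwise[OF U_open z _ X E_smooth e[symmetric], where Q="\<lambda>X. nabla X (E (1, 0)) z"])
    fix V assume V: "openin (S_top T) V" "z \<in> V" "V \<subseteq> U"
    show "tensorial_at (S_atlas A) V z (\<lambda>X. nabla X (E (1, 0)) z)"
      by (rule L.nabla_tensorial_left[OF V(1) vfield_subset[OF E_smooth V(3)] V(2)])
  qed
  also have "\<dots> = \<phi> z (X z)" using nabla_E_xi[OF z, of "X z C"] e by simp
  finally show ?thesis .
qed

lemma phi_E_smooth: "smooth_vfield_on (S_atlas A) U (\<lambda>z. \<phi> z (E u z))"
  by (rule smooth_phi[OF U_open E_smooth])

text \<open>The Lie derivative of \<open>\<phi>\<close> along \<open>\<xi>\<close> vanishes, as the components of \<open>\<phi>\<close> do not involve \<open>t\<close>.\<close>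
lemma xi_phi_E_commute:
  assumes z: "z \<in> U"
  shows "lie_bracket (S_atlas A) (E (1, 0)) (\<lambda>q. \<phi> q (E u q)) z = tzero"
proof (rule S.tangent_eqI[OF L.lie_bracket_tangent[OF U_open E_smooth phi_E_smooth z] S.tangent_zero U_facts(4)[OF z]])
  note zf = U_facts[OF z]
  have oD: "open (snd C ` (U \<inter> U))" "snd C z \<in> snd C ` (U \<inter> U)"
    using open_S_chart_image[OF c U_open] z by blast+
  let ?k = "\<lambda>y. P (chart_inv c y) (chart_vec A c (chart_inv c y) (snd u)) c"
  have D1: "frechet_derivative (\<lambda>x. E (1, 0) (chart_inv C x) C) (at (snd C z))
     = frechet_derivative (\<lambda>x. (1, 0)) (at (snd C z))"
  proof (rule frechet_derivative_cong_open[OF oD])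
    fix x assume "x \<in> snd C ` (U \<inter> U)"
    from S_chart_image_at(1)[OF c U_open this] show "E (1, 0) (chart_inv C x) C = (1, 0)"
      by (rule S.chart_vec_self[OF U_facts(4)])
  qed
  have D2: "frechet_derivative (\<lambda>x. \<phi> (chart_inv C x) (E u (chart_inv C x)) C) (at (snd C z))
     = frechet_derivative (\<lambda>x. (0, ?k (snd x))) (at (snd C z))"
  proof (rule frechet_derivative_cong_open[OF oD])
    fix x assume x: "x \<in> snd C ` (U \<inter> U)"
    note q = S_chart_image_at[OF c U_open x]
    have m: "snd (chart_inv C x) \<in> fst c" using q(3) by (simp add: charts_at_def)
    have "snd x = snd c (snd (chart_inv C x))"
      using arg_cong[OF q(4), of snd] by (simp only: snd_S_chart snd_conv)
    then have "snd (chart_inv C x) = chart_inv c (snd x)"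
      by (simp only: chart_inv_chart[OF c m])
    then show "\<phi> (chart_inv C x) (E u (chart_inv C x)) C = (0, ?k (snd x))"
      unfolding phi_chart[OF q(2,3)] N_part_chart_vec[OF q(2,3)] by simp
  qed
  have "smooth_on (snd c ` (fst c \<inter> fst c)) ?k"
    by (rule vfield_chart[OF P_smooth[OF openin_chart[OF c] smooth_chart_vec[OF c]] c])
  moreover have "snd c (snd z) \<in> snd c ` (fst c \<inter> fst c)" using zf(3) by (simp add: charts_at_def)
  ultimately have "(?k has_derivative frechet_derivative ?k (at (snd c (snd z)))) (at (snd (snd C z)))"
    using smooth_on_has_derivative by (simp only: snd_S_chart snd_conv)
  then have "((\<lambda>x. ?k (snd x)) has_derivative (\<lambda>w. frechet_derivative ?k (at (snd c (snd z))) (snd w))) (at (snd C z))"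
    by (rule has_derivative_compose[OF bounded_linear_imp_has_derivative[OF bounded_linear_snd]])
  then have "((\<lambda>x. (0::real, ?k (snd x))) has_derivative
      (\<lambda>w. (0, frechet_derivative ?k (at (snd c (snd z))) (snd w)))) (at (snd C z))"
    by (rule has_derivative_Pair[OF has_derivative_const])
  note D3 = fun_cong[OF frechet_derivative_at[OF this, symmetric], of "(1, 0)"]
  have "linear (frechet_derivative ?k (at (snd c (snd z))))"
    using \<open>(?k has_derivative _) _\<close> by (rule has_derivative_linear)
  then have "frechet_derivative ?k (at (snd c (snd z))) 0 = 0" by (rule linear_0)
  then show "lie_bracket (S_atlas A) (E (1, 0)) (\<lambda>q. \<phi> q (E u q)) z C = tzero C"
    unfolding S.lie_bracket_chart[OF zf(4)] D1 D2 S.chart_vec_self[OF zf(4)] using D3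
    by (simp add: zero_prod_def)
qed

text \<open>
  With \<open>\<nabla>\<xi> = \<phi>\<close> and \<open>[\<xi>, \<phi> u] = 0\<close> one has \<open>\<nabla>\<^sub>\<xi> (\<phi> u) = \<nabla>\<^sub>\<phi>\<^sub>u \<xi> = \<phi>\<^sup>2 u\<close>, and this is the only
  term of \<open>R (u, \<xi>) \<xi>\<close> that does not vanish.
\<close>
lemma curvature_fields_xi:
  assumes z: "z \<in> U"
  shows "curvature_fields (S_atlas A) nabla (E u) (E (1, 0)) (E (1, 0)) z = (-1) *\<^sub>T \<phi> z (\<phi> z (E u z))"
proof -
  note zf = U_facts[OF z]
  note Ex = L.nabla_smooth[OF U_open E_smooth E_smooth]
  have "nabla (E (1, 0)) (E (1, 0)) q = tzero" if "q \<in> U" for q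
    using nabla_xi[OF that E_smooth, of "(1, 0)"] E_xi[OF that] phi_xi[OF U_facts(1)[OF that]] by simp
  then have "nabla (E u) (nabla (E (1, 0)) (E (1, 0))) z = nabla (E u) (\<lambda>q. tzero) z"
    by (rule L.nabla_cong_right[OF U_open E_smooth Ex S.vfield_zero z])
  also have "\<dots> = tzero"
    using L.nabla_scale_const_right[OF U_open E_smooth S.vfield_zero z, of u 0] by simp
  finally have 1: "nabla (E u) (nabla (E (1, 0)) (E (1, 0))) z = tzero" .
  have "nabla (E (1, 0)) (nabla (E u) (E (1, 0))) z = nabla (E (1, 0)) (\<lambda>q. \<phi> q (E u q)) z"
    by (rule L.nabla_cong_right[OF U_open E_smooth Ex phi_E_smooth z nabla_xi[OF _ E_smooth]])
  also have "\<dots> = nabla (\<lambda>q. \<phi> q (E u q)) (E (1, 0)) z"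
  proof -
    have "nabla (E (1, 0)) (\<lambda>q. \<phi> q (E u q)) z -\<^sub>T nabla (\<lambda>q. \<phi> q (E u q)) (E (1, 0)) z = tzero"
      using L.torsion_free[OF U_open E_smooth phi_E_smooth z, of "(1, 0)" u] xi_phi_E_commute[OF z, of u] by simp
    then show ?thesis by (simp add: fun_eq_iff)
  qed
  also have "\<dots> = \<phi> z (\<phi> z (E u z))" by (rule nabla_xi[OF z phi_E_smooth])
  finally have 2: "nabla (E (1, 0)) (nabla (E u) (E (1, 0))) z = \<phi> z (\<phi> z (E u z))" .
  have "\<phi> z tzero = tzero"
    using phi_linear[OF zf(1) S.tangent_zero S.tangent_zero, of 0 0] by simp
  then have 3: "nabla (lie_bracket (S_atlas A) (E u) (E (1, 0))) (E (1, 0)) z = tzero"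
    using nabla_xi[OF z L.smooth_lie_bracket[OF U_open E_smooth E_smooth], of u "(1, 0)"] E_commute[OF z, of u "(1, 0)"]
    by simp
  show ?thesis unfolding curvature_fields_def 1 2 3 by simp
qed

end

lemma curvature_xi:
  assumes z: "z \<in> topspace (S_top T)" and x: "x \<in> STan z" and w: "w \<in> STan z"
  shows "curvature (S_top T) (S_atlas A) gS nabla z x (\<xi> z) (\<xi> z) w = \<eta> z x * \<eta> z w - gS z x w"
proof -
  obtain c where c: "c \<in> charts_at A (snd z)" using z by (rule S_chart_obtain)
  then have cA: "c \<in> A" and zU: "z \<in> fst (S_chart c)"
    using topspace_SD(1)[OF z] by (auto simp: charts_at_def mem_Times_iff)
  note C = U_facts(4)[OF cA zU]
  have "curvature_op (S_top T) (S_atlas A) nabla z x (\<xi> z) (\<xi> z)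
     = curvature_fields (S_atlas A) nabla (\<lambda>z. chart_vec (S_atlas A) (S_chart c) z (x (S_chart c)))
        (\<lambda>z. chart_vec (S_atlas A) (S_chart c) z (1, 0)) (\<lambda>z. chart_vec (S_atlas A) (S_chart c) z (1, 0)) z"
    by (rule L.curvature_op_eq[OF U_open[OF cA] zU E_smooth[OF cA] E_smooth[OF cA] E_smooth[OF cA]
          S.chart_vec_component[OF x C] E_xi[OF cA zU] E_xi[OF cA zU]])
  also have "\<dots> = (-1) *\<^sub>T (x -\<^sub>T \<eta> z x *\<^sub>T \<xi> z)"
    unfolding curvature_fields_xi[OF cA zU] S.chart_vec_component[OF x C] phi_phi[OF z x] ..
  also have "\<dots> = (-1) *\<^sub>T x +\<^sub>T \<eta> z x *\<^sub>T \<xi> z" by (simp add: fun_eq_iff)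
  finally have e: "curvature_op (S_top T) (S_atlas A) nabla z x (\<xi> z) (\<xi> z) = (-1) *\<^sub>T x +\<^sub>T \<eta> z x *\<^sub>T \<xi> z" .
  show ?thesis
    unfolding curvature_def e L.metric_linear[OF z x S_xi_tangent[OF z] w] metric_xi[OF z w] by simp
qed

end

section \<open>Sectional and scalar curvatures\<close>

context manifold
begin

lemma linear_map_sum:
  fixes l :: "('m, 'e) tvec \<Rightarrow> real"
  assumes e: "\<And>i. i \<in> I \<Longrightarrow> e i \<in> Tan p" and "finite I"
    and l: "\<And>x y a b. x \<in> Tan p \<Longrightarrow> y \<in> Tan p \<Longrightarrow>
      l (a *\<^sub>T x +\<^sub>T b *\<^sub>T y) = a * l x + b * l y"
  shows "(\<lambda>c. \<Sum>i\<in>I. a i *\<^sub>R e i c) \<in> Tan p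
    \<and> l (\<lambda>c. \<Sum>i\<in>I. a i *\<^sub>R e i c) = (\<Sum>i\<in>I. a i * l (e i))"
  using assms(2) e
proof (induction I rule: finite_induct)
  case empty
  have z: "(\<lambda>c. \<Sum>i\<in>{}. a i *\<^sub>R e i c) = tzero" by (simp add: tzero_def)
  have "l tzero = 0" using l[OF tangent_zero tangent_zero, of 0 0] by simp
  then show ?case unfolding z using tangent_zero by simp
next
  case (insert i I)
  let ?s = "\<lambda>c. \<Sum>i\<in>I. a i *\<^sub>R e i c"
  have s: "?s \<in> Tan p" and ls: "l ?s = (\<Sum>i\<in>I. a i * l (e i))"
    using insert by auto
  have ei: "e i \<in> Tan p" using insert.prems by simp
  have eq: "(\<lambda>c. \<Sum>i\<in>insert i I. a i *\<^sub>R e i c) = a i *\<^sub>T e i +\<^sub>T 1 *\<^sub>T ?s"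
    using insert.hyps by (simp add: fun_eq_iff)
  show ?case
    unfolding eq l[OF ei s] using tangent_add[OF tangent_scale[OF ei, of "a i"] tangent_scale[OF s, of 1]] ls insert.hyps
    by simp
qed

end

text \<open>
  If \<open>N\<close> expresses the orthonormal family \<open>E\<close> through the basis \<open>e\<close> and \<open>G\<close> is the Gram matrix of \<open>e\<close>,
  then \<open>N G N\<^sup>T = I\<close>, that is \<open>G\<^sup>-\<^sup>1 = N\<^sup>T N\<close>.  The two families have the same index type, so \<open>N\<close> is
  square and its one-sided inverse is two-sided.
\<close>
lemma (in riemannian_manifold) trace_orthonormal:
  fixes e E :: "'i::finite \<Rightarrow> ('m, 'e) tvec"
  assumes p: "p \<in> topspace T" and e: "tangent_basis A p e"
    and E: "\<And>a. E a \<in> Tan p"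
    and orth: "\<And>a b. g p (E a) (E b) = (if a = b then 1 else 0)"
    and left: "\<And>x y z a b. x \<in> Tan p \<Longrightarrow> y \<in> Tan p \<Longrightarrow> z \<in> Tan p \<Longrightarrow>
      B (a *\<^sub>T x +\<^sub>T b *\<^sub>T y) z = a * B x z + b * B y z"
    and right: "\<And>x y z a b. x \<in> Tan p \<Longrightarrow> y \<in> Tan p \<Longrightarrow> z \<in> Tan p \<Longrightarrow>
      B z (a *\<^sub>T x +\<^sub>T b *\<^sub>T y) = a * B z x + b * B z y"
  shows "(\<Sum>i\<in>UNIV. \<Sum>j\<in>UNIV. inverse_metric g p e $ i $ j * B (e i) (e j)) = (\<Sum>a\<in>UNIV. B (E a) (E a))"
proof -
  have et: "e i \<in> Tan p" for i using e by (simp add: tangent_basis_def)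
  have "\<exists>n. E a = (\<lambda>c. \<Sum>i\<in>UNIV. n i *\<^sub>R e i c)" for a
    using e E[of a] unfolding tangent_basis_def by blast
  then obtain n where n: "\<And>a. E a = (\<lambda>c. \<Sum>i\<in>UNIV. n a i *\<^sub>R e i c)" by metis
  define N where "N = (\<chi> a i. n a i)"
  define G where "G = (\<chi> i j. g p (e i) (e j))"
  have bilin: "B' (E a) (E b) = (\<Sum>i\<in>UNIV. \<Sum>j\<in>UNIV. n a i * n b j * B' (e i) (e j))"
    if l: "\<And>x y z a b. x \<in> Tan p \<Longrightarrow> y \<in> Tan p \<Longrightarrow> z \<in> Tan p \<Longrightarrow>
        B' (a *\<^sub>T x +\<^sub>T b *\<^sub>T y) z = a * B' x z + b * B' y z"
      and r: "\<And>x y z a b. x \<in> Tan p \<Longrightarrow> y \<in> Tan p \<Longrightarrow> z \<in> Tan p \<Longrightarrow>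
        B' z (a *\<^sub>T x +\<^sub>T b *\<^sub>T y) = a * B' z x + b * B' z y"
    for B' a b
  proof -
    have "B' (E a) (E b) = (\<Sum>i\<in>UNIV. n a i * B' (e i) (E b))"
      unfolding n[of a]
      by (rule linear_map_sum[where l="\<lambda>x. B' x (E b)" and p=p, THEN conjunct2]) (simp_all only: et finite l E)
    also have "\<dots> = (\<Sum>i\<in>UNIV. n a i * (\<Sum>j\<in>UNIV. n b j * B' (e i) (e j)))"
    proof (rule sum.cong[OF refl])
      fix i
      have "B' (e i) (E b) = (\<Sum>j\<in>UNIV. n b j * B' (e i) (e j))"
        unfolding n[of b]
        by (rule linear_map_sum[where l="\<lambda>x. B' (e i) x" and p=p, THEN conjunct2]) (simp_all only: et finite r)
      then show "n a i * B' (e i) (E b) = n a i * (\<Sum>j\<in>UNIV. n b j * B' (e i) (e j))" by simp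
    qed
    finally show ?thesis by (simp add: sum_distrib_left mult.assoc)
  qed
  have "(\<Sum>i\<in>UNIV. \<Sum>j\<in>UNIV. n a i * n b j * g p (e i) (e j)) = (if a = b then 1 else 0)" for a b
    using bilin[of "g p" a b] orth[of a b] metric_linear[OF p] metric_linear_right[OF p] by simp
  moreover have "(N ** (G ** transpose N)) $ a $ b = (\<Sum>i\<in>UNIV. \<Sum>j\<in>UNIV. n a i * n b j * g p (e i) (e j))" for a b
    by (simp add: matrix_matrix_mult_def N_def G_def transpose_def sum_distrib_left mult_ac)
  ultimately have NG: "N ** (G ** transpose N) = mat 1"
    by (simp add: vec_eq_iff mat_def)
  then have "(G ** transpose N) ** N = mat 1" using matrix_left_right_inverse by blast
  then have GNN: "G ** (transpose N ** N) = mat 1" by (simp add: matrix_mul_assoc)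
  then have NNG: "(transpose N ** N) ** G = mat 1" using matrix_left_right_inverse by blast
  have "G ** matrix_inv G = mat 1 \<and> matrix_inv G ** G = mat 1"
    unfolding matrix_inv_def
    by (rule someI[where P="\<lambda>X. G ** X = mat 1 \<and> X ** G = mat 1"]) (rule conjI[OF GNN NNG])
  then have "matrix_inv G = transpose N ** N"
    using GNN by (metis matrix_mul_assoc matrix_mul_lid matrix_mul_rid)
  then have inv: "inverse_metric g p e $ i $ j = (\<Sum>a\<in>UNIV. n a i * n a j)" for i j
    unfolding inverse_metric_def G_def[symmetric]
    by (simp add: matrix_matrix_mult_def N_def transpose_def)
  have "(\<Sum>i\<in>UNIV. \<Sum>j\<in>UNIV. inverse_metric g p e $ i $ j * B (e i) (e j))
     = (\<Sum>i\<in>UNIV. \<Sum>j\<in>UNIV. \<Sum>a\<in>UNIV. n a i * n a j * B (e i) (e j))"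
    by (simp add: inv sum_distrib_right)
  also have "\<dots> = (\<Sum>i\<in>UNIV. \<Sum>a\<in>UNIV. \<Sum>j\<in>UNIV. n a i * n a j * B (e i) (e j))"
    by (intro sum.cong refl sum.swap)
  also have "\<dots> = (\<Sum>a\<in>UNIV. \<Sum>i\<in>UNIV. \<Sum>j\<in>UNIV. n a i * n a j * B (e i) (e j))"
    by (rule sum.swap)
  also have "\<dots> = (\<Sum>a\<in>UNIV. B (E a) (E a))"
    by (rule sum.cong[OF refl], rule bilin[of B, symmetric], (rule left right; assumption)+)
  finally show ?thesis .
qed

context paracomplex_cone
begin

abbreviation "R \<equiv> curvature (S_top T) (S_atlas A) gS nabla"

lemma eta_metric: "z \<in> topspace (S_top T) \<Longrightarrow> w \<in> STan z \<Longrightarrow> gS z w (\<xi> z) = \<eta> z w"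
  using metric_xi[of z w] L.metric_sym[of z w "\<xi> z"] S_xi_tangent[of z] by simp

text \<open>
  Both the curvature and the Gram determinant of a plane are multiplied by \<open>a\<^sup>2\<close> when \<open>x\<close> is replaced
  by \<open>\<xi> = a x + b y\<close>, and for the plane spanned by \<open>\<xi>\<close> and \<open>y\<close> the claim is \<open>curvature_xi\<close>.
\<close>
lemma curvature_plane_xi:
  assumes z: "z \<in> topspace (S_top T)" and x: "x \<in> STan z" and y: "y \<in> STan z"
    and xi: "\<xi> z = a *\<^sub>T x +\<^sub>T b *\<^sub>T y" and "a \<noteq> 0"
  shows "R z x y y x = - (gS z x x * gS z y y - (gS z x y)\<^sup>2)"
proof -
  note t = S_xi_tangent[OF z]
  have d1: "R z v v u w = 0" if "v \<in> STan z" "u \<in> STan z" "w \<in> STan z" for v u w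
    using L.curvature_antisym_12[OF z that(1,1,2,3)] by simp
  have d2: "R z v u w w = 0" if "v \<in> STan z" "u \<in> STan z" "w \<in> STan z" for v u w
    using L.curvature_antisym_34[OF z that(1,2,3,3)] by simp
  have "R z (\<xi> z) y y (\<xi> z) = a * R z x y y (\<xi> z)"
    using L.curvature_linear_1[OF z x y y y t, of a b] d1[OF y y t] by (simp flip: xi)
  also have "R z x y y (\<xi> z) = a * R z x y y x"
    using L.curvature_linear_4[OF z x y y x y, of a b] d2[OF x y y] by (simp flip: xi)
  finally have "a\<^sup>2 * R z x y y x = R z (\<xi> z) y y (\<xi> z)" by (simp add: power2_eq_square)
  also have "\<dots> = R z y (\<xi> z) (\<xi> z) y"
    using L.curvature_antisym_12[OF z t y y t] L.curvature_antisym_34[OF z y t y t] by simp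
  also have "\<dots> = \<eta> z y * \<eta> z y - gS z y y" by (rule curvature_xi[OF z y y])
  also have "\<dots> = - (gS z (\<xi> z) (\<xi> z) * gS z y y - (gS z (\<xi> z) y)\<^sup>2)"
    using metric_xi[OF z t] metric_xi[OF z y] S_eta_xi[OF z] by (simp add: power2_eq_square)
  also have "gS z (\<xi> z) y = a * gS z x y + b * gS z y y"
    using L.metric_linear[OF z x y y, of a b] by (simp flip: xi)
  also have "gS z (\<xi> z) (\<xi> z) = a * (a * gS z x x + b * gS z x y) + b * (a * gS z x y + b * gS z y y)"
    using L.metric_linear[OF z x y t, of a b] L.metric_linear_right[OF z x y x, of a b]
      L.metric_linear_right[OF z x y y, of a b] L.metric_sym[OF z x y] by (simp flip: xi)
  finally have "a\<^sup>2 * R z x y y x = a\<^sup>2 * (- (gS z x x * gS z y y - (gS z x y)\<^sup>2))"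
    by (simp add: power2_eq_square algebra_simps)
  then show ?thesis using \<open>a \<noteq> 0\<close> unfolding mult_cancel_left by simp
qed

text \<open>
  One coefficient of \<open>\<xi> = a x + b y\<close> may vanish, but not both, and \<open>R (x, y, y, x)\<close> and the Gram
  determinant do not change when \<open>x\<close> and \<open>y\<close> are exchanged.
\<close>
lemma xi_sectional_curvature:
  assumes z: "z \<in> topspace (S_top T)" and plane: "plane_basis (S_atlas A) z x y"
    and xi: "\<xi> z \<in> tspan2 x y"
  shows "sectional_curvature (S_top T) (S_atlas A) gS nabla z x y = - 1"
proof -
  have x: "x \<in> STan z" and y: "y \<in> STan z" using plane by (auto simp: plane_basis_def)
  have indep: "a = 0 \<and> b = 0" if "a *\<^sub>T x +\<^sub>T b *\<^sub>T y = tzero" for a b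
    using plane that unfolding plane_basis_def by blast
  obtain a b where ab: "\<xi> z = a *\<^sub>T x +\<^sub>T b *\<^sub>T y" using xi unfolding tspan2_def by blast
  let ?D = "gS z x x * gS z y y - (gS z x y)\<^sup>2"
  have "a \<noteq> 0 \<or> b \<noteq> 0"
  proof (rule ccontr)
    assume "\<not> ?thesis"
    then have "\<xi> z = tzero" using ab by simp
    then show False
      using S_eta_xi[OF z] S_eta_linear[OF z S.tangent_zero S.tangent_zero, of 0 0] by simp
  qed
  moreover have "R z x y y x = - ?D" if "a \<noteq> 0"
    by (rule curvature_plane_xi[OF z x y ab that])
  moreover have "R z x y y x = - ?D" if "b \<noteq> 0"
  proof -
    have "\<xi> z = b *\<^sub>T y +\<^sub>T a *\<^sub>T x" using ab by (simp add: fun_eq_iff add.commute)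
    from curvature_plane_xi[OF z y x this that]
    have "R z y x x y = - (gS z y y * gS z x x - (gS z y x)\<^sup>2)" .
    moreover have "R z y x x y = R z x y y x"
      using L.curvature_antisym_12[OF z x y y x] L.curvature_antisym_34[OF z y x y x] by simp
    ultimately show ?thesis using L.metric_sym[OF z x y] by (simp add: mult.commute)
  qed
  ultimately have R: "R z x y y x = - ?D" by blast
  have "y \<noteq> tzero" using indep[of 0 1] by auto
  then have yy: "gS z y y > 0" by (rule L.metric_pos[OF z y])
  \<comment> \<open>the component of \<open>x\<close> orthogonal to \<open>y\<close>, up to the factor \<open>g (y, y)\<close>\<close>
  let ?w = "gS z y y *\<^sub>T x +\<^sub>T (- gS z x y) *\<^sub>T y"
  have w: "?w \<in> STan z" by (rule S.tangent_add[OF S.tangent_scale[OF x] S.tangent_scale[OF y]])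
  have "?w \<noteq> tzero" using indep yy by fastforce
  then have "gS z ?w ?w > 0" by (rule L.metric_pos[OF z w])
  also have "gS z ?w ?w = gS z y y * ?D"
    unfolding L.metric_linear[OF z x y w] L.metric_linear_right[OF z x y x] L.metric_linear_right[OF z x y y]
    using L.metric_sym[OF z x y] by (simp add: power2_eq_square algebra_simps)
  finally have "?D > 0" using yy by (simp add: zero_less_mult_iff)
  moreover have "- d / d = -1" if "d > 0" for d :: real using that by simp
  ultimately show ?thesis unfolding sectional_curvature_def R by blast
qed

theorem xi_sectional_S: "constant_negative_xi_sectional (S_top T) (S_atlas A) \<xi> gS nabla"
  unfolding constant_negative_xi_sectional_def
  by (rule exI[of _ "-1"]) (use xi_sectional_curvature in simp)

lemma unit_eigenvector:
  assumes z: "z \<in> topspace (S_top T)" and x: "x \<in> Tan (snd z)" "x \<noteq> tzero"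
    and P: "P (snd z) x = s *\<^sub>T x"
  shows "\<exists>r. gS z (S_vec A z (r *\<^sub>T x) 0) (S_vec A z (r *\<^sub>T x) 0) = 1
    \<and> \<phi> z (S_vec A z (r *\<^sub>T x) 0) = s *\<^sub>T S_vec A z (r *\<^sub>T x) 0"
proof -
  let ?v = "S_vec A z x 0"
  have v: "?v \<in> STan z" by (rule S_vec_tangent[OF z x(1)])
  have sc: "S_vec A z (r *\<^sub>T y) 0 = r *\<^sub>T S_vec A z y 0" for r y
    by (auto simp: fun_eq_iff S_vec_def)
  have N: "N_part ?v = x" by (rule N_part_S_vec[OF z x(1)])
  have "?v \<noteq> tzero"
  proof
    assume 0: "?v = tzero"
    have "N_part ?v = tzero" unfolding 0 by (simp add: N_part_apply fun_eq_iff)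
    then show False using N x(2) by simp
  qed
  then have pos: "gS z ?v ?v > 0" by (rule L.metric_pos[OF z v])
  let ?r = "1 / sqrt (gS z ?v ?v)"
  have "gS z (?r *\<^sub>T ?v) (?r *\<^sub>T ?v) = ?r * (?r * gS z ?v ?v)"
    unfolding L.metric_scale[OF z v S.tangent_scale[OF v]] L.metric_scale_right[OF z v v] ..
  also have "\<dots> = 1" using pos by simp
  finally have 1: "gS z (?r *\<^sub>T ?v) (?r *\<^sub>T ?v) = 1" .
  have "\<phi> z (?r *\<^sub>T ?v) = ?r *\<^sub>T \<phi> z ?v" using phi_linear[OF z v v, of ?r 0] by simp
  also have "\<phi> z ?v = s *\<^sub>T ?v" unfolding S_phi_def N P sc ..
  also have "?r *\<^sub>T s *\<^sub>T ?v = s *\<^sub>T ?r *\<^sub>T ?v" by (simp add: fun_eq_iff)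
  finally have 2: "\<phi> z (?r *\<^sub>T ?v) = s *\<^sub>T ?r *\<^sub>T ?v" .
  show ?thesis by (rule exI[of _ ?r]) (use 1 2 in \<open>simp only: sc\<close>)
qed

text \<open>
  The lifts of the two eigenvectors of \<open>P\<close> are orthogonal: \<open>\<phi>\<close> preserves their inner product and also
  changes its sign.
\<close>
lemma adapted_frame:
  assumes z: "z \<in> topspace (S_top T)"
  obtains u v where "u \<in> STan z" "v \<in> STan z" "\<phi> z u = u" "\<phi> z v = (-1) *\<^sub>T v"
    "gS z u u = 1" "gS z v v = 1" "gS z u v = 0" "\<eta> z u = 0" "\<eta> z v = 0"
proof -
  note p = topspace_SD(2)[OF z]
  obtain x y where x: "x \<in> Tan (snd z)" "x \<noteq> tzero" "P (snd z) x = x"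
    and y: "y \<in> Tan (snd z)" "y \<noteq> tzero" "P (snd z) y = (-1) *\<^sub>T y"
    using P_eigenvectors[OF p] by blast
  have "P (snd z) x = 1 *\<^sub>T x" using x(3) by simp
  from unit_eigenvector[OF z x(1,2) this] obtain r where
    r: "gS z (S_vec A z (r *\<^sub>T x) 0) (S_vec A z (r *\<^sub>T x) 0) = 1"
      "\<phi> z (S_vec A z (r *\<^sub>T x) 0) = 1 *\<^sub>T S_vec A z (r *\<^sub>T x) 0" by blast
  from unit_eigenvector[OF z y] obtain s where
    s: "gS z (S_vec A z (s *\<^sub>T y) 0) (S_vec A z (s *\<^sub>T y) 0) = 1"
      "\<phi> z (S_vec A z (s *\<^sub>T y) 0) = (-1) *\<^sub>T S_vec A z (s *\<^sub>T y) 0" by blast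
  let ?u = "S_vec A z (r *\<^sub>T x) 0" and ?v = "S_vec A z (s *\<^sub>T y) 0"
  have u: "?u \<in> STan z" and v: "?v \<in> STan z"
    by (rule S_vec_tangent[OF z tangent_scale[OF x(1)]], rule S_vec_tangent[OF z tangent_scale[OF y(1)]])
  have eu: "\<eta> z ?u = 0" and ev: "\<eta> z ?v = 0"
    by (rule S_eta_S_vec[OF z tangent_scale[OF x(1)]], rule S_eta_S_vec[OF z tangent_scale[OF y(1)]])
  have "gS z ?u ?v = gS z (\<phi> z ?u) (\<phi> z ?v)" using S_metric_phi[OF z u v] eu ev by simp
  also have "\<dots> = - gS z ?u ?v" unfolding r(2) s(2) L.metric_scale_right[OF z v S.tangent_scale[OF u]] by simp
  finally have "gS z ?u ?v = 0" by simp
  then show ?thesis using that[OF u v] r s eu ev by simp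
qed

text \<open>
  In the frame \<open>u, v, \<xi>\<close> with \<open>\<phi> u = u\<close>, \<open>\<phi> v = - v\<close>, \<open>\<phi> \<xi> = 0\<close> the double trace of
  \<open>R (\<cdot>, \<cdot>, \<cdot>, \<phi> \<cdot>)\<close> is \<open>(K(u, v) + K(u, \<xi>)) - (K(v, u) + K(v, \<xi>))\<close>.  It vanishes because all
  \<open>\<xi>\<close>-sectional curvatures agree.
\<close>
theorem star_scalar_flat_S:
  fixes e :: "3 \<Rightarrow> (real \<times> 'm, real \<times> 'e) tvec"
  assumes z: "z \<in> topspace (S_top T)" and e: "tangent_basis (S_atlas A) z e"
  shows "star_scalar (S_top T) (S_atlas A) \<phi> gS nabla z e = 0"
proof -
  obtain u v where u: "u \<in> STan z" and v: "v \<in> STan z" and phi: "\<phi> z u = u" "\<phi> z v = (-1) *\<^sub>T v"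
    and g: "gS z u u = 1" "gS z v v = 1" "gS z u v = 0" and eta: "\<eta> z u = 0" "\<eta> z v = 0"
    using adapted_frame[OF z] .
  note t = S_xi_tangent[OF z]
  define E where "E = (\<lambda>i::3. if i = 1 then u else if i = 2 then v else \<xi> z)"
  have E123: "E 1 = u" "E 2 = v" "E 3 = \<xi> z" by (simp_all add: E_def)
  have E: "E a \<in> STan z" for a using u v t by (simp add: E_def)
  have orth: "gS z (E a) (E b) = (if a = b then 1 else 0)" for a b
  proof -
    have "gS z (\<xi> z) (\<xi> z) = 1" using metric_xi[OF z t] S_eta_xi[OF z] by simp
    moreover have "gS z v u = 0" using L.metric_sym[OF z u v] g by simp
    moreover have "gS z (\<xi> z) u = 0" "gS z (\<xi> z) v = 0" "gS z u (\<xi> z) = 0" "gS z v (\<xi> z) = 0"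
      using metric_xi[OF z u] metric_xi[OF z v] eta_metric[OF z u] eta_metric[OF z v] eta by simp_all
    moreover have "a = 1 \<or> a = 2 \<or> a = 3" "b = 1 \<or> b = 2 \<or> b = 3" using exhaust_3 by auto
    ultimately show ?thesis using g E123 by auto
  qed
  note ft = phi_tangent[OF z]
  have ricci: "star_ricci (S_top T) (S_atlas A) \<phi> gS nabla z e x y = (\<Sum>a\<in>UNIV. R z (E a) x y (\<phi> z (E a)))"
    if x: "x \<in> STan z" and y: "y \<in> STan z" for x y
    unfolding star_ricci_def
  proof (rule L.trace_orthonormal[OF z e E orth, where B="\<lambda>r s. R z r x y (\<phi> z s)"])
    show "R z (a *\<^sub>T q +\<^sub>T b *\<^sub>T r) x y (\<phi> z s) = a * R z q x y (\<phi> z s) + b * R z r x y (\<phi> z s)"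
      if "q \<in> STan z" "r \<in> STan z" "s \<in> STan z" for q r s a b
      by (rule L.curvature_linear_1[OF z that(1,2) x y ft[OF that(3)]])
    show "R z s x y (\<phi> z (a *\<^sub>T q +\<^sub>T b *\<^sub>T r)) = a * R z s x y (\<phi> z q) + b * R z s x y (\<phi> z r)"
      if "q \<in> STan z" "r \<in> STan z" "s \<in> STan z" for q r s a b
      unfolding phi_linear[OF z that(1,2)]
      by (rule L.curvature_linear_4[OF z that(3) x y ft[OF that(1)] ft[OF that(2)]])
  qed
  have et: "e i \<in> STan z" for i using e by (simp add: tangent_basis_def)
  have "star_scalar (S_top T) (S_atlas A) \<phi> gS nabla z e
     = (\<Sum>i\<in>UNIV. \<Sum>j\<in>UNIV. inverse_metric gS z e $ i $ j * (\<Sum>a\<in>UNIV. R z (E a) (e i) (e j) (\<phi> z (E a))))"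
    unfolding star_scalar_def by (simp only: ricci[OF et et])
  also have "\<dots> = (\<Sum>b\<in>UNIV. \<Sum>a\<in>UNIV. R z (E a) (E b) (E b) (\<phi> z (E a)))"
  proof (rule L.trace_orthonormal[OF z e E orth, where B="\<lambda>x y. \<Sum>a\<in>UNIV. R z (E a) x y (\<phi> z (E a))"])
    show "(\<Sum>i\<in>UNIV. R z (E i) (a *\<^sub>T q +\<^sub>T b *\<^sub>T r) s (\<phi> z (E i)))
      = a * (\<Sum>i\<in>UNIV. R z (E i) q s (\<phi> z (E i))) + b * (\<Sum>i\<in>UNIV. R z (E i) r s (\<phi> z (E i)))"
      if "q \<in> STan z" "r \<in> STan z" "s \<in> STan z" for q r s a b
      unfolding L.curvature_linear_2[OF z E that ft[OF E]] by (simp add: sum.distrib sum_distrib_left)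
    show "(\<Sum>i\<in>UNIV. R z (E i) s (a *\<^sub>T q +\<^sub>T b *\<^sub>T r) (\<phi> z (E i)))
      = a * (\<Sum>i\<in>UNIV. R z (E i) s q (\<phi> z (E i))) + b * (\<Sum>i\<in>UNIV. R z (E i) s r (\<phi> z (E i)))"
      if "q \<in> STan z" "r \<in> STan z" "s \<in> STan z" for q r s a b
      unfolding L.curvature_linear_3[OF z E that(3,1,2) ft[OF E]] by (simp add: sum.distrib sum_distrib_left)
  qed
  also have "\<dots> = 0"
  proof -
    have zero: "R z q r s tzero = 0" and minus: "R z q r s ((-1) *\<^sub>T w) = - R z q r s w"
      if "q \<in> STan z" "r \<in> STan z" "s \<in> STan z" "w \<in> STan z" for q r s w
      using L.curvature_linear_4[OF z that(1-3) S.tangent_zero S.tangent_zero, of 0 0]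
        L.curvature_linear_4[OF z that(1-4) that(4), of "-1" 0] by simp_all
    have same: "R z q q s w = 0" if "q \<in> STan z" "s \<in> STan z" "w \<in> STan z" for q s w
      using L.curvature_antisym_12[OF z that(1,1,2,3)] by simp
    have sym: "R z v u u v = R z u v v u"
      using L.curvature_antisym_12[OF z u v v u] L.curvature_antisym_34[OF z v u v u] by simp
    show ?thesis
      unfolding sum_3 E123 phi phi_xi[OF z] zero[OF t u u t] zero[OF t v v t] zero[OF t t t t]
        minus[OF v u u v] minus[OF v v v v] minus[OF v t t v] same[OF u u u] same[OF v v v]
        curvature_xi[OF z u u] curvature_xi[OF z v v] g eta sym
      by simp
  qed
  finally show ?thesis .
qed

end

theorem proposition3p3:
  fixes T :: "'n topology" and A :: "('n, real ^ 2) chart set"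
    and P :: "'n \<Rightarrow> ('n, real ^ 2) tvec \<Rightarrow> ('n, real ^ 2) tvec"
    and h :: "('n, real ^ 2) form2"
    and nabla :: "(real \<times> 'n, real \<times> (real ^ 2)) vfield \<Rightarrow>
      (real \<times> 'n, real \<times> (real ^ 2)) vfield \<Rightarrow> (real \<times> 'n, real \<times> (real ^ 2)) vfield"
  assumes "almost_paracomplex_riemannian T A P h"
    and "levi_civita (S_top T) (S_atlas A) (S_metric A P h) nabla"
  shows "apapR_manifold (S_top T) (S_atlas A) (S_phi A P) (S_xi A) (S_eta A) (S_metric A P h) \<and>
    constant_negative_xi_sectional (S_top T) (S_atlas A) (S_xi A) (S_metric A P h) nabla \<and>
    (\<forall>z\<in>topspace (S_top T). \<forall>e :: 3 \<Rightarrow> (real \<times> 'n, real \<times> (real ^ 2)) tvec.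
       tangent_basis (S_atlas A) z e \<longrightarrow>
       star_scalar (S_top T) (S_atlas A) (S_phi A P) (S_metric A P h) nabla z e = 0)"
proof -
  have "smooth_manifold T A" "riemannian_metric T A h"
    using assms(1) by (auto simp: almost_paracomplex_riemannian_def)
  then interpret paracomplex_cone T A h P nabla
    using assms by unfold_locales
  show ?thesis using apapR_S xi_sectional_S star_scalar_flat_S by blast
qed

end
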